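(* Let $F$ be an almost h-conformal semi-invariant submersion, with dilation $\lambda$, from a hyperkähler manifold $(M,I,J,K,g_M)$ onto a Riemannian manifold $(N,g_N)$ such that $(I,J,K)$ is an almost h-conformal semi-invariant basis. For $R\in\{I,J,K\}$ let $(P_R)$ be the following condition: for all $X,Y\in\Gamma((\ker F_* )^{\perp})$ and $V\in\Gamma(\mathcal{D}_2^R)$, $$\mathcal{A}_XC_RY+\mathcal{V}\nabla_XB_RY\in\Gamma(\mathcal{D}_2^R)$$ and $$g_N(\nabla^F_XF_*RV,\,F_*C_RY)=\lambda^2g_M\big(\mathcal{A}_XB_RY-(C_RY)(\ln\lambda)\,X+g_M(X,C_RY)\nabla(\ln\lambda),\,RV\big).$$ Then the following conditions are equivalent: (a) the distribution $(\ker F_* )^{\perp}$ defines a totally geodesic foliation on $M$; (b) $(P_I)$ holds; (c) $(P_J)$ holds; (d) $(P_K)$ holds.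
   Context: All manifolds and maps are $C^\infty$; $\Gamma(\cdot)$ denotes smooth sections. A hyperkähler manifold $(M,I,J,K,g_M)$ is a Riemannian manifold with global sections $I,J,K$ of $\mathrm{End}(TM)$ satisfying $I^2=J^2=K^2=-\mathrm{id}$, $IJ=-JI=K$, $JK=-KJ=I$, $KI=-IK=J$, $g_M(RX,RY)=g_M(X,Y)$ and $\nabla R=0$ for $R\in\{I,J,K\}$, where $\nabla$ is the Levi-Civita connection of $g_M$. A horizontally conformal submersion $F:(M,g_M)\to(N,g_N)$ with dilation $\lambda:M\to(0,\infty)$ is a surjective submersion with $g_N(F_*X,F_*Y)=\lambda^2g_M(X,Y)$ for all $X,Y\in(\ker F_* )^{\perp}$. It is an almost h-conformal semi-invariant submersion with almost h-conformal semi-invariant basis $(I,J,K)$ if for each $R\in\{I,J,K\}$ there is a distribution $\mathcal{D}_1^R\subset\ker F_*$ such that $\ker F_*=\mathcal{D}_1^R\oplus\mathcal{D}_2^R$, $R(\mathcal{D}_1^R)=\mathcal{D}_1^R$, $R(\mathcal{D}_2^R)\subset(\ker F_* )^{\perp}$, where $\mathcal{D}_2^R$ is the orthogonal complement of $\mathcal{D}_1^R$ in $\ker F_*$. Let $\mu^R$ be the orthogonal complement of $R\mathcal{D}_2^R$ in $(\ker F_* )^{\perp}$ (it is $R$-invariant). For $Z\in\Gamma((\ker F_* )^{\perp})$ write $RZ=B_RZ+C_RZ$ with $B_RZ\in\Gamma(\mathcal{D}_2^R)$, $C_RZ\in\Gamma(\mu^R)$. $\mathcal{V},\mathcal{H}$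 denote the orthogonal projections of $TM$ onto $\ker F_*$ and $(\ker F_* )^{\perp}$. The O'Neill tensor is $\mathcal{A}_EG=\mathcal{H}\nabla_{\mathcal{H}E}\mathcal{V}G+\mathcal{V}\nabla_{\mathcal{H}E}\mathcal{H}G$. $\nabla^F$ is the pullback connection on $F^{*}TN$, $\nabla(\ln\lambda)$ is the gradient of $\ln\lambda$ with respect to $g_M$, and $Z(\ln\lambda)$ is the derivative of $\ln\lambda$ along $Z$. A distribution $\mathcal{D}$ defines a totally geodesic foliation on $M$ if $\nabla_XY\in\Gamma(\mathcal{D})$ for all $X,Y\in\Gamma(\mathcal{D})$. *)

theory Defs
  imports "HOL-Analysis.Analysis" "HOL-Library.Function_Algebras"
begin

text \<open>Real-valued functions, tangent vectors and vector fields below are all functions;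
  they are added (via \<open>Function_Algebras\<close>) and scaled pointwise.\<close>

instantiation "fun" :: (type, real_vector) real_vector
begin

definition scaleR_fun :: "real \<Rightarrow> ('a \<Rightarrow> 'b) \<Rightarrow> 'a \<Rightarrow> 'b"
  where "scaleR_fun a f = (\<lambda>x. a *\<^sub>R f x)"

instance
  by standard (simp_all add: scaleR_fun_def plus_fun_def fun_eq_iff scaleR_add_right scaleR_add_left)

end


section \<open>Smooth manifolds\<close>

text \<open>To be used for open sets \<open>S\<close> in a finite-dimensional space, where it is \<open>k\<close>-fold
  continuous differentiability.\<close>

primrec Ck_on :: "nat \<Rightarrow> 'a::real_normed_vector set \<Rightarrow> ('a \<Rightarrow> 'b::real_normed_vector) \<Rightarrow> bool"
  where
    "Ck_on 0 S f \<longleftrightarrow> continuous_on S f"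
  | "Ck_on (Suc k) S f \<longleftrightarrow> (\<forall>x\<in>S. f differentiable (at x)) \<and>
       (\<forall>v. Ck_on k S (\<lambda>x. frechet_derivative f (at x) v))"

definition smooth_on :: "'a::real_normed_vector set \<Rightarrow> ('a \<Rightarrow> 'b::real_normed_vector) \<Rightarrow> bool"
  where "smooth_on S f \<longleftrightarrow> (\<forall>k. Ck_on k S f)"

type_synonym ('m, 'e) chart = "'m set \<times> ('m \<Rightarrow> 'e)"

abbreviation chart_inv :: "('m, 'e) chart \<Rightarrow> 'e \<Rightarrow> 'm"
  where "chart_inv c \<equiv> inv_into (fst c) (snd c)"

text \<open>The manifold is the whole Hausdorff, second countable space \<open>'m\<close>; \<open>\<A>\<close> is an atlas, not
  necessarily maximal. The model space \<open>'e\<close> is a finite-dimensional inner product space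
  rather than of class \<open>euclidean_space\<close>, since the latter excludes dimension 0.\<close>

definition smooth_manifold ::
    "('m::{t2_space, second_countable_topology}, 'e::real_inner) chart set \<Rightarrow> bool"
  where "smooth_manifold \<A> \<longleftrightarrow>
    (\<exists>B::'e set. finite B \<and> span B = UNIV) \<and>
    (\<Union>c\<in>\<A>. fst c) = UNIV \<and>
    (\<forall>c\<in>\<A>. open (fst c) \<and> open (snd c ` fst c) \<and>
       homeomorphism (fst c) (snd c ` fst c) (snd c) (chart_inv c)) \<and>
    (\<forall>c\<in>\<A>. \<forall>d\<in>\<A>. smooth_on (snd c ` (fst c \<inter> fst d)) (snd d \<circ> chart_inv c))"

definition smooth_functions :: "('m, 'e::real_inner) chart set \<Rightarrow> ('m \<Rightarrow> real) set"
  where "smooth_functions \<A> = {f. \<forall>c\<in>\<A>. smooth_on (snd c ` fst c) (f \<circ> chart_inv c)}"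

definition smooth_map ::
    "('m::topological_space, 'e::real_inner) chart set \<Rightarrow>
     ('n::topological_space, 'd::real_inner) chart set \<Rightarrow> ('m \<Rightarrow> 'n) \<Rightarrow> bool"
  where "smooth_map \<A> \<B> F \<longleftrightarrow> continuous_on UNIV F \<and>
    (\<forall>c\<in>\<A>. \<forall>d\<in>\<B>. smooth_on (snd c ` (fst c \<inter> F -` fst d)) (snd d \<circ> F \<circ> chart_inv c))"


section \<open>Tangent vectors and vector fields\<close>

type_synonym 'm tangent = "('m \<Rightarrow> real) \<Rightarrow> real"

text \<open>Tangent vectors at \<open>p\<close> are derivations at \<open>p\<close> of the algebra of smooth functions. The value 0
  on non-smooth arguments makes them extensional.\<close>

definition tangent_space :: "('m, 'e::real_inner) chart set \<Rightarrow> 'm \<Rightarrow> 'm tangent set"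
  where "tangent_space \<A> p = {v.
    (\<forall>f\<in>smooth_functions \<A>. \<forall>h\<in>smooth_functions \<A>. v (f + h) = v f + v h) \<and>
    (\<forall>f\<in>smooth_functions \<A>. \<forall>a. v (a *\<^sub>R f) = a * v f) \<and>
    (\<forall>f\<in>smooth_functions \<A>. \<forall>h\<in>smooth_functions \<A>. v (f * h) = f p * v h + h p * v f) \<and>
    (\<forall>f. f \<notin> smooth_functions \<A> \<longrightarrow> v f = 0)}"

definition vector_fields :: "('m, 'e::real_inner) chart set \<Rightarrow> ('m \<Rightarrow> 'm tangent) set"
  where "vector_fields \<A> = {X. (\<forall>p. X p \<in> tangent_space \<A> p) \<and>
    (\<forall>f\<in>smooth_functions \<A>. (\<lambda>p. X p f) \<in> smooth_functions \<A>)}"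

definition lie_bracket :: "('m \<Rightarrow> 'm tangent) \<Rightarrow> ('m \<Rightarrow> 'm tangent) \<Rightarrow> 'm \<Rightarrow> 'm tangent"
  where "lie_bracket X Y = (\<lambda>p f. X p (\<lambda>q. Y q f) - Y p (\<lambda>q. X q f))"

definition differential ::
    "('n, 'd::real_inner) chart set \<Rightarrow> ('m \<Rightarrow> 'n) \<Rightarrow> 'm tangent \<Rightarrow> 'n tangent"
  where "differential \<B> F v = (\<lambda>f. if f \<in> smooth_functions \<B> then v (f \<circ> F) else 0)"

text \<open>Smooth sections of the pullback bundle of the tangent bundle of the target of \<open>F\<close>.\<close>

definition pullback_sections ::
    "('m, 'e::real_inner) chart set \<Rightarrow> ('n, 'd::real_inner) chart set \<Rightarrow> ('m \<Rightarrow> 'n) \<Rightarrow>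
     ('m \<Rightarrow> 'n tangent) set"
  where "pullback_sections \<A> \<B> F = {S. (\<forall>p. S p \<in> tangent_space \<B> (F p)) \<and>
    (\<forall>f\<in>smooth_functions \<B>. (\<lambda>p. S p f) \<in> smooth_functions \<A>)}"


section \<open>Distributions\<close>

text \<open>A distribution is a smooth subbundle of the tangent bundle: it has smooth local frames.
  The frames are taken from globally defined vector fields; by means of cutoff functions
  this is no restriction.\<close>

definition distribution ::
    "('m::topological_space, 'e::real_inner) chart set \<Rightarrow> ('m \<Rightarrow> 'm tangent set) \<Rightarrow> bool"
  where "distribution \<A> D \<longleftrightarrow>
    (\<forall>p. \<exists>U. open U \<and> p \<in> U \<and>
      (\<exists>(k::nat) X. (\<forall>i<k. X i \<in> vector_fields \<A>) \<and>
        (\<forall>q\<in>U. inj_on (\<lambda>i. X i q) {..<k} \<and> independent ((\<lambda>i. X i q) ` {..<k}) \<and>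
          span ((\<lambda>i. X i q) ` {..<k}) = D q)))"

definition sections ::
    "('m, 'e::real_inner) chart set \<Rightarrow> ('m \<Rightarrow> 'm tangent set) \<Rightarrow> ('m \<Rightarrow> 'm tangent) set"
  where "sections \<A> D = {X \<in> vector_fields \<A>. \<forall>p. X p \<in> D p}"

definition direct_sum :: "'v::real_vector set \<Rightarrow> 'v set \<Rightarrow> 'v set \<Rightarrow> bool"
  where "direct_sum W A B \<longleftrightarrow> W = {a + b |a b. a \<in> A \<and> b \<in> B} \<and> A \<inter> B = {0}"

text \<open>The \<open>A\<close>-component of a vector field with values in the direct sum of \<open>A\<close> and \<open>B\<close>.\<close>

definition component ::
    "('m \<Rightarrow> 'v::real_vector set) \<Rightarrow> ('m \<Rightarrow> 'v set) \<Rightarrow> ('m \<Rightarrow> 'v) \<Rightarrow> 'm \<Rightarrow> 'v"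
  where "component A B X = (\<lambda>p. THE a. a \<in> A p \<and> (\<exists>b\<in>B p. X p = a + b))"


section \<open>Riemannian metrics and connections\<close>

type_synonym 'm metric = "'m \<Rightarrow> 'm tangent \<Rightarrow> 'm tangent \<Rightarrow> real"

definition riemannian_metric :: "('m, 'e::real_inner) chart set \<Rightarrow> 'm metric \<Rightarrow> bool"
  where "riemannian_metric \<A> g \<longleftrightarrow>
    (\<forall>p. \<forall>u\<in>tangent_space \<A> p. \<forall>v\<in>tangent_space \<A> p.
       g p u v = g p v u \<and>
       (\<forall>w\<in>tangent_space \<A> p. g p (u + v) w = g p u w + g p v w) \<and>
       (\<forall>a. g p (a *\<^sub>R u) v = a * g p u v) \<and>
       (u \<noteq> 0 \<longrightarrow> g p u u > 0)) \<and>
    (\<forall>X\<in>vector_fields \<A>. \<forall>Y\<in>vector_fields \<A>. (\<lambda>p. g p (X p) (Y p)) \<in> smooth_functions \<A>)"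

definition riemannian_manifold ::
    "('m::{t2_space, second_countable_topology}, 'e::real_inner) chart set \<Rightarrow> 'm metric \<Rightarrow> bool"
  where "riemannian_manifold \<A> g \<longleftrightarrow> smooth_manifold \<A> \<and> riemannian_metric \<A> g"

definition orth_complement ::
    "'m metric \<Rightarrow> ('m \<Rightarrow> 'm tangent set) \<Rightarrow> ('m \<Rightarrow> 'm tangent set) \<Rightarrow> 'm \<Rightarrow> 'm tangent set"
  where "orth_complement g W D = (\<lambda>p. {v \<in> W p. \<forall>w\<in>D p. g p v w = 0})"

definition gradient ::
    "('m, 'e::real_inner) chart set \<Rightarrow> 'm metric \<Rightarrow> ('m \<Rightarrow> real) \<Rightarrow> 'm \<Rightarrow> 'm tangent"
  where "gradient \<A> g f =
    (\<lambda>p. THE v. v \<in> tangent_space \<A> p \<and> (\<forall>w\<in>tangent_space \<A> p. g p v w = w f))"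

text \<open>Connections on a vector bundle over the manifold, given through its space \<open>\<Gamma>\<close> of smooth
  sections; only the values on smooth vector fields and smooth sections matter.\<close>

definition linear_connection ::
    "('m, 'e::real_inner) chart set \<Rightarrow> ('m \<Rightarrow> 'v::real_vector) set \<Rightarrow>
     (('m \<Rightarrow> 'm tangent) \<Rightarrow> ('m \<Rightarrow> 'v) \<Rightarrow> 'm \<Rightarrow> 'v) \<Rightarrow> bool"
  where "linear_connection \<A> \<Gamma> nab \<longleftrightarrow>
    (\<forall>X\<in>vector_fields \<A>. \<forall>S\<in>\<Gamma>.
       nab X S \<in> \<Gamma> \<and>
       (\<forall>Y\<in>vector_fields \<A>. nab (X + Y) S = nab X S + nab Y S) \<and>
       (\<forall>T\<in>\<Gamma>. nab X (S + T) = nab X S + nab X T) \<and>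
       (\<forall>f\<in>smooth_functions \<A>. nab (\<lambda>p. f p *\<^sub>R X p) S = (\<lambda>p. f p *\<^sub>R nab X S p)) \<and>
       (\<forall>f\<in>smooth_functions \<A>.
          nab X (\<lambda>p. f p *\<^sub>R S p) = (\<lambda>p. X p f *\<^sub>R S p + f p *\<^sub>R nab X S p)))"

type_synonym 'm connection = "('m \<Rightarrow> 'm tangent) \<Rightarrow> ('m \<Rightarrow> 'm tangent) \<Rightarrow> 'm \<Rightarrow> 'm tangent"

definition levi_civita :: "('m, 'e::real_inner) chart set \<Rightarrow> 'm metric \<Rightarrow> 'm connection \<Rightarrow> bool"
  where "levi_civita \<A> g nab \<longleftrightarrow>
    linear_connection \<A> (vector_fields \<A>) nab \<and>
    (\<forall>X\<in>vector_fields \<A>. \<forall>Y\<in>vector_fields \<A>. nab X Y - nab Y X = lie_bracket X Y) \<and>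
    (\<forall>X\<in>vector_fields \<A>. \<forall>Y\<in>vector_fields \<A>. \<forall>Z\<in>vector_fields \<A>. \<forall>p.
       X p (\<lambda>q. g q (Y q) (Z q)) = g p (nab X Y p) (Z p) + g p (Y p) (nab X Z p))"

text \<open>In the second conjunct \<open>V\<close> is any extension of the vector \<open>F\<^sub>* X\<close> at \<open>F p\<close>; a connection on the
  tangent bundle depends on its direction argument only pointwise.\<close>

definition pullback_connection ::
    "('m, 'e::real_inner) chart set \<Rightarrow> ('n, 'd::real_inner) chart set \<Rightarrow> ('m \<Rightarrow> 'n) \<Rightarrow>
     'n connection \<Rightarrow> (('m \<Rightarrow> 'm tangent) \<Rightarrow> ('m \<Rightarrow> 'n tangent) \<Rightarrow> 'm \<Rightarrow> 'n tangent) \<Rightarrow> bool"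
  where "pullback_connection \<A> \<B> F nabN nabF \<longleftrightarrow>
    linear_connection \<A> (pullback_sections \<A> \<B> F) nabF \<and>
    (\<forall>X\<in>vector_fields \<A>. \<forall>V\<in>vector_fields \<B>. \<forall>W\<in>vector_fields \<B>. \<forall>p.
       V (F p) = differential \<B> F (X p) \<longrightarrow> nabF X (W \<circ> F) p = nabN V W (F p))"

definition totally_geodesic_foliation ::
    "('m, 'e::real_inner) chart set \<Rightarrow> 'm connection \<Rightarrow> ('m \<Rightarrow> 'm tangent set) \<Rightarrow> bool"
  where "totally_geodesic_foliation \<A> nab D \<longleftrightarrow>
    (\<forall>X\<in>sections \<A> D. \<forall>Y\<in>sections \<A> D. nab X Y \<in> sections \<A> D)"


section \<open>Hyperkaehler manifolds\<close>

type_synonym 'm endo = "'m \<Rightarrow> 'm tangent \<Rightarrow> 'm tangent"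

definition endo_field :: "('m, 'e::real_inner) chart set \<Rightarrow> 'm endo \<Rightarrow> bool"
  where "endo_field \<A> R \<longleftrightarrow>
    (\<forall>p. \<forall>u\<in>tangent_space \<A> p. R p u \<in> tangent_space \<A> p \<and>
       (\<forall>v\<in>tangent_space \<A> p. R p (u + v) = R p u + R p v) \<and>
       (\<forall>a. R p (a *\<^sub>R u) = a *\<^sub>R R p u)) \<and>
    (\<forall>X\<in>vector_fields \<A>. (\<lambda>p. R p (X p)) \<in> vector_fields \<A>)"

text \<open>An almost complex structure that is compatible with \<open>g\<close> and parallel for \<open>nab\<close>.\<close>

definition kaehler_structure ::
    "('m, 'e::real_inner) chart set \<Rightarrow> 'm metric \<Rightarrow> 'm connection \<Rightarrow> 'm endo \<Rightarrow> bool"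
  where "kaehler_structure \<A> g nab R \<longleftrightarrow>
    endo_field \<A> R \<and>
    (\<forall>p. \<forall>u\<in>tangent_space \<A> p. R p (R p u) = - u) \<and>
    (\<forall>p. \<forall>u\<in>tangent_space \<A> p. \<forall>v\<in>tangent_space \<A> p. g p (R p u) (R p v) = g p u v) \<and>
    (\<forall>X\<in>vector_fields \<A>. \<forall>Y\<in>vector_fields \<A>.
       nab X (\<lambda>p. R p (Y p)) = (\<lambda>p. R p (nab X Y p)))"

definition hyperkaehler ::
    "('m::{t2_space, second_countable_topology}, 'e::real_inner) chart set \<Rightarrow> 'm metric \<Rightarrow>
     'm connection \<Rightarrow> 'm endo \<Rightarrow> 'm endo \<Rightarrow> 'm endo \<Rightarrow> bool"
  where "hyperkaehler \<A> g nab I J K \<longleftrightarrow>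
    riemannian_manifold \<A> g \<and> levi_civita \<A> g nab \<and>
    (\<forall>R\<in>{I, J, K}. kaehler_structure \<A> g nab R) \<and>
    (\<forall>p. \<forall>u\<in>tangent_space \<A> p.
       I p (J p u) = K p u \<and> J p (I p u) = - K p u \<and>
       J p (K p u) = I p u \<and> K p (J p u) = - I p u \<and>
       K p (I p u) = J p u \<and> I p (K p u) = - J p u)"


section \<open>Horizontally conformal and semi-invariant submersions\<close>

definition vertical ::
    "('m, 'e::real_inner) chart set \<Rightarrow> ('n, 'd::real_inner) chart set \<Rightarrow> ('m \<Rightarrow> 'n) \<Rightarrow>
     'm \<Rightarrow> 'm tangent set"
  where "vertical \<A> \<B> F = (\<lambda>p. {v \<in> tangent_space \<A> p. differential \<B> F v = 0})"

definition horizontal ::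
    "('m, 'e::real_inner) chart set \<Rightarrow> 'm metric \<Rightarrow> ('n, 'd::real_inner) chart set \<Rightarrow> ('m \<Rightarrow> 'n) \<Rightarrow>
     'm \<Rightarrow> 'm tangent set"
  where "horizontal \<A> g \<B> F = orth_complement g (tangent_space \<A>) (vertical \<A> \<B> F)"

definition horizontally_conformal_submersion ::
    "('m::topological_space, 'e::real_inner) chart set \<Rightarrow> 'm metric \<Rightarrow>
     ('n::topological_space, 'd::real_inner) chart set \<Rightarrow> 'n metric \<Rightarrow>
     ('m \<Rightarrow> 'n) \<Rightarrow> ('m \<Rightarrow> real) \<Rightarrow> bool"
  where "horizontally_conformal_submersion \<A> gM \<B> gN F lam \<longleftrightarrow>
    smooth_map \<A> \<B> F \<and> surj F \<and>
    (\<forall>p. differential \<B> F ` tangent_space \<A> p = tangent_space \<B> (F p)) \<and>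
    lam \<in> smooth_functions \<A> \<and> (\<forall>p. lam p > 0) \<and>
    (\<forall>p. \<forall>u\<in>horizontal \<A> gM \<B> F p. \<forall>v\<in>horizontal \<A> gM \<B> F p.
       gN (F p) (differential \<B> F u) (differential \<B> F v) = (lam p)\<^sup>2 * gM p u v)"

text \<open>In the sequel \<open>D\<close> stands for \<open>\<D>\<^sub>1\<^sup>R\<close>.\<close>

definition D2 ::
    "('m, 'e::real_inner) chart set \<Rightarrow> 'm metric \<Rightarrow> ('n, 'd::real_inner) chart set \<Rightarrow> ('m \<Rightarrow> 'n) \<Rightarrow>
     ('m \<Rightarrow> 'm tangent set) \<Rightarrow> 'm \<Rightarrow> 'm tangent set"
  where "D2 \<A> g \<B> F D = orth_complement g (vertical \<A> \<B> F) D"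

definition mu ::
    "('m, 'e::real_inner) chart set \<Rightarrow> 'm metric \<Rightarrow> ('n, 'd::real_inner) chart set \<Rightarrow> ('m \<Rightarrow> 'n) \<Rightarrow>
     'm endo \<Rightarrow> ('m \<Rightarrow> 'm tangent set) \<Rightarrow> 'm \<Rightarrow> 'm tangent set"
  where "mu \<A> g \<B> F R D =
    orth_complement g (horizontal \<A> g \<B> F) (\<lambda>p. R p ` D2 \<A> g \<B> F D p)"

definition semi_invariant_distribution ::
    "('m::topological_space, 'e::real_inner) chart set \<Rightarrow> 'm metric \<Rightarrow>
     ('n, 'd::real_inner) chart set \<Rightarrow> ('m \<Rightarrow> 'n) \<Rightarrow> 'm endo \<Rightarrow> ('m \<Rightarrow> 'm tangent set) \<Rightarrow> bool"
  where "semi_invariant_distribution \<A> g \<B> F R D \<longleftrightarrow>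
    distribution \<A> D \<and>
    (\<forall>p. D p \<subseteq> vertical \<A> \<B> F p \<and>
         direct_sum (vertical \<A> \<B> F p) (D p) (D2 \<A> g \<B> F D p) \<and>
         R p ` D p = D p \<and>
         R p ` D2 \<A> g \<B> F D p \<subseteq> horizontal \<A> g \<B> F p)"

text \<open>The distributions \<open>\<D>\<^sub>1\<^sup>R\<close> for \<open>R = I, J, K\<close> are passed as \<open>DI\<close>, \<open>DJ\<close>, \<open>DK\<close>.\<close>

definition almost_h_conformal_semi_invariant_submersion ::
    "('m::topological_space, 'e::real_inner) chart set \<Rightarrow> 'm metric \<Rightarrow>
     ('n::topological_space, 'd::real_inner) chart set \<Rightarrow> 'n metric \<Rightarrow>
     ('m \<Rightarrow> 'n) \<Rightarrow> ('m \<Rightarrow> real) \<Rightarrow> 'm endo \<Rightarrow> 'm endo \<Rightarrow> 'm endo \<Rightarrow>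
     ('m \<Rightarrow> 'm tangent set) \<Rightarrow> ('m \<Rightarrow> 'm tangent set) \<Rightarrow> ('m \<Rightarrow> 'm tangent set) \<Rightarrow> bool"
  where "almost_h_conformal_semi_invariant_submersion \<A> gM \<B> gN F lam I J K DI DJ DK \<longleftrightarrow>
    horizontally_conformal_submersion \<A> gM \<B> gN F lam \<and>
    semi_invariant_distribution \<A> gM \<B> F I DI \<and>
    semi_invariant_distribution \<A> gM \<B> F J DJ \<and>
    semi_invariant_distribution \<A> gM \<B> F K DK"

definition vert_part ::
    "('m, 'e::real_inner) chart set \<Rightarrow> 'm metric \<Rightarrow> ('n, 'd::real_inner) chart set \<Rightarrow> ('m \<Rightarrow> 'n) \<Rightarrow>
     ('m \<Rightarrow> 'm tangent) \<Rightarrow> 'm \<Rightarrow> 'm tangent"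
  where "vert_part \<A> g \<B> F = component (vertical \<A> \<B> F) (horizontal \<A> g \<B> F)"

definition hor_part ::
    "('m, 'e::real_inner) chart set \<Rightarrow> 'm metric \<Rightarrow> ('n, 'd::real_inner) chart set \<Rightarrow> ('m \<Rightarrow> 'n) \<Rightarrow>
     ('m \<Rightarrow> 'm tangent) \<Rightarrow> 'm \<Rightarrow> 'm tangent"
  where "hor_part \<A> g \<B> F = component (horizontal \<A> g \<B> F) (vertical \<A> \<B> F)"

definition oneill_A ::
    "('m, 'e::real_inner) chart set \<Rightarrow> 'm metric \<Rightarrow> 'm connection \<Rightarrow>
     ('n, 'd::real_inner) chart set \<Rightarrow> ('m \<Rightarrow> 'n) \<Rightarrow> 'm connection"
  where "oneill_A \<A> g nab \<B> F E G =
    hor_part \<A> g \<B> F (nab (hor_part \<A> g \<B> F E) (vert_part \<A> g \<B> F G)) +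
    vert_part \<A> g \<B> F (nab (hor_part \<A> g \<B> F E) (hor_part \<A> g \<B> F G))"

definition B_part ::
    "('m, 'e::real_inner) chart set \<Rightarrow> 'm metric \<Rightarrow> ('n, 'd::real_inner) chart set \<Rightarrow> ('m \<Rightarrow> 'n) \<Rightarrow>
     'm endo \<Rightarrow> ('m \<Rightarrow> 'm tangent set) \<Rightarrow> ('m \<Rightarrow> 'm tangent) \<Rightarrow> 'm \<Rightarrow> 'm tangent"
  where "B_part \<A> g \<B> F R D Z =
    component (D2 \<A> g \<B> F D) (mu \<A> g \<B> F R D) (\<lambda>p. R p (Z p))"

definition C_part ::
    "('m, 'e::real_inner) chart set \<Rightarrow> 'm metric \<Rightarrow> ('n, 'd::real_inner) chart set \<Rightarrow> ('m \<Rightarrow> 'n) \<Rightarrow>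
     'm endo \<Rightarrow> ('m \<Rightarrow> 'm tangent set) \<Rightarrow> ('m \<Rightarrow> 'm tangent) \<Rightarrow> 'm \<Rightarrow> 'm tangent"
  where "C_part \<A> g \<B> F R D Z =
    component (mu \<A> g \<B> F R D) (D2 \<A> g \<B> F D) (\<lambda>p. R p (Z p))"

text \<open>The condition \<open>(P\<^sub>R)\<close>, with \<open>nabM\<close> the Levi-Civita connection of \<open>gM\<close> and \<open>nabF\<close> the pullback
  connection.\<close>

definition condition_P ::
    "('m, 'e::real_inner) chart set \<Rightarrow> 'm metric \<Rightarrow> 'm connection \<Rightarrow>
     ('n, 'd::real_inner) chart set \<Rightarrow> 'n metric \<Rightarrow>
     (('m \<Rightarrow> 'm tangent) \<Rightarrow> ('m \<Rightarrow> 'n tangent) \<Rightarrow> 'm \<Rightarrow> 'n tangent) \<Rightarrow>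
     ('m \<Rightarrow> 'n) \<Rightarrow> ('m \<Rightarrow> real) \<Rightarrow> 'm endo \<Rightarrow> ('m \<Rightarrow> 'm tangent set) \<Rightarrow> bool"
  where "condition_P \<A> gM nabM \<B> gN nabF F lam R D \<longleftrightarrow>
    (let H = horizontal \<A> gM \<B> F; D\<^sub>2 = D2 \<A> gM \<B> F D; \<V> = vert_part \<A> gM \<B> F;
         A = oneill_A \<A> gM nabM \<B> F; B = B_part \<A> gM \<B> F R D; C = C_part \<A> gM \<B> F R D;
         ln_lam = (\<lambda>p. ln (lam p))
     in \<forall>X\<in>sections \<A> H. \<forall>Y\<in>sections \<A> H. \<forall>V\<in>sections \<A> D\<^sub>2.
          A X (C Y) + \<V> (nabM X (B Y)) \<in> sections \<A> D\<^sub>2 \<and>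
          (\<forall>p. gN (F p) (nabF X (\<lambda>q. differential \<B> F (R q (V q))) p) (differential \<B> F (C Y p)) =
               (lam p)\<^sup>2 * gM p
                 (A X (B Y) p - C Y p ln_lam *\<^sub>R X p + gM p (X p) (C Y p) *\<^sub>R gradient \<A> gM ln_lam p)
                 (R p (V p))))"

end

theory Submission
  imports Defs
begin

text \<open>
  Let \<open>R\<close> be one of \<open>I\<close>, \<open>J\<close>, \<open>K\<close> and let \<open>X\<close>, \<open>Y\<close> be horizontal fields. Write \<open>\<D>\<^sub>1\<close>, \<open>\<D>\<^sub>2\<close> for the two
  distributions that belong to \<open>R\<close>, and \<open>R Y = B Y + C Y\<close> for the splitting of \<open>R Y\<close>, which turns out to
  be the one into vertical and horizontal parts. As \<open>R\<close> is parallel,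
  \<open>R (\<nabla>\<^sub>X Y) = \<nabla>\<^sub>X (B Y) + \<nabla>\<^sub>X (C Y)\<close>.

  The field in the first half of condition \<open>(P\<^sub>R)\<close> is the vertical part of this sum. It lies in \<open>\<D>\<^sub>2\<close> iff
  it is orthogonal to \<open>\<D>\<^sub>1\<close>, and since \<open>R\<close> is skew and preserves \<open>\<D>\<^sub>1\<close> this says that \<open>\<nabla>\<^sub>X Y\<close> is
  orthogonal to \<open>\<D>\<^sub>1\<close>. The second half says that \<open>\<nabla>\<^sub>X Y\<close> is orthogonal to \<open>\<D>\<^sub>2\<close>: for a section \<open>V\<close> of
  \<open>\<D>\<^sub>2\<close> one has \<open>g (\<nabla>\<^sub>X Y) V = g (\<nabla>\<^sub>X (B Y)) (R V) - g (C Y) (\<nabla>\<^sub>X (R V))\<close>, and the last term is computed on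
  the target by the formula for the second fundamental form of a horizontally conformal map. The
  kernel of \<open>F\<^sub>*\<close> being the sum of \<open>\<D>\<^sub>1\<close> and \<open>\<D>\<^sub>2\<close>, the two halves together say that \<open>\<nabla>\<^sub>X Y\<close> is horizontal,
  which is the condition for a totally geodesic foliation. That condition does not mention \<open>R\<close>, so
  the conditions for \<open>I\<close>, \<open>J\<close> and \<open>K\<close> are equivalent. These steps are \<open>first_condition_iff\<close>,
  \<open>second_condition_iff\<close> and \<open>totally_geodesic_iff_condition_P\<close>.

  The formula for the second fundamental form (\<open>second_fundamental_form_horizontal\<close>) is a comparison
  of two Koszul formulas. It rests on the facts that the pullback connection is torsion-free and
  metric (\<open>nabF_torsion\<close>, \<open>nabF_metric\<close>), which are computed in local frames.

  Most of the work lies in the smoothness statements behind this argument. Tangent vectors are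
  derivations of the algebra of global smooth functions, so cutoff functions (\<open>bump_exists\<close>) and
  Hadamard's lemma (\<open>hadamard\<close>) are needed to obtain coordinate frames (\<open>coordinate_frame_exists\<close>)
  and to extend vectors to fields. A smooth version of Gram-Schmidt (\<open>smooth_riesz\<close>) then produces
  gradients and shows that the horizontal part of a smooth field is smooth (\<open>hor_near\<close>). The latter
  also yields the sections of \<open>\<D>\<^sub>2\<close> through a given vector (\<open>D2_extend\<close>) that are needed to pass from
  the second half of \<open>(P\<^sub>R)\<close> to a pointwise statement.
\<close>

section \<open>Smooth functions on open sets\<close>

text \<open>The model space of a manifold is only known to be spanned by a finite set. All coordinates refer
  to an orthonormal basis in the following sense, which also fits the real line and the zero space.\<close>

definition onb :: "'e::real_inner set \<Rightarrow> bool"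
  where "onb B \<longleftrightarrow> finite B \<and> (\<forall>a\<in>B. \<forall>b\<in>B. inner a b = (if a = b then 1 else 0)) \<and>
    (\<forall>x. x = (\<Sum>b\<in>B. inner x b *\<^sub>R b))"

lemma onb_finite: "onb B \<Longrightarrow> finite B"
  and onb_inner: "onb B \<Longrightarrow> a \<in> B \<Longrightarrow> b \<in> B \<Longrightarrow> inner a b = (if a = b then 1 else 0)"
  and onb_expand: "onb B \<Longrightarrow> (\<Sum>b\<in>B. inner x b *\<^sub>R b) = x"
  by (auto simp: onb_def)

lemma onb_real: "onb {1::real}"
  by (auto simp: onb_def)

text \<open>Gram-Schmidt gives an orthogonal spanning set; it remains to discard the zero vector and to
  normalise. The expansion formula holds because the difference of its two sides is orthogonal
  to every basis vector.\<close>

lemma onb_exists: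
  assumes "finite (S::'e::real_inner set)" "span S = UNIV"
  shows "\<exists>B::'e set. onb B"
proof -
  obtain C where C: "finite C" "span C = span S" "pairwise orthogonal C"
    using basis_orthogonal[OF assms(1)] by auto
  define D where "D = C - {0}"
  define B where "B = (\<lambda>x. x /\<^sub>R norm x) ` D"
  have D: "finite D" "span D = UNIV" "pairwise orthogonal D" "0 \<notin> D"
    using C assms(2) by (auto simp: D_def pairwise_def)
  have fin: "finite B" using D by (simp add: B_def)
  have n1: "norm b = 1" if "b \<in> B" for b
  proof -
    obtain x where "x \<in> D" "b = x /\<^sub>R norm x" using \<open>b \<in> B\<close> by (auto simp: B_def)
    moreover have "x \<noteq> 0" using \<open>x \<in> D\<close> D by auto
    ultimately show ?thesis by simp
  qed
  have orth: "inner a b = 0" if "a \<in> B" "b \<in> B" "a \<noteq> b" for a b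
  proof -
    obtain x y where xy: "x \<in> D" "y \<in> D" "a = x /\<^sub>R norm x" "b = y /\<^sub>R norm y"
      using \<open>a \<in> B\<close> \<open>b \<in> B\<close> by (auto simp: B_def)
    then have "x \<noteq> y" using that by auto
    then have "inner x y = 0" using D(3) xy by (auto simp: pairwise_def orthogonal_def)
    then show ?thesis using xy by simp
  qed
  have spanB: "x \<in> span B" for x
  proof -
    have "D \<subseteq> span B"
    proof
      fix d assume d: "d \<in> D"
      then have "norm d *\<^sub>R (d /\<^sub>R norm d) \<in> span B"
        by (intro span_mul span_base) (auto simp: B_def)
      moreover have "norm d \<noteq> 0" using d D(4) by auto
      ultimately show "d \<in> span B" by simp
    qed
    then have "span D \<subseteq> span B" by (simp add: span_minimal)
    then show ?thesis using D by auto
  qed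
  have "x = (\<Sum>b\<in>B. inner x b *\<^sub>R b)" for x
  proof -
    define r where "r = x - (\<Sum>b\<in>B. inner x b *\<^sub>R b)"
    have rb: "inner r b = 0" if "b \<in> B" for b
    proof -
      have "(\<Sum>a\<in>B. inner x a * inner a b) = (\<Sum>a\<in>B. if a = b then inner x b else 0)"
        using orth n1 that by (intro sum.cong) (auto simp: dot_square_norm)
      then show ?thesis using that fin by (simp add: r_def inner_diff_left inner_sum_left)
    qed
    have "r \<in> span B" using spanB by auto
    then have "inner r r = 0"
    proof (rule span_induct[where P = "\<lambda>z. inner r z = 0"])
      show "subspace {z. inner r z = 0}" by (simp add: subspace_hyperplane)
    qed (use rb in auto)
    then show ?thesis by (simp add: r_def)
  qed
  then have "onb B" using fin orth n1 by (auto simp: onb_def dot_square_norm)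
  then show ?thesis by blast
qed

lemma onb_linear_expand:
  fixes L :: "'e::real_inner \<Rightarrow> real"
  assumes "onb B" "linear L"
  shows "L v = (\<Sum>b\<in>B. inner v b * L b)"
proof -
  have "L v = L (\<Sum>b\<in>B. inner v b *\<^sub>R b)" by (simp add: onb_expand[OF assms(1)])
  then show ?thesis by (simp add: linear_sum[OF assms(2)] linear_scale[OF assms(2)])
qed

lemma has_derivative_imp_frechet:
  "(f has_derivative f') (at x) \<Longrightarrow> frechet_derivative f (at x) = f'"
  using frechet_derivative_at by metis

text \<open>A Frechet derivative only sees a neighbourhood; this is what makes smoothness on open sets a local
  property.\<close>

lemma frechet_cong_open:
  assumes "open S" "x \<in> S" "\<And>y. y \<in> S \<Longrightarrow> f y = h y"
  shows "f differentiable (at x) \<longleftrightarrow> h differentiable (at x)"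
    and "frechet_derivative f (at x) = frechet_derivative h (at x)"
proof -
  have *: "(f has_derivative D) (at x) \<longleftrightarrow> (h has_derivative D) (at x)" for D
    using has_derivative_transform_within_open[of f D x UNIV S h]
      has_derivative_transform_within_open[of h D x UNIV S f] assms by metis
  show "f differentiable (at x) \<longleftrightarrow> h differentiable (at x)"
    unfolding differentiable_def using * by simp
  show "frechet_derivative f (at x) = frechet_derivative h (at x)"
    unfolding frechet_derivative_def using * by simp
qed

lemma Ck_on_cong:
  assumes "open S" "\<And>x. x \<in> S \<Longrightarrow> f x = h x"
  shows "Ck_on k S f \<longleftrightarrow> Ck_on k S h"
  using assms(2)
proof (induction k arbitrary: f h)
  case 0
  then show ?case by (simp cong: continuous_on_cong)
next
  case (Suc k)
  have "Ck_on k S (\<lambda>x. frechet_derivative f (at x) v) \<longleftrightarrow> Ck_on k S (\<lambda>x. frechet_derivative h (at x) v)" for v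
    by (rule Suc.IH) (simp add: frechet_cong_open(2)[OF assms(1) _ Suc.prems])
  then show ?case using frechet_cong_open(1)[OF assms(1) _ Suc.prems] by simp
qed

lemma Ck_on_subset: "Ck_on k S f \<Longrightarrow> T \<subseteq> S \<Longrightarrow> Ck_on k T f"
  by (induction k arbitrary: f) (auto intro: continuous_on_subset)

lemma Ck_on_imp_continuous: "Ck_on k S f \<Longrightarrow> continuous_on S f"
  by (cases k) (auto intro!: continuous_at_imp_continuous_on differentiable_imp_continuous_within)

lemma Ck_on_Suc_imp: "Ck_on (Suc k) S f \<Longrightarrow> Ck_on k S f"
proof (induction k arbitrary: f)
  case 0
  then show ?case using Ck_on_imp_continuous by fastforce
next
  case (Suc k)
  have "Ck_on k S (\<lambda>x. frechet_derivative f (at x) v)" for v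
    using Suc.prems by (intro Suc.IH) (simp only: Ck_on.simps(2)[of "Suc k"])
  then show ?case using Suc.prems by simp
qed

lemma Ck_on_SucI:
  assumes "open S" "\<And>x. x \<in> S \<Longrightarrow> (f has_derivative f' x) (at x)"
    "\<And>v. Ck_on k S (\<lambda>x. f' x v)"
  shows "Ck_on (Suc k) S f"
proof -
  have "frechet_derivative f (at x) = f' x" if "x \<in> S" for x
    using has_derivative_imp_frechet assms(2) that by blast
  then have "Ck_on k S (\<lambda>x. frechet_derivative f (at x) v)" for v
    using Ck_on_cong[OF assms(1), of "\<lambda>x. frechet_derivative f (at x) v" "\<lambda>x. f' x v" k] assms(3) by simp
  then show ?thesis using assms(2) by (auto simp: differentiable_def)
qed

lemma Ck_on_SucD:
  assumes "Ck_on (Suc k) S f" "x \<in> S"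
  shows "(f has_derivative frechet_derivative f (at x)) (at x)"
  using assms frechet_derivative_works by auto

lemma Ck_on_local:
  assumes "\<And>x. x \<in> S \<Longrightarrow> \<exists>T. open T \<and> x \<in> T \<and> Ck_on k T f"
  shows "Ck_on k S f"
  using assms
proof (induction k arbitrary: f)
  case 0
  have "isCont f x" if "x \<in> S" for x
    using 0[OF that] by (auto simp: continuous_on_eq_continuous_at)
  then show ?case by (simp add: continuous_at_imp_continuous_on)
next
  case (Suc k)
  have "f differentiable (at x)" if "x \<in> S" for x
    using Suc.prems[OF that] by auto
  moreover have "Ck_on k S (\<lambda>x. frechet_derivative f (at x) v)" for v
  proof (rule Suc.IH)
    fix x assume "x \<in> S"
    then obtain T where "open T" "x \<in> T" "Ck_on (Suc k) T f" using Suc.prems by blast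
    then show "\<exists>T. open T \<and> x \<in> T \<and> Ck_on k T (\<lambda>x. frechet_derivative f (at x) v)" by auto
  qed
  ultimately show ?case by simp
qed

lemma Ck_on_const [simp]: "Ck_on k S (\<lambda>x. c)"
proof (induction k arbitrary: c)
  case (Suc k)
  then show ?case by (simp add: frechet_derivative_const)
qed simp

lemma Ck_on_bounded_linear:
  assumes "bounded_linear L" "open S" "Ck_on k S f"
  shows "Ck_on k S (\<lambda>x. L (f x))"
  using assms(3)
proof (induction k arbitrary: f)
  case 0
  then show ?case by (simp add: bounded_linear.continuous_on[OF assms(1)])
next
  case (Suc k)
  show ?case
  proof (rule Ck_on_SucI[OF assms(2)])
    show "((\<lambda>x. L (f x)) has_derivative (\<lambda>v. L (frechet_derivative f (at x) v))) (at x)" if "x \<in> S" for x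
      using bounded_linear.has_derivative[OF assms(1) Ck_on_SucD[OF Suc.prems that]] .
    show "Ck_on k S (\<lambda>x. L (frechet_derivative f (at x) v))" for v
      using Suc by simp
  qed
qed

lemma Ck_on_id: "open S \<Longrightarrow> Ck_on k S (\<lambda>x. x)"
proof (cases k)
  case (Suc l)
  assume "open S"
  then show ?thesis unfolding Suc
    by (rule Ck_on_SucI[where f' = "\<lambda>x v. v"]) (auto intro: has_derivative_ident)
qed simp

lemma Ck_on_add:
  assumes "open S" "Ck_on k S f" "Ck_on k S h"
  shows "Ck_on k S (\<lambda>x. f x + h x)"
  using assms(2,3)
proof (induction k arbitrary: f h)
  case 0
  then show ?case by (simp add: continuous_on_add)
next
  case (Suc k)
  show ?case
  proof (rule Ck_on_SucI[OF assms(1)])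
    show "((\<lambda>x. f x + h x) has_derivative
      (\<lambda>v. frechet_derivative f (at x) v + frechet_derivative h (at x) v)) (at x)" if "x \<in> S" for x
      using Ck_on_SucD[OF _ that] Suc.prems by (intro has_derivative_add) blast+
    show "Ck_on k S (\<lambda>x. frechet_derivative f (at x) v + frechet_derivative h (at x) v)" for v
      using Suc by simp
  qed
qed

lemma Ck_on_sum:
  assumes "open S" "\<And>i. i \<in> A \<Longrightarrow> Ck_on k S (f i)"
  shows "Ck_on k S (\<lambda>x. \<Sum>i\<in>A. f i x)"
  using assms(2)
proof (induction A rule: infinite_finite_induct)
  case (insert a A)
  then show ?case by (simp add: Ck_on_add[OF assms(1)])
qed auto

lemma Ck_on_mult:
  fixes f h :: "'a::real_normed_vector \<Rightarrow> real"
  assumes "open S" "Ck_on k S f" "Ck_on k S h"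
  shows "Ck_on k S (\<lambda>x. f x * h x)"
  using assms(2,3)
proof (induction k arbitrary: f h)
  case 0
  then show ?case by (simp add: continuous_on_mult)
next
  case (Suc k)
  show ?case
  proof (rule Ck_on_SucI[OF assms(1)])
    show "((\<lambda>x. f x * h x) has_derivative
      (\<lambda>v. f x * frechet_derivative h (at x) v + frechet_derivative f (at x) v * h x)) (at x)"
      if "x \<in> S" for x
      using Ck_on_SucD[OF _ that] Suc.prems by (intro has_derivative_mult) blast+
    show "Ck_on k S (\<lambda>x. f x * frechet_derivative h (at x) v + frechet_derivative f (at x) v * h x)" for v
    proof -
      have "Ck_on k S f" "Ck_on k S h" using Suc.prems Ck_on_Suc_imp by blast+
      moreover have "Ck_on k S (\<lambda>x. frechet_derivative f (at x) v)"
        "Ck_on k S (\<lambda>x. frechet_derivative h (at x) v)" using Suc.prems by simp_all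
      ultimately show ?thesis by (intro Ck_on_add assms(1) Suc.IH)
    qed
  qed
qed

lemma Ck_on_inverse:
  fixes f :: "'a::real_normed_vector \<Rightarrow> real"
  assumes "open S" "Ck_on k S f" "\<And>x. x \<in> S \<Longrightarrow> f x \<noteq> 0"
  shows "Ck_on k S (\<lambda>x. inverse (f x))"
  using assms(2)
proof (induction k)
  case 0
  then show ?case using assms(3) by (simp add: continuous_on_inverse)
next
  case (Suc k)
  show ?case
  proof (rule Ck_on_SucI[OF assms(1)])
    show "((\<lambda>x. inverse (f x)) has_derivative
      (\<lambda>v. - (inverse (f x) * frechet_derivative f (at x) v * inverse (f x)))) (at x)"
      if "x \<in> S" for x
      using Deriv.has_derivative_inverse[OF assms(3)[OF that] Ck_on_SucD[OF Suc.prems that]] .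
    have IH: "Ck_on k S (\<lambda>x. inverse (f x))" using Suc Ck_on_Suc_imp by blast
    show "Ck_on k S (\<lambda>x. - (inverse (f x) * frechet_derivative f (at x) v * inverse (f x)))" for v
    proof -
      have "Ck_on k S (\<lambda>x. frechet_derivative f (at x) v)" using Suc.prems by simp
      then have "Ck_on k S (\<lambda>x. inverse (f x) * frechet_derivative f (at x) v * inverse (f x))"
        by (intro Ck_on_mult IH assms(1))
      then show ?thesis
        using Ck_on_bounded_linear[OF bounded_linear_minus[OF bounded_linear_ident] assms(1)] by blast
    qed
  qed
qed

text \<open>By the chain rule the derivative of \<open>f \<circ> g\<close> in direction \<open>v\<close> is \<open>D f (g x) (D g (x) v)\<close>, where the
  direction inside \<open>D f\<close> varies with \<open>x\<close>. Expanding this direction in an orthonormal basis turns it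
  into a sum of products of functions to which the induction hypothesis applies.\<close>

lemma Ck_on_compose:
  fixes f :: "'b::real_inner \<Rightarrow> real" and g :: "'a::real_normed_vector \<Rightarrow> 'b"
  assumes "onb (B::'b set)" "open S" "open T" "g ` S \<subseteq> T" "Ck_on k T f" "Ck_on k S g"
  shows "Ck_on k S (\<lambda>x. f (g x))"
  using assms(5,6)
proof (induction k arbitrary: f)
  case 0
  then show ?case using assms(4) continuous_on_compose2 by fastforce
next
  case (Suc k)
  have g: "(g has_derivative frechet_derivative g (at x)) (at x)" if "x \<in> S" for x
    using Suc.prems(2) that by (rule Ck_on_SucD)
  have f: "(f has_derivative frechet_derivative f (at (g x))) (at (g x))" if "x \<in> S" for x
    using Suc.prems(1) assms(4) that by (intro Ck_on_SucD) auto
  have eq: "frechet_derivative f (at (g x)) w = (\<Sum>b\<in>B. inner w b * frechet_derivative f (at (g x)) b)"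
    if "x \<in> S" for x w
    using onb_linear_expand[OF assms(1) has_derivative_linear[OF f[OF that]]] .
  show ?case
  proof (rule Ck_on_SucI[OF assms(2)])
    show "((\<lambda>x. f (g x)) has_derivative
      (\<lambda>v. \<Sum>b\<in>B. inner (frechet_derivative g (at x) v) b * frechet_derivative f (at (g x)) b)) (at x)"
      if "x \<in> S" for x
    proof -
      have "(\<lambda>v. frechet_derivative f (at (g x)) (frechet_derivative g (at x) v)) =
        (\<lambda>v. \<Sum>b\<in>B. inner (frechet_derivative g (at x) v) b * frechet_derivative f (at (g x)) b)"
        by (rule ext, rule eq[OF that])
      then show ?thesis using has_derivative_compose[OF g[OF that] f[OF that]] by metis
    qed
    have gk: "Ck_on k S g" using Suc.prems Ck_on_Suc_imp by blast
    show "Ck_on k S (\<lambda>x. \<Sum>b\<in>B. inner (frechet_derivative g (at x) v) b * frechet_derivative f (at (g x)) b)" for v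
    proof (intro Ck_on_sum Ck_on_mult assms(2))
      fix b
      show "Ck_on k S (\<lambda>x. inner (frechet_derivative g (at x) v) b)"
        using Suc.prems(2) by (intro Ck_on_bounded_linear[OF bounded_linear_inner_left assms(2)]) simp
      show "Ck_on k S (\<lambda>x. frechet_derivative f (at (g x)) b)"
        using Suc.IH[of "\<lambda>y. frechet_derivative f (at y) b"] Suc.prems gk by auto
    qed
  qed
qed

lemma smooth_onD_derivative:
  assumes "smooth_on S f" "x \<in> S"
  shows "(f has_derivative frechet_derivative f (at x)) (at x)"
  using assms Ck_on_SucD unfolding smooth_on_def by blast

lemma smooth_on_frechet: "smooth_on S f \<Longrightarrow> smooth_on S (\<lambda>x. frechet_derivative f (at x) v)"
  unfolding smooth_on_def using Ck_on.simps(2) by blast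

lemma smooth_on_subset: "smooth_on S f \<Longrightarrow> T \<subseteq> S \<Longrightarrow> smooth_on T f"
  unfolding smooth_on_def using Ck_on_subset by blast

lemma smooth_on_cong: "open S \<Longrightarrow> (\<And>x. x \<in> S \<Longrightarrow> f x = h x) \<Longrightarrow> smooth_on S f \<longleftrightarrow> smooth_on S h"
  unfolding smooth_on_def using Ck_on_cong by blast

lemma smooth_on_transfer:
  "smooth_on S h \<Longrightarrow> open S \<Longrightarrow> (\<And>x. x \<in> S \<Longrightarrow> f x = h x) \<Longrightarrow> smooth_on S f"
  using smooth_on_cong[of S f h] by simp

lemma smooth_on_local: "(\<And>x. x \<in> S \<Longrightarrow> \<exists>T. open T \<and> x \<in> T \<and> smooth_on T f) \<Longrightarrow> smooth_on S f"
  unfolding smooth_on_def using Ck_on_local by metis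

lemma smooth_on_const: "smooth_on S (\<lambda>x. c)"
  by (simp add: smooth_on_def)

lemma smooth_on_id: "open S \<Longrightarrow> smooth_on S (\<lambda>x. x)"
  by (simp add: smooth_on_def Ck_on_id)

lemma smooth_on_bounded_linear:
  "bounded_linear L \<Longrightarrow> open S \<Longrightarrow> smooth_on S f \<Longrightarrow> smooth_on S (\<lambda>x. L (f x))"
  by (simp add: smooth_on_def Ck_on_bounded_linear)

lemma smooth_on_add: "open S \<Longrightarrow> smooth_on S f \<Longrightarrow> smooth_on S h \<Longrightarrow> smooth_on S (\<lambda>x. f x + h x)"
  by (simp add: smooth_on_def Ck_on_add)

lemma smooth_on_sum:
  "open S \<Longrightarrow> (\<And>i. i \<in> A \<Longrightarrow> smooth_on S (f i)) \<Longrightarrow> smooth_on S (\<lambda>x. \<Sum>i\<in>A. f i x)"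
  by (simp add: smooth_on_def Ck_on_sum)

lemma smooth_on_mult:
  fixes f h :: "'a::real_normed_vector \<Rightarrow> real"
  shows "open S \<Longrightarrow> smooth_on S f \<Longrightarrow> smooth_on S h \<Longrightarrow> smooth_on S (\<lambda>x. f x * h x)"
  by (simp add: smooth_on_def Ck_on_mult)

lemma smooth_on_inverse:
  fixes f :: "'a::real_normed_vector \<Rightarrow> real"
  shows "open S \<Longrightarrow> smooth_on S f \<Longrightarrow> (\<And>x. x \<in> S \<Longrightarrow> f x \<noteq> 0) \<Longrightarrow> smooth_on S (\<lambda>x. inverse (f x))"
  by (simp add: smooth_on_def Ck_on_inverse)

lemma smooth_on_compose:
  fixes f :: "'b::real_inner \<Rightarrow> real" and g :: "'a::real_normed_vector \<Rightarrow> 'b"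
  assumes "onb (B::'b set)" "open S" "open T" "g ` S \<subseteq> T" "smooth_on T f" "smooth_on S g"
  shows "smooth_on S (\<lambda>x. f (g x))"
  using assms by (simp add: smooth_on_def Ck_on_compose[OF assms(1-4)])

lemma smooth_on_ln: "smooth_on {0<..} (ln :: real \<Rightarrow> real)"
proof -
  have "Ck_on (Suc k) {0<..} (ln :: real \<Rightarrow> real)" for k
  proof (rule Ck_on_SucI)
    show "(ln has_derivative (\<lambda>v. v * inverse x)) (at x)" if "x \<in> {0<..}" for x :: real
      using that by (auto intro!: derivative_eq_intros simp: field_simps)
    show "Ck_on k {0<..} (\<lambda>x::real. v * inverse x)" for v
      by (intro Ck_on_mult Ck_on_inverse Ck_on_id Ck_on_const) auto
  qed auto
  then show ?thesis using Ck_on_Suc_imp unfolding smooth_on_def by blast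
qed

section \<open>A smooth step function and compact balls\<close>

text \<open>For positive \<open>t\<close> this is \<open>exp (-1/t) / t ^ n\<close>. The family is closed under differentiation up to
  linear combinations, so all of its members are smooth by one induction.\<close>

definition flat :: "nat \<Rightarrow> real \<Rightarrow> real"
  where "flat n t = (if 0 < t then exp (- inverse t) * inverse t ^ n else 0)"

lemma flat_tendsto_0: "(flat n \<longlongrightarrow> 0) (at 0)"
proof -
  have "((\<lambda>x::real. x ^ n / exp x) \<longlongrightarrow> 0) at_top"
    by (rule tendsto_power_div_exp_0)
  then have "((\<lambda>t. inverse t ^ n / exp (inverse t)) \<longlongrightarrow> 0) (at_right (0::real))"
    using filterlim_compose filterlim_inverse_at_top_right by blast
  then have "(flat n \<longlongrightarrow> 0) (at_right 0)"
    by (rule Lim_transform_eventually)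
      (auto simp: flat_def exp_minus field_simps intro!: eventually_at_right_less[THEN eventually_mono])
  moreover have "(flat n \<longlongrightarrow> 0) (at_left 0)"
    by (rule Lim_transform_eventually[OF tendsto_const])
      (auto simp: flat_def eventually_at_left_field intro!: exI[of _ "-1"])
  ultimately show ?thesis by (simp add: filterlim_split_at)
qed

lemma flat_has_derivative:
  "(flat n has_real_derivative flat (n + 2) t - real n * flat (n + 1) t) (at t)"
proof (cases t "0::real" rule: linorder_cases)
  case less
  have "((\<lambda>_. 0) has_real_derivative 0) (at t)" by simp
  then have "(flat n has_real_derivative 0) (at t)"
    by (rule DERIV_cong_ev[THEN iffD1, rotated -1])
      (use less in \<open>auto simp: flat_def eventually_nhds intro!: exI[of _ "{..<0}"]\<close>)
  then show ?thesis using less by (simp add: flat_def)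
next
  case greater
  have "((\<lambda>t. exp (- inverse t) * inverse t ^ n) has_real_derivative
     flat (n + 2) t - real n * flat (n + 1) t) (at t)"
    using greater
    by (auto intro!: derivative_eq_intros simp: flat_def field_simps power2_eq_square)
       (cases n, auto simp: field_simps)
  then show ?thesis
    by (rule DERIV_cong_ev[THEN iffD1, rotated -1])
      (use greater in \<open>auto simp: flat_def eventually_nhds intro!: exI[of _ "{0<..}"]\<close>)
next
  case equal
  have "(\<lambda>h. (flat n (0 + h) - flat n 0) / h) = flat (n + 1)"
    by (auto simp: flat_def fun_eq_iff field_simps)
  then have "(flat n has_real_derivative 0) (at 0)"
    using flat_tendsto_0[of "n + 1"] by (simp add: DERIV_def)
  then show ?thesis using equal by (simp add: flat_def)
qed

lemma smooth_on_flat: "smooth_on UNIV (flat n)"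
proof -
  have "Ck_on (Suc k) UNIV (flat n)" for k n
  proof (induction k arbitrary: n)
    case 0
    show ?case
      by (rule Ck_on_SucI[where f' = "\<lambda>t v. (flat (n + 2) t - real n * flat (n + 1) t) * v"])
        (use flat_has_derivative in \<open>auto simp: has_field_derivative_def
          intro!: continuous_intros DERIV_continuous_on[OF flat_has_derivative]\<close>)
  next
    case (Suc k)
    show ?case
    proof (rule Ck_on_SucI[where f' = "\<lambda>t v. (flat (n + 2) t + (- real n) * flat (n + 1) t) * v"])
      show "Ck_on (Suc k) UNIV (\<lambda>t. (flat (n + 2) t + (- real n) * flat (n + 1) t) * v)" for v
        by (intro Ck_on_mult Ck_on_add Suc Ck_on_const) auto
    qed (use flat_has_derivative in \<open>auto simp: has_field_derivative_def\<close>)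
  qed
  then show ?thesis using Ck_on_Suc_imp unfolding smooth_on_def by blast
qed

text \<open>The usual quotient of two flat functions whose denominator never vanishes.\<close>

lemma smooth_step_exists:
  "\<exists>\<beta>::real \<Rightarrow> real. smooth_on UNIV \<beta> \<and> (\<forall>t\<le>1. \<beta> t = 1) \<and> (\<forall>t\<ge>2. \<beta> t = 0)"
proof -
  define \<beta> where "\<beta> t = flat 0 (2 - t) * inverse (flat 0 (2 - t) + flat 0 (t - 1))" for t
  have pos: "flat 0 (2 - t) + flat 0 (t - 1) \<noteq> 0" for t
  proof -
    have "0 < flat 0 (2 - t) + flat 0 (t - 1)"
      by (cases "t < 2"; cases "1 < t") (auto simp: flat_def add_pos_pos)
    then show ?thesis by simp
  qed
  have 1: "smooth_on UNIV (\<lambda>t. flat 0 (2 + (-1) * t))" "smooth_on UNIV (\<lambda>t. flat 0 (t + - 1))"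
    by (rule smooth_on_compose[OF onb_real _ _ _ smooth_on_flat];
      (intro smooth_on_add smooth_on_mult smooth_on_const smooth_on_id)?; simp)+
  then have 2: "smooth_on UNIV (\<lambda>t. flat 0 (2 - t))" "smooth_on UNIV (\<lambda>t. flat 0 (t - 1))"
    by simp_all
  then have "smooth_on UNIV \<beta>" unfolding \<beta>_def
    by (intro smooth_on_mult smooth_on_inverse smooth_on_add) (use pos in auto)
  moreover have "\<beta> t = 1" if "t \<le> 1" for t
    using that pos[of t] by (auto simp: \<beta>_def flat_def)
  moreover have "\<beta> t = 0" if "t \<ge> 2" for t
    using that by (auto simp: \<beta>_def flat_def)
  ultimately show ?thesis by blast
qed

text \<open>A ball is a closed subset of the image of a cube, and cubes are compact by induction on the number
  of coordinates.\<close>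

lemma compact_cball_onb:
  assumes "onb (B::'e::real_inner set)"
  shows "compact (cball (a::'e) r)"
proof -
  have box: "compact {\<Sum>b\<in>C. t b *\<^sub>R b |t. \<forall>b. \<bar>t b\<bar> \<le> s}" if "finite C" for C :: "'e set" and s :: real
    using that
  proof (induction C)
    case empty
    have "{\<Sum>b\<in>{}. t b *\<^sub>R b |t. \<forall>b. \<bar>t b\<bar> \<le> s} \<subseteq> {0::'e}" by auto
    then show ?case using finite_subset finite_imp_compact by blast
  next
    case (insert c C)
    let ?K = "{\<Sum>b\<in>C. t b *\<^sub>R b |t. \<forall>b. \<bar>t b\<bar> \<le> s}"
    have "compact ((\<lambda>(u, x). u *\<^sub>R c + x) ` ({-s..s} \<times> ?K))"
      by (intro compact_continuous_image compact_Times insert.IH)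
        (auto intro!: continuous_intros simp: split_beta)
    moreover have "{\<Sum>b\<in>insert c C. t b *\<^sub>R b |t. \<forall>b. \<bar>t b\<bar> \<le> s} =
      (\<lambda>(u, x). u *\<^sub>R c + x) ` ({-s..s} \<times> ?K)" (is "?L = ?R")
    proof
      show "?L \<subseteq> ?R"
      proof
        fix x assume "x \<in> ?L"
        then obtain t where t: "x = (\<Sum>b\<in>insert c C. t b *\<^sub>R b)" "\<forall>b. \<bar>t b\<bar> \<le> s" by blast
        have "x = (\<lambda>(u, x). u *\<^sub>R c + x) (t c, \<Sum>b\<in>C. t b *\<^sub>R b)"
          using insert.hyps t by simp
        moreover have "t c \<in> {-s..s}" using t(2)[rule_format, of c] by auto
        ultimately show "x \<in> ?R" using t(2) by blast
      qed
      show "?R \<subseteq> ?L"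
      proof
        fix x assume "x \<in> ?R"
        then obtain u t where t: "x = u *\<^sub>R c + (\<Sum>b\<in>C. t b *\<^sub>R b)" "\<forall>b. \<bar>t b\<bar> \<le> s" "u \<in> {-s..s}"
          by auto
        have "(\<Sum>b\<in>C. (t(c := u)) b *\<^sub>R b) = (\<Sum>b\<in>C. t b *\<^sub>R b)"
          using insert.hyps by (intro sum.cong) auto
        then have "x = (\<Sum>b\<in>insert c C. (t(c := u)) b *\<^sub>R b)" using t insert.hyps by simp
        moreover have "\<forall>b. \<bar>(t(c := u)) b\<bar> \<le> s" using t by auto
        ultimately show "x \<in> ?L" by blast
      qed
    qed
    ultimately show ?case by simp
  qed
  define s where "s = norm a + \<bar>r\<bar>"
  have fin: "finite B" using assms by (rule onb_finite)
  have n1: "norm b = 1" if "b \<in> B" for b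
    using onb_inner[OF assms that that] by (simp add: norm_eq_sqrt_inner)
  have "cball a r \<subseteq> {\<Sum>b\<in>B. t b *\<^sub>R b |t. \<forall>b. \<bar>t b\<bar> \<le> s}"
  proof
    fix x assume x: "x \<in> cball a r"
    define t where "t b = (if b \<in> B then inner x b else 0)" for b
    have nx: "norm x \<le> s" using x norm_triangle_ineq2[of x a]
      by (auto simp: s_def dist_norm norm_minus_commute)
    have "\<bar>t b\<bar> \<le> s" for b
    proof (cases "b \<in> B")
      case True
      then show ?thesis using Cauchy_Schwarz_ineq2[of x b] n1[OF True] nx by (simp add: t_def)
    qed (use order_trans[OF norm_ge_zero[of x] nx] in \<open>simp add: t_def\<close>)
    moreover have "x = (\<Sum>b\<in>B. t b *\<^sub>R b)"
      using onb_expand[OF assms, of x] by (simp add: t_def cong: sum.cong)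
    ultimately show "x \<in> {\<Sum>b\<in>B. t b *\<^sub>R b |t. \<forall>b. \<bar>t b\<bar> \<le> s}" by blast
  qed
  then have "cball a r = {\<Sum>b\<in>B. t b *\<^sub>R b |t. \<forall>b. \<bar>t b\<bar> \<le> s} \<inter> cball a r" by blast
  moreover have "compact ({\<Sum>b\<in>B. t b *\<^sub>R b |t. \<forall>b. \<bar>t b\<bar> \<le> s} \<inter> cball a r)"
    by (rule compact_Int_closed[OF box[OF fin] closed_cball])
  ultimately show ?thesis by simp
qed

section \<open>Hadamard's lemma\<close>

lemma onb_bound:
  fixes L :: "'e::real_inner \<Rightarrow> real"
  assumes "onb B" "linear L"
  shows "\<bar>L v\<bar> \<le> (\<Sum>b\<in>B. \<bar>L b\<bar>) * norm v"
proof -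
  have n1: "norm b = 1" if "b \<in> B" for b
    using onb_inner[OF assms(1) that that] by (simp add: norm_eq_sqrt_inner)
  have "\<bar>L v\<bar> \<le> (\<Sum>b\<in>B. \<bar>inner v b * L b\<bar>)"
    unfolding onb_linear_expand[OF assms, of v] by (rule sum_abs)
  also have "\<dots> \<le> (\<Sum>b\<in>B. \<bar>L b\<bar> * norm v)"
  proof (rule sum_mono)
    fix b assume "b \<in> B"
    then have "\<bar>inner v b\<bar> \<le> norm v" using Cauchy_Schwarz_ineq2[of v b] n1 by simp
    then show "\<bar>inner v b * L b\<bar> \<le> \<bar>L b\<bar> * norm v"
      using mult_left_mono[of "\<bar>inner v b\<bar>" "norm v" "\<bar>L b\<bar>"] by (simp add: abs_mult mult.commute)
  qed
  finally show ?thesis by (simp add: sum_distrib_right)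
qed

text \<open>For \<open>m = 0\<close> this is the average of \<open>g\<close> over the segment from \<open>a\<close> to \<open>x\<close>. The weights \<open>t ^ m\<close> make the
  family stable under differentiation, since each derivative in \<open>x\<close> produces a factor \<open>t\<close>.\<close>

definition ray_mean :: "nat \<Rightarrow> 'e::real_inner \<Rightarrow> ('e \<Rightarrow> real) \<Rightarrow> 'e \<Rightarrow> real"
  where "ray_mean m a g x = integral {0..1} (\<lambda>t. t ^ m * g (a + t *\<^sub>R (x - a)))"

lemma ray_in_cball:
  fixes x a :: "'e::real_normed_vector"
  assumes "x \<in> cball a \<rho>" "t \<in> {0..1::real}"
  shows "a + t *\<^sub>R (x - a) \<in> cball a \<rho>"
proof -
  have "t * norm (x - a) \<le> 1 * norm (x - a)" using assms by (intro mult_right_mono) auto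
  then show ?thesis using assms by (simp add: dist_norm norm_minus_commute)
qed

lemma ray_mean_integrable:
  fixes g :: "'e::real_normed_vector \<Rightarrow> real"
  assumes "continuous_on (cball a \<rho>) g" "x \<in> cball a \<rho>"
  shows "(\<lambda>t. t ^ m * g (a + t *\<^sub>R (x - a))) integrable_on {0..1::real}"
proof -
  have "continuous_on {0..1} (\<lambda>t. g (a + t *\<^sub>R (x - a)))"
  proof (rule continuous_on_compose2[OF assms(1)])
    show "continuous_on {0..1} (\<lambda>t. a + t *\<^sub>R (x - a))" by (intro continuous_intros)
  qed (use ray_in_cball[OF assms(2)] in blast)
  then have "continuous_on {0..1} (\<lambda>t. t ^ m * g (a + t *\<^sub>R (x - a)))"
    by (intro continuous_intros)
  then show ?thesis by (rule integrable_continuous_interval)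
qed

text \<open>Differentiation under the integral sign. The error of the linearisation of \<open>g\<close> at a point of the
  segment is controlled by the oscillation of the derivative of \<open>g\<close>, and this oscillation is small
  uniformly along the segment because the derivative is uniformly continuous on a compact ball.\<close>

lemma ray_mean_has_derivative:
  assumes B: "onb (B::'e::real_inner set)" and g: "smooth_on (ball a r) g" and x: "x \<in> ball (a::'e) r"
  shows "(ray_mean m a g has_derivative
    (\<lambda>v. ray_mean (m + 1) a (\<lambda>z. frechet_derivative g (at z) v) x)) (at x)"
proof -
  define g' where "g' z = frechet_derivative g (at z)" for z
  obtain \<rho> where \<rho>: "dist a x < \<rho>" "\<rho> < r" using x dense by auto
  have K: "cball a \<rho> \<subseteq> ball a r" using \<rho> by auto
  have xK: "x \<in> cball a \<rho>" using \<rho> by auto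
  have gd: "(g has_derivative g' z) (at z)" if "z \<in> cball a \<rho>" for z
    unfolding g'_def using smooth_onD_derivative[OF g] K that by blast
  have lin: "linear (g' z)" if "z \<in> cball a \<rho>" for z
    using gd[OF that] has_derivative_linear by blast
  have cont_g: "continuous_on (cball a \<rho>) g"
    using smooth_on_subset[OF g K] Ck_on_imp_continuous unfolding smooth_on_def by blast
  have cont_g': "continuous_on (cball a \<rho>) (\<lambda>z. g' z v)" for v
    using smooth_on_subset[OF smooth_on_frechet[OF g] K] Ck_on_imp_continuous
    unfolding smooth_on_def g'_def by blast
  define L where "L v = ray_mean (m + 1) a (\<lambda>z. g' z v) x" for v
  have Lint: "(\<lambda>t. t ^ (m + 1) * g' (a + t *\<^sub>R (x - a)) v) integrable_on {0..1}" for v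
    by (rule ray_mean_integrable[OF cont_g' xK])
  have L: "L v = (\<Sum>b\<in>B. inner v b * L b)" for v
  proof -
    have "L v = integral {0..1} (\<lambda>t. \<Sum>b\<in>B. inner v b * (t ^ (m + 1) * g' (a + t *\<^sub>R (x - a)) b))"
      unfolding L_def ray_mean_def
    proof (rule integral_cong)
      fix t :: real assume "t \<in> {0..1}"
      then show "t ^ (m + 1) * g' (a + t *\<^sub>R (x - a)) v =
        (\<Sum>b\<in>B. inner v b * (t ^ (m + 1) * g' (a + t *\<^sub>R (x - a)) b))"
        using onb_linear_expand[OF B lin[OF ray_in_cball[OF xK]], of t v]
        by (simp add: sum_distrib_left mult_ac)
    qed
    also have "\<dots> = (\<Sum>b\<in>B. integral {0..1} (\<lambda>t. inner v b * (t ^ (m + 1) * g' (a + t *\<^sub>R (x - a)) b)))"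
      by (rule integral_sum[OF onb_finite[OF B]]) (intro integrable_on_mult_right Lint)
    finally show ?thesis by (simp add: L_def ray_mean_def)
  qed
  have "bounded_linear (\<lambda>v. \<Sum>b\<in>B. inner v b * L b)"
    by (intro bounded_linear_sum bounded_linear_mult_const bounded_linear_inner_left)
  moreover have "L = (\<lambda>v. \<Sum>b\<in>B. inner v b * L b)" by (rule ext, rule L)
  ultimately have bl: "bounded_linear L" by (simp only: \<open>L = _\<close>[symmetric])
  \<comment> \<open>\<open>\<phi> (u, z)\<close> bounds the operator norm of \<open>g' u - g' z\<close>. It vanishes on the diagonal, so its uniform
  continuity yields one radius for all points and all directions at once.\<close>
  define \<phi> where "\<phi> = (\<lambda>(u, z). \<Sum>b\<in>B. \<bar>g' u b - g' z b\<bar>)"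
  have "continuous_on (cball a \<rho> \<times> cball a \<rho>) \<phi>"
    unfolding \<phi>_def split_beta
    by (intro continuous_intros continuous_on_compose2[OF cont_g']) auto
  then have uc: "uniformly_continuous_on (cball a \<rho> \<times> cball a \<rho>) \<phi>"
    using compact_uniformly_continuous compact_Times compact_cball_onb[OF B] by blast
  show ?thesis
    unfolding has_derivative_at_alt g'_def[symmetric] L_def[symmetric]
  proof (intro conjI bl allI impI)
    fix e :: real assume "e > 0"
    then obtain d where d: "d > 0"
      "\<And>p q. p \<in> cball a \<rho> \<times> cball a \<rho> \<Longrightarrow> q \<in> cball a \<rho> \<times> cball a \<rho> \<Longrightarrow> dist q p < d \<Longrightarrow> dist (\<phi> q) (\<phi> p) < e"
      using uniformly_continuous_onE[OF uc \<open>e > 0\<close>] by metis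
    have \<phi>e: "\<phi> (u, z) \<le> e" if "u \<in> cball a \<rho>" "z \<in> cball a \<rho>" "dist u z < d" for u z
    proof -
      have "dist (u, z) (z, z) = dist u z" by (simp add: dist_Pair_Pair)
      then have "dist (\<phi> (u, z)) (\<phi> (z, z)) < e" using d(2)[of "(z, z)" "(u, z)"] that by simp
      moreover have "\<phi> (z, z) = 0" by (simp add: \<phi>_def)
      ultimately show ?thesis by (simp add: dist_real_def)
    qed
    show "\<exists>d>0. \<forall>y. norm (y - x) < d \<longrightarrow>
      norm (ray_mean m a g y - ray_mean m a g x - L (y - x)) \<le> e * norm (y - x)"
    proof (intro exI[of _ "min d (\<rho> - dist a x)"] conjI allI impI)
      show "0 < min d (\<rho> - dist a x)" using d \<rho> by simp
      fix y assume y: "norm (y - x) < min d (\<rho> - dist a x)"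
      have yK: "y \<in> cball a \<rho>"
        using y dist_triangle[of a y x] by (simp add: dist_norm norm_minus_commute)
      define D where "D t = t ^ m * g (a + t *\<^sub>R (y - a)) - t ^ m * g (a + t *\<^sub>R (x - a))
         - t ^ (m + 1) * g' (a + t *\<^sub>R (x - a)) (y - x)" for t
      have Dint: "(D has_integral (ray_mean m a g y - ray_mean m a g x - L (y - x))) {0..1}"
        unfolding D_def L_def ray_mean_def
        by (intro has_integral_diff integrable_integral ray_mean_integrable[OF cont_g]
            ray_mean_integrable[OF cont_g'] xK yK)
      have bound: "norm (D t) \<le> e * norm (y - x)" if t: "t \<in> {0..1}" for t
      proof -
        define z where "z = a + t *\<^sub>R (x - a)"
        define w where "w = a + t *\<^sub>R (y - a)"
        have zw: "z \<in> cball a \<rho>" "w \<in> cball a \<rho>"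
          using ray_in_cball t xK yK by (auto simp: z_def w_def)
        have wz: "w - z = t *\<^sub>R (y - x)" by (simp add: w_def z_def algebra_simps)
        have nwz: "norm (w - z) \<le> norm (y - x)"
          using t mult_right_mono[of t 1 "norm (y - x)"] by (simp add: wz)
        have seg: "closed_segment z w \<subseteq> cball a \<rho>"
          using zw by (simp add: closed_segment_subset)
        have "norm (g w - g z - g' z (w - z)) \<le> norm (w - z) * e"
        proof (rule differentiable_bound_linearization[where S = "closed_segment z w"])
          show "z + s *\<^sub>R (w - z) \<in> closed_segment z w" if "s \<in> {0..1}" for s
            using that unfolding closed_segment_def
            by (auto intro!: exI[of _ s] simp: algebra_simps)
          show "(g has_derivative g' u) (at u within closed_segment z w)" if "u \<in> closed_segment z w" for u
            using gd seg that has_derivative_at_withinI by blast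
          show "onorm (g' u - g' z) \<le> e" if u: "u \<in> closed_segment z w" for u
          proof (rule onorm_bound)
            fix v
            have uK: "u \<in> cball a \<rho>" using seg u by blast
            have "dist u z \<le> norm (w - z)"
              using u segment_bound(1)[of u z w] by (simp add: dist_norm)
            then have "dist u z < d" using nwz y by simp
            then have le: "(\<Sum>b\<in>B. \<bar>g' u b - g' z b\<bar>) \<le> e"
              using \<phi>e[OF uK zw(1)] by (simp add: \<phi>_def)
            have "linear (\<lambda>v. g' u v - g' z v)"
              using lin uK zw linear_compose_sub by blast
            from onb_bound[OF B this, of v]
            have "\<bar>g' u v - g' z v\<bar> \<le> (\<Sum>b\<in>B. \<bar>g' u b - g' z b\<bar>) * norm v" .
            also have "\<dots> \<le> e * norm v" using le by (intro mult_right_mono) auto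
            finally show "norm ((g' u - g' z) v) \<le> e * norm v" by simp
          qed (use \<open>e > 0\<close> in simp)
          show "z \<in> closed_segment z w" by simp
        qed
        also have "\<dots> \<le> norm (y - x) * e" using nwz \<open>e > 0\<close> by (intro mult_right_mono) auto
        finally have le: "\<bar>g w - g z - g' z (w - z)\<bar> \<le> norm (y - x) * e" by simp
        have "g' z (w - z) = t * g' z (y - x)" unfolding wz using linear_scale[OF lin[OF zw(1)]] by simp
        moreover have "D t = t ^ m * g w - t ^ m * g z - t ^ (m + 1) * g' z (y - x)"
          by (simp only: D_def z_def w_def)
        ultimately have "D t = t ^ m * (g w - g z - g' z (w - z))"
          by (simp add: algebra_simps)
        then have "norm (D t) = t ^ m * \<bar>g w - g z - g' z (w - z)\<bar>"
          using t by (simp add: abs_mult)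
        also have "\<dots> \<le> 1 * (norm (y - x) * e)"
          using t le by (intro mult_mono power_le_one) auto
        finally show ?thesis by (simp add: mult.commute)
      qed
      show "norm (ray_mean m a g y - ray_mean m a g x - L (y - x)) \<le> e * norm (y - x)"
        using has_integral_bound[of "e * norm (y - x)" D _ 0 1] Dint bound \<open>e > 0\<close>
        by simp
    qed
  qed
qed

lemma smooth_on_ray_mean:
  assumes B: "onb (B::'e::real_inner set)" and g: "smooth_on (ball a r) g"
  shows "smooth_on (ball (a::'e) r) (ray_mean m a g)"
proof -
  have "Ck_on k (ball a r) (ray_mean m a g)" for k
    using g
  proof (induction k arbitrary: m g)
    case 0
    show ?case
      using ray_mean_has_derivative[OF B 0]
      by (auto intro!: continuous_at_imp_continuous_on has_derivative_continuous)
  next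
    case (Suc k)
    show ?case
      by (rule Ck_on_SucI[OF open_ball ray_mean_has_derivative[OF B Suc.prems]])
        (auto intro!: Suc.IH smooth_on_frechet Suc.prems)
  qed
  then show ?thesis by (simp add: smooth_on_def)
qed

text \<open>Hadamard's lemma: integrating the derivative of \<open>f\<close> along the segment from \<open>a\<close> to \<open>x\<close> and expanding
  \<open>x - a\<close> in the basis gives the factors as averages of the partial derivatives. It is the reason
  why a derivation at \<open>a\<close> is determined by its values on the coordinate functions.\<close>

lemma hadamard:
  assumes B: "onb (B::'e::real_inner set)" and f: "smooth_on (ball a r) f" and "r > 0"
  shows "\<exists>h. (\<forall>b\<in>B. smooth_on (ball (a::'e) r) (h b) \<and> h b a = frechet_derivative f (at a) b) \<and>
    (\<forall>x\<in>ball a r. f x = f a + (\<Sum>b\<in>B. inner (x - a) b * h b x))"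
proof -
  define f' where "f' z = frechet_derivative f (at z)" for z
  define h where "h b = ray_mean 0 a (\<lambda>z. f' z b)" for b
  have f': "smooth_on (ball a r) (\<lambda>z. f' z b)" for b
    unfolding f'_def using smooth_on_frechet[OF f] .
  have fd: "(f has_derivative f' z) (at z)" if "z \<in> ball a r" for z
    unfolding f'_def using smooth_onD_derivative[OF f that] .
  show ?thesis
  proof (intro exI[of _ h] conjI ballI)
    fix b assume "b \<in> B"
    show "smooth_on (ball a r) (h b)" unfolding h_def by (rule smooth_on_ray_mean[OF B f'])
    show "h b a = frechet_derivative f (at a) b" by (simp add: h_def ray_mean_def f'_def)
  next
    fix x assume x: "x \<in> ball a r"
    define z where "z t = a + t *\<^sub>R (x - a)" for t :: real
    have zt: "z t \<in> ball a r" if "t \<in> {0..1}" for t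
      using ray_in_cball[of x a "dist a x" t] that x by (auto simp: z_def)
    have K: "cball a (dist a x) \<subseteq> ball a r" using x by auto
    have cont: "continuous_on (cball a (dist a x)) (\<lambda>z. f' z b)" for b
      using smooth_on_subset[OF f' K] Ck_on_imp_continuous unfolding smooth_on_def by blast
    have int: "(\<lambda>t. f' (z t) b) integrable_on {0..1}" for b
      using ray_mean_integrable[OF cont, of x 0 b] by (simp add: z_def)
    have "((\<lambda>t. f' (z t) (x - a)) has_integral (f (z 1) - f (z 0))) {0..1}"
    proof (rule fundamental_theorem_of_calculus)
      fix t :: real assume t: "t \<in> {0..1}"
      have "(z has_vector_derivative (x - a)) (at t within {0..1})"
        unfolding z_def by (auto intro!: derivative_eq_intros simp: has_vector_derivative_def)
      then show "((\<lambda>t. f (z t)) has_vector_derivative f' (z t) (x - a)) (at t within {0..1})"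
        using vector_derivative_diff_chain_within[of z "x - a" t "{0..1}" f "f' (z t)"]
          has_derivative_at_withinI[OF fd[OF zt[OF t]]] by (simp add: o_def)
    qed simp
    then have "f x - f a = integral {0..1} (\<lambda>t. f' (z t) (x - a))"
      by (simp add: integral_unique z_def)
    also have "\<dots> = integral {0..1} (\<lambda>t. \<Sum>b\<in>B. inner (x - a) b * f' (z t) b)"
    proof (rule integral_cong)
      fix t :: real assume t: "t \<in> {0..1}"
      show "f' (z t) (x - a) = (\<Sum>b\<in>B. inner (x - a) b * f' (z t) b)"
        by (rule onb_linear_expand[OF B]) (use fd[OF zt[OF t]] has_derivative_linear in blast)
    qed
    also have "\<dots> = (\<Sum>b\<in>B. inner (x - a) b * integral {0..1} (\<lambda>t. f' (z t) b))"
      using integral_sum[OF onb_finite[OF B], of "\<lambda>b t. inner (x - a) b * f' (z t) b" "{0..1}"]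
        integrable_on_mult_right[OF int] by simp
    finally show "f x = f a + (\<Sum>b\<in>B. inner (x - a) b * h b x)"
      by (simp add: h_def ray_mean_def z_def)
  qed
qed

section \<open>Smooth functions on a manifold\<close>

locale manifold =
  fixes \<A> :: "('m::{t2_space, second_countable_topology}, 'e::real_inner) chart set"
    and B :: "'e set"
  assumes smooth_manifold: "smooth_manifold \<A>" and onb: "onb B"
begin

abbreviation "C \<equiv> smooth_functions \<A>"
abbreviation "T \<equiv> tangent_space \<A>"
abbreviation "VF \<equiv> vector_fields \<A>"

lemma chart_exists: obtains c where "c \<in> \<A>" "p \<in> fst c"
proof -
  have "p \<in> (\<Union>c\<in>\<A>. fst c)" using smooth_manifold by (simp add: smooth_manifold_def)
  then show ?thesis using that by blast
qed

lemma chart: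
  assumes "c \<in> \<A>"
  shows chart_open: "open (fst c)" and chart_open_image: "open (snd c ` fst c)"
    and chart_homeo: "homeomorphism (fst c) (snd c ` fst c) (snd c) (chart_inv c)"
  using smooth_manifold assms by (auto simp: smooth_manifold_def)

lemma chart_inv_chart [simp]: "c \<in> \<A> \<Longrightarrow> q \<in> fst c \<Longrightarrow> chart_inv c (snd c q) = q"
  using chart_homeo unfolding homeomorphism_def by blast

lemma chart_image_open:
  assumes "c \<in> \<A>" "open W"
  shows "open (snd c ` (fst c \<inter> W))"
proof -
  have "snd c ` (fst c \<inter> W) = snd c ` fst c \<inter> chart_inv c -` W"
    using assms(1) by force
  moreover have "continuous_on (snd c ` fst c) (chart_inv c)"
    using chart_homeo[OF assms(1)] by (simp add: homeomorphism_def)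
  ultimately show ?thesis
    using continuous_open_preimage chart_open_image assms by metis
qed

lemma chart_preimage_open:
  assumes "c \<in> \<A>" "open S"
  shows "open (fst c \<inter> snd c -` S)"
  using chart_homeo[OF assms(1)] chart_open[OF assms(1)] assms(2)
  by (auto simp: homeomorphism_def intro: continuous_open_preimage)

lemma smooth_functionsD: "f \<in> C \<Longrightarrow> c \<in> \<A> \<Longrightarrow> smooth_on (snd c ` fst c) (\<lambda>x. f (chart_inv c x))"
  by (simp add: smooth_functions_def o_def)

text \<open>Smoothness near \<open>q\<close> tested in a single chart; the transition maps carry it to all other charts.\<close>

definition smooth_near :: "('m \<Rightarrow> real) \<Rightarrow> 'm \<Rightarrow> bool"
  where "smooth_near f q \<longleftrightarrow> (\<exists>c\<in>\<A>. q \<in> fst c \<and> (\<exists>S. open S \<and> snd c q \<in> S \<and>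
    S \<subseteq> snd c ` fst c \<and> smooth_on S (\<lambda>x. f (chart_inv c x))))"

lemma smooth_functions_iff: "f \<in> C \<longleftrightarrow> (\<forall>q. smooth_near f q)"
proof
  assume f: "f \<in> C"
  show "\<forall>q. smooth_near f q"
  proof
    fix q
    obtain c where "c \<in> \<A>" "q \<in> fst c" by (rule chart_exists)
    then show "smooth_near f q"
      unfolding smooth_near_def using smooth_functionsD[OF f] chart_open_image by blast
  qed
next
  assume near: "\<forall>q. smooth_near f q"
  show "f \<in> C" unfolding smooth_functions_def
  proof (intro CollectI ballI)
    fix d assume d: "d \<in> \<A>"
    show "smooth_on (snd d ` fst d) (f \<circ> chart_inv d)"
    proof (rule smooth_on_local)
      fix x assume "x \<in> snd d ` fst d"
      then obtain q where q: "q \<in> fst d" "x = snd d q" by blast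
      obtain c S where c: "c \<in> \<A>" "q \<in> fst c" and S: "open S" "snd c q \<in> S"
        "S \<subseteq> snd c ` fst c" "smooth_on S (\<lambda>x. f (chart_inv c x))"
        using near unfolding smooth_near_def by blast
      define W where "W = fst c \<inter> snd c -` S"
      have W: "open W" "q \<in> W" using chart_preimage_open[OF c(1) S(1)] c S by (auto simp: W_def)
      define N where "N = snd d ` (fst d \<inter> W)"
      have N: "open N" "x \<in> N" using chart_image_open[OF d W(1)] q W by (auto simp: N_def)
      have "smooth_on (snd d ` (fst d \<inter> fst c)) (snd c \<circ> chart_inv d)"
        using smooth_manifold c d by (simp add: smooth_manifold_def)
      then have tr: "smooth_on N (\<lambda>x. snd c (chart_inv d x))"
        using smooth_on_subset[of "snd d ` (fst d \<inter> fst c)" "snd c \<circ> chart_inv d" N]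
        by (auto simp: N_def W_def o_def)
      have "smooth_on N (\<lambda>x. f (chart_inv c (snd c (chart_inv d x))))"
        by (rule smooth_on_compose[OF onb N(1) S(1) _ S(4) tr]) (use d in \<open>auto simp: N_def W_def\<close>)
      then have "smooth_on N (f \<circ> chart_inv d)"
        by (rule smooth_on_transfer[OF _ N(1)]) (use c d in \<open>auto simp: N_def W_def\<close>)
      then show "\<exists>N. open N \<and> x \<in> N \<and> smooth_on N (f \<circ> chart_inv d)" using N by blast
    qed
  qed
qed

lemma smooth_near_cong:
  assumes "smooth_near h q" "eventually (\<lambda>x. f x = h x) (nhds q)"
  shows "smooth_near f q"
proof -
  obtain c S where c: "c \<in> \<A>" "q \<in> fst c" and S: "open S" "snd c q \<in> S"
    "S \<subseteq> snd c ` fst c" "smooth_on S (\<lambda>x. h (chart_inv c x))"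
    using assms(1) unfolding smooth_near_def by blast
  obtain W where W: "open W" "q \<in> W" "\<And>x. x \<in> W \<Longrightarrow> f x = h x"
    using assms(2) unfolding eventually_nhds by blast
  define N where "N = snd c ` (fst c \<inter> W) \<inter> S"
  have N: "open N" "snd c q \<in> N"
    using chart_image_open[OF c(1) W(1)] S c W by (auto simp: N_def)
  have "smooth_on N (\<lambda>x. h (chart_inv c x))"
    using S(4) smooth_on_subset[of S _ N] by (auto simp: N_def)
  then have "smooth_on N (\<lambda>x. f (chart_inv c x))"
    by (rule smooth_on_transfer[OF _ N(1)]) (use W(3) c(1) in \<open>auto simp: N_def\<close>)
  moreover have "N \<subseteq> snd c ` fst c" by (auto simp: N_def)
  ultimately show ?thesis unfolding smooth_near_def using c N by blast
qed

text \<open>The gluing principle by which local constructions become global; vector fields inherit it in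
  \<open>VFI_local\<close>.\<close>

lemma smooth_functionsI_local:
  assumes "\<And>q. \<exists>h\<in>C. eventually (\<lambda>x. f x = h x) (nhds q)"
  shows "f \<in> C"
  using assms smooth_near_cong smooth_functions_iff by metis

lemma smooth_const [simp]: "(\<lambda>p. a) \<in> C"
  by (simp add: smooth_functions_def o_def smooth_on_const)

lemma smooth_add [intro]: "f \<in> C \<Longrightarrow> h \<in> C \<Longrightarrow> (\<lambda>p. f p + h p) \<in> C"
  using chart_open_image by (auto simp: smooth_functions_def o_def intro!: smooth_on_add)

lemma smooth_mult [intro]: "f \<in> C \<Longrightarrow> h \<in> C \<Longrightarrow> (\<lambda>p. f p * h p) \<in> C"
  using chart_open_image by (auto simp: smooth_functions_def o_def intro!: smooth_on_mult)

lemma smooth_diff [intro]: "f \<in> C \<Longrightarrow> h \<in> C \<Longrightarrow> (\<lambda>p. f p - h p) \<in> C"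
  using smooth_add[OF _ smooth_mult[OF smooth_const[of "-1"]]] by simp

lemma smooth_sum [intro]: "(\<And>i. i \<in> I \<Longrightarrow> f i \<in> C) \<Longrightarrow> (\<lambda>p. \<Sum>i\<in>I. f i p) \<in> C"
  by (induction I rule: infinite_finite_induct) auto

lemma smooth_compose:
  assumes "f \<in> C" "smooth_on S (\<phi>::real \<Rightarrow> real)" "open S" "\<And>p. f p \<in> S"
  shows "(\<lambda>p. \<phi> (f p)) \<in> C"
  unfolding smooth_functions_def o_def
  using assms smooth_on_compose[OF onb_real chart_open_image assms(3) _ assms(2) smooth_functionsD[OF assms(1)]]
  by auto

lemma smooth_continuous:
  assumes "f \<in> C" shows "continuous_on UNIV f"
proof -
  have "isCont f q" for q
  proof -
    obtain c where c: "c \<in> \<A>" "q \<in> fst c" by (rule chart_exists)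
    have "continuous_on (snd c ` fst c) (\<lambda>x. f (chart_inv c x))"
      using smooth_functionsD[OF assms c(1)] Ck_on_imp_continuous unfolding smooth_on_def by blast
    moreover have "continuous_on (fst c) (snd c)"
      using chart_homeo[OF c(1)] by (simp add: homeomorphism_def)
    ultimately have "continuous_on (fst c) (\<lambda>q. f (chart_inv c (snd c q)))"
      using continuous_on_compose2 by blast
    then have "continuous_on (fst c) f" using c(1) by (simp cong: continuous_on_cong)
    then show ?thesis using c chart_open continuous_on_eq_continuous_at by blast
  qed
  then show ?thesis by (simp add: continuous_at_imp_continuous_on)
qed

lemma smooth_on_coordinate: "open S \<Longrightarrow> smooth_on S (\<lambda>x. inner (x::'e) b)"
  by (intro smooth_on_bounded_linear[OF bounded_linear_inner_left] smooth_on_id)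

text \<open>Compose the step function with the squared distance in a chart. The support \<open>K\<close> is the preimage of
  a closed ball; it is closed in the manifold because that ball is compact and the manifold is
  Hausdorff.\<close>

lemma bump_exists:
  assumes "open W" "p \<in> W"
  obtains \<theta> K where "\<theta> \<in> C" "eventually (\<lambda>q. \<theta> q = 1) (nhds p)" "closed K" "K \<subseteq> W"
    "\<And>q. q \<notin> K \<Longrightarrow> \<theta> q = 0"
proof -
  obtain \<beta> :: "real \<Rightarrow> real" where \<beta>: "smooth_on UNIV \<beta>" "\<And>t. t \<le> 1 \<Longrightarrow> \<beta> t = 1" "\<And>t. t \<ge> 2 \<Longrightarrow> \<beta> t = 0"
    using smooth_step_exists by blast
  obtain c where c: "c \<in> \<A>" "p \<in> fst c" by (rule chart_exists)
  define x0 where "x0 = snd c p"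
  have "open (snd c ` (fst c \<inter> W))" "x0 \<in> snd c ` (fst c \<inter> W)"
    using chart_image_open[OF c(1) assms(1)] c assms by (auto simp: x0_def)
  then obtain s where s: "s > 0" "cball x0 s \<subseteq> snd c ` (fst c \<inter> W)"
    using open_contains_cball by meson
  define r where "r = s / 2"
  have r: "r > 0" "s = 2 * r" using s by (simp_all add: r_def)
  define K where "K = chart_inv c ` cball x0 s"
  have "continuous_on (cball x0 s) (chart_inv c)"
    using chart_homeo[OF c(1)] s(2) by (auto simp: homeomorphism_def elim!: continuous_on_subset)
  then have "compact K" unfolding K_def by (intro compact_continuous_image compact_cball_onb[OF onb])
  then have K: "closed K" by (rule compact_imp_closed)
  have KW: "K \<subseteq> fst c \<inter> W" using s(2) c(1) by (force simp: K_def)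
  define \<rho> where "\<rho> x = inverse (r\<^sup>2) * (\<Sum>b\<in>B. inner (x + - x0) b * inner (x + - x0) b)" for x
  have \<rho>: "\<rho> x = (norm (x - x0) / r)\<^sup>2" for x
  proof -
    have "(norm (x - x0))\<^sup>2 = inner (x - x0) (\<Sum>b\<in>B. inner (x - x0) b *\<^sub>R b)"
      by (simp add: onb_expand[OF onb] power2_norm_eq_inner)
    then show ?thesis by (simp add: \<rho>_def inner_sum_right power_divide divide_inverse power_mult_distrib power_inverse mult.commute)
  qed
  have \<rho>s: "smooth_on (snd c ` fst c) (\<lambda>x. \<beta> (\<rho> x))"
  proof (rule smooth_on_compose[OF onb_real chart_open_image[OF c(1)] open_UNIV _ \<beta>(1)])
    have "smooth_on (snd c ` fst c) (\<lambda>x. inner (x + - x0) b)" for b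
      by (intro smooth_on_bounded_linear[OF bounded_linear_inner_left] smooth_on_add smooth_on_id
          smooth_on_const chart_open_image c(1))
    then show "smooth_on (snd c ` fst c) \<rho>"
      unfolding \<rho>_def by (intro smooth_on_mult smooth_on_const smooth_on_sum chart_open_image c(1))
  qed simp
  define \<theta> where "\<theta> q = (if q \<in> fst c then \<beta> (\<rho> (snd c q)) else 0)" for q
  have off: "\<theta> q = 0" if "q \<notin> K" for q
  proof (cases "q \<in> fst c")
    case True
    have "snd c q \<notin> cball x0 s" using that True c(1) by (force simp: K_def)
    then have "2 \<le> norm (snd c q - x0) / r" using r by (simp add: dist_norm norm_minus_commute field_simps)
    then have "2\<^sup>2 \<le> (norm (snd c q - x0) / r)\<^sup>2" by (intro power_mono) auto
    then show ?thesis using \<beta>(3) by (simp add: \<theta>_def \<rho>)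
  qed (simp add: \<theta>_def)
  have "smooth_near \<theta> q" for q
  proof (cases "q \<in> fst c")
    case True
    have "smooth_on (snd c ` fst c) (\<lambda>x. \<theta> (chart_inv c x))"
      by (rule smooth_on_transfer[OF \<rho>s chart_open_image[OF c(1)]]) (use c(1) in \<open>auto simp: \<theta>_def\<close>)
    then show ?thesis unfolding smooth_near_def using True c(1) chart_open_image[OF c(1)]
      by (intro bexI[of _ c] conjI exI[of _ "snd c ` fst c"]) auto
  next
    case False
    then have "eventually (\<lambda>x. \<theta> x = 0) (nhds q)"
      unfolding eventually_nhds using K KW off by (intro exI[of _ "- K"]) auto
    then show ?thesis
      by (rule smooth_near_cong[OF smooth_functions_iff[THEN iffD1, rule_format, OF smooth_const]])
  qed
  then have "\<theta> \<in> C" by (simp add: smooth_functions_iff)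
  moreover have "eventually (\<lambda>q. \<theta> q = 1) (nhds p)"
    unfolding eventually_nhds
  proof (intro exI[of _ "fst c \<inter> snd c -` ball x0 r"] conjI ballI)
    fix q assume "q \<in> fst c \<inter> snd c -` ball x0 r"
    then have "q \<in> fst c" "norm (snd c q - x0) / r \<le> 1"
      using r by (auto simp: dist_norm norm_minus_commute)
    then show "\<theta> q = 1" using \<beta>(2) r by (simp add: \<theta>_def \<rho> power_le_one)
  qed (use chart_preimage_open c r in \<open>auto simp: x0_def\<close>)
  ultimately show thesis using K KW off by (intro that[of \<theta> K]) auto
qed

text \<open>A function given in a chart becomes a global one after multiplication by a cutoff.\<close>

lemma smooth_extend_by_zero:
  assumes c: "c \<in> \<A>" and W: "open W" "W \<subseteq> fst c" and g: "smooth_on (snd c ` W) g"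
    and \<theta>: "\<theta> \<in> C" "closed K" "K \<subseteq> W" "\<And>q. q \<notin> K \<Longrightarrow> \<theta> q = 0"
  shows "(\<lambda>q. if q \<in> W then \<theta> q * g (snd c q) else 0) \<in> C" (is "?f \<in> C")
  unfolding smooth_functions_iff
proof
  fix q
  have eqW: "snd c ` (fst c \<inter> W) = snd c ` W" using W(2) by auto
  have oW: "open (snd c ` W)" using chart_image_open[OF c W(1)] eqW by simp
  show "smooth_near ?f q"
  proof (cases "q \<in> W")
    case True
    have "smooth_on (snd c ` W) (\<lambda>x. \<theta> (chart_inv c x) * g x)"
      using smooth_on_subset[OF smooth_functionsD[OF \<theta>(1) c]] W(2)
      by (intro smooth_on_mult oW g) blast
    then have "smooth_on (snd c ` W) (\<lambda>x. ?f (chart_inv c x))"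
      by (rule smooth_on_transfer[OF _ oW]) (use c W(2) in \<open>auto simp: subset_iff\<close>)
    then show ?thesis unfolding smooth_near_def using True c W oW
      by (intro bexI[of _ c] conjI exI[of _ "snd c ` W"]) auto
  next
    case False
    then have "eventually (\<lambda>x. ?f x = 0) (nhds q)"
      unfolding eventually_nhds using \<theta> by (intro exI[of _ "- K"]) auto
    then show ?thesis
      by (rule smooth_near_cong[OF smooth_functions_iff[THEN iffD1, rule_format, OF smooth_const]])
  qed
qed

text \<open>Cutting off \<open>1 / h\<close> makes division possible near \<open>p\<close> without leaving the globally smooth functions.\<close>

lemma local_inverse:
  assumes "h \<in> C" "h p \<noteq> 0"
  obtains k where "k \<in> C" "eventually (\<lambda>q. k q * h q = 1) (nhds p)"
proof -
  obtain c where c: "c \<in> \<A>" "p \<in> fst c" by (rule chart_exists)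
  define W where "W = fst c \<inter> h -` (- {0})"
  have W: "open W" "p \<in> W" "W \<subseteq> fst c"
    using smooth_continuous[OF assms(1)] chart_open[OF c(1)] assms(2) c(2)
    by (auto simp: W_def intro!: open_Int open_vimage open_Compl)
  obtain \<theta> K where \<theta>: "\<theta> \<in> C" "eventually (\<lambda>q. \<theta> q = 1) (nhds p)" "closed K" "K \<subseteq> W"
    "\<And>q. q \<notin> K \<Longrightarrow> \<theta> q = 0" using bump_exists[OF W(1,2)] by metis
  have oW: "open (snd c ` W)"
    using chart_image_open[OF c(1) W(1)] W(3) by (simp add: Int_absorb1)
  have "smooth_on (snd c ` W) (\<lambda>x. h (chart_inv c x))"
    by (rule smooth_on_subset[OF smooth_functionsD[OF assms(1) c(1)]]) (auto simp: W_def)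
  then have "smooth_on (snd c ` W) (\<lambda>x. inverse (h (chart_inv c x)))"
    using c(1) by (intro smooth_on_inverse oW) (auto simp: W_def)
  from smooth_extend_by_zero[OF c(1) W(1,3) this \<theta>(1,3-5)]
  have "(\<lambda>q. if q \<in> W then \<theta> q * inverse (h (chart_inv c (snd c q))) else 0) \<in> C" (is "?k \<in> C") .
  moreover have "eventually (\<lambda>q. q \<in> W) (nhds p)" using W eventually_nhds by blast
  with \<theta>(2) have "eventually (\<lambda>q. ?k q * h q = 1) (nhds p)"
    by eventually_elim (use c(1) in \<open>auto simp: W_def\<close>)
  ultimately show thesis using that by blast
qed

end

section \<open>Tangent vectors and coordinate frames\<close>

lemma sum_fun_apply: "(\<Sum>i\<in>I. f i) x = (\<Sum>i\<in>I. f i x)"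
  by (induction I rule: infinite_finite_induct) auto

lemma scaleR_fun_apply [simp]: "(a *\<^sub>R f) x = a *\<^sub>R f x"
  by (simp add: scaleR_fun_def)

context manifold
begin

lemma tangent_add: "v \<in> T p \<Longrightarrow> f \<in> C \<Longrightarrow> h \<in> C \<Longrightarrow> v (\<lambda>q. f q + h q) = v f + v h"
  and tangent_scale: "v \<in> T p \<Longrightarrow> f \<in> C \<Longrightarrow> v (\<lambda>q. a * f q) = a * v f"
  and tangent_mult: "v \<in> T p \<Longrightarrow> f \<in> C \<Longrightarrow> h \<in> C \<Longrightarrow> v (\<lambda>q. f q * h q) = f p * v h + h p * v f"
  and tangent_nonsmooth: "v \<in> T p \<Longrightarrow> f \<notin> C \<Longrightarrow> v f = 0"
  by (auto simp: tangent_space_def plus_fun_def times_fun_def scaleR_fun_def)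

lemma tangent_spaceI:
  assumes "\<And>f h. f \<in> C \<Longrightarrow> h \<in> C \<Longrightarrow> v (\<lambda>q. f q + h q) = v f + v h"
    and "\<And>f a. f \<in> C \<Longrightarrow> v (\<lambda>q. a * f q) = a * v f"
    and "\<And>f h. f \<in> C \<Longrightarrow> h \<in> C \<Longrightarrow> v (\<lambda>q. f q * h q) = f p * v h + h p * v f"
    and "\<And>f. f \<notin> C \<Longrightarrow> v f = 0"
  shows "v \<in> T p"
  using assms by (simp add: tangent_space_def plus_fun_def times_fun_def scaleR_fun_def)

lemma tangent_const: "v \<in> T p \<Longrightarrow> v (\<lambda>q. a) = 0"
proof -
  assume v: "v \<in> T p"
  have "v (\<lambda>q. 1 * 1) = 1 * v (\<lambda>q. 1) + 1 * v (\<lambda>q. 1)"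
    using tangent_mult[OF v smooth_const smooth_const] .
  then have "v (\<lambda>q. 1) = 0" by simp
  then show ?thesis using tangent_scale[OF v smooth_const, of a 1] by simp
qed

lemma tangent_diff: "v \<in> T p \<Longrightarrow> f \<in> C \<Longrightarrow> h \<in> C \<Longrightarrow> v (\<lambda>q. f q - h q) = v f - v h"
  using tangent_add[of v p f "\<lambda>q. -1 * h q"] tangent_scale[of v p h "-1"]
    smooth_mult[OF smooth_const[of "-1"], of h] by simp

lemma tangent_sum:
  "v \<in> T p \<Longrightarrow> (\<And>i. i \<in> I \<Longrightarrow> f i \<in> C) \<Longrightarrow> v (\<lambda>q. \<Sum>i\<in>I. f i q) = (\<Sum>i\<in>I. v (f i))"
proof (induction I rule: infinite_finite_induct)
  case (insert i I)
  then show ?case using tangent_add[of v p "f i" "\<lambda>q. \<Sum>i\<in>I. f i q"] by auto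
qed (auto simp: tangent_const)

lemma T_zero [simp, intro]: "0 \<in> T p"
  by (simp add: tangent_space_def)

lemma T_add [intro]: "u \<in> T p \<Longrightarrow> v \<in> T p \<Longrightarrow> u + v \<in> T p"
  by (simp add: tangent_space_def algebra_simps)

lemma T_scale [intro]: "v \<in> T p \<Longrightarrow> a *\<^sub>R v \<in> T p"
  by (simp add: tangent_space_def algebra_simps)

lemma T_minus [intro]: "v \<in> T p \<Longrightarrow> - v \<in> T p"
  using T_scale[of v p "-1"] by simp

lemma T_diff [intro]: "u \<in> T p \<Longrightarrow> v \<in> T p \<Longrightarrow> u - v \<in> T p"
  using T_add[OF _ T_minus, of u p v] by simp

lemma T_sum [intro]: "(\<And>i. i \<in> I \<Longrightarrow> v i \<in> T p) \<Longrightarrow> (\<Sum>i\<in>I. v i) \<in> T p"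
  by (induction I rule: infinite_finite_induct) auto

lemma VF_T: "X \<in> VF \<Longrightarrow> X p \<in> T p"
  and VF_smooth: "X \<in> VF \<Longrightarrow> f \<in> C \<Longrightarrow> (\<lambda>p. X p f) \<in> C"
  by (auto simp: vector_fields_def)

lemma VFI: "(\<And>p. X p \<in> T p) \<Longrightarrow> (\<And>f. f \<in> C \<Longrightarrow> (\<lambda>p. X p f) \<in> C) \<Longrightarrow> X \<in> VF"
  by (auto simp: vector_fields_def)

lemma VF_zero [simp, intro]: "(\<lambda>p. 0) \<in> VF" "0 \<in> VF"
  by (auto intro!: VFI)

lemma VF_add [intro]: "X \<in> VF \<Longrightarrow> Y \<in> VF \<Longrightarrow> (\<lambda>p. X p + Y p) \<in> VF"
  by (rule VFI) (simp_all add: T_add[OF VF_T VF_T] smooth_add[OF VF_smooth VF_smooth])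

lemma VF_mult [intro]: "f \<in> C \<Longrightarrow> X \<in> VF \<Longrightarrow> (\<lambda>p. f p *\<^sub>R X p) \<in> VF"
  by (rule VFI) (simp_all add: T_scale[OF VF_T] smooth_mult[OF _ VF_smooth])

lemma VF_scale [intro]: "X \<in> VF \<Longrightarrow> (\<lambda>p. a *\<^sub>R X p) \<in> VF"
  using VF_mult[OF smooth_const] .

lemma VF_diff [intro]: "X \<in> VF \<Longrightarrow> Y \<in> VF \<Longrightarrow> (\<lambda>p. X p - Y p) \<in> VF"
  using VF_add[OF _ VF_scale[of Y "-1"]] by simp

lemma VF_sum [intro]: "(\<And>i. i \<in> I \<Longrightarrow> X i \<in> VF) \<Longrightarrow> (\<lambda>p. \<Sum>i\<in>I. X i p) \<in> VF"
  by (induction I rule: infinite_finite_induct) auto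

lemma VFI_local:
  assumes "\<And>p. \<exists>Y\<in>VF. eventually (\<lambda>q. X q = Y q) (nhds p)"
  shows "X \<in> VF"
proof (rule VFI)
  fix p
  obtain Y where Y: "Y \<in> VF" "eventually (\<lambda>q. X q = Y q) (nhds p)" using assms by blast
  then have "X p = Y p" by (blast dest: eventually_nhds_x_imp_x)
  then show "X p \<in> T p" using VF_T[OF Y(1)] by simp
next
  fix f assume f: "f \<in> C"
  show "(\<lambda>p. X p f) \<in> C"
  proof (rule smooth_functionsI_local)
    fix p
    obtain Y where Y: "Y \<in> VF" "eventually (\<lambda>q. X q = Y q) (nhds p)" using assms by blast
    from Y(2) have "eventually (\<lambda>q. X q f = Y q f) (nhds p)" by eventually_elim simp
    then show "\<exists>h\<in>C. eventually (\<lambda>q. X q f = h q) (nhds p)"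
      by (intro bexI[of _ "\<lambda>q. Y q f"] VF_smooth[OF Y(1) f])
  qed
qed

text \<open>Derivations are local: if \<open>f\<close> and \<open>h\<close> agree near \<open>p\<close>, a cutoff \<open>\<theta>\<close> supported there kills
  \<open>f - h\<close>, and the product rule applied to \<open>\<theta> * (f - h) = 0\<close> leaves \<open>v f = v h\<close>.\<close>

lemma tangent_local:
  assumes v: "v \<in> T p" and f: "f \<in> C" "h \<in> C" and eq: "eventually (\<lambda>q. f q = h q) (nhds p)"
  shows "v f = v h"
proof -
  obtain W where W: "open W" "p \<in> W" "\<And>q. q \<in> W \<Longrightarrow> f q = h q"
    using eq unfolding eventually_nhds by blast
  obtain \<theta> K where \<theta>: "\<theta> \<in> C" "eventually (\<lambda>q. \<theta> q = 1) (nhds p)" "closed K" "K \<subseteq> W"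
    "\<And>q. q \<notin> K \<Longrightarrow> \<theta> q = 0" using bump_exists[OF W(1,2)] by metis
  have "(\<lambda>q. \<theta> q * (f q - h q)) = (\<lambda>q. 0)" (is "?l = ?r")
  proof
    fix q show "?l q = ?r q" using \<theta>(4) \<theta>(5)[of q] W(3)[of q] by (cases "q \<in> K") auto
  qed
  then have "v (\<lambda>q. \<theta> q * (f q - h q)) = 0" using tangent_const[OF v, of 0] by (simp only:)
  moreover have "v (\<lambda>q. \<theta> q * (f q - h q)) = \<theta> p * v (\<lambda>q. f q - h q) + (f p - h p) * v \<theta>"
    by (rule tangent_mult[OF v \<theta>(1) smooth_diff[OF f]])
  moreover have "\<theta> p = 1" using \<theta>(2) by (rule eventually_nhds_x_imp_x)
  moreover have "f p = h p" using eq by (rule eventually_nhds_x_imp_x)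
  ultimately show ?thesis by (simp add: tangent_diff[OF v f])
qed

definition chart_derivative :: "('m, 'e) chart \<Rightarrow> 'm \<Rightarrow> ('m \<Rightarrow> real) \<Rightarrow> 'e \<Rightarrow> real"
  where "chart_derivative c q f = frechet_derivative (\<lambda>x. f (chart_inv c x)) (at (snd c q))"

lemma chart_derivative:
  "f \<in> C \<Longrightarrow> c \<in> \<A> \<Longrightarrow> q \<in> fst c \<Longrightarrow>
    ((\<lambda>x. f (chart_inv c x)) has_derivative chart_derivative c q f) (at (snd c q))"
  unfolding chart_derivative_def by (rule smooth_onD_derivative[OF smooth_functionsD]) auto

text \<open>The partial derivative in direction \<open>b\<close> of a chart, cut off to a global vector field.\<close>

lemma chart_vector_field:
  assumes c: "c \<in> \<A>" and \<theta>: "\<theta> \<in> C" "closed K" "K \<subseteq> fst c" "\<And>q. q \<notin> K \<Longrightarrow> \<theta> q = 0"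
  shows "(\<lambda>q f. if f \<in> C \<and> q \<in> fst c then \<theta> q * chart_derivative c q f b else 0) \<in> VF" (is "?X \<in> VF")
proof (rule VFI)
  fix q
  note D = chart_derivative[OF _ c]
  have val: "chart_derivative c q f = f'" if
    "((\<lambda>x. f (chart_inv c x)) has_derivative f') (at (snd c q))" for f f'
    unfolding chart_derivative_def by (rule has_derivative_imp_frechet[OF that])
  show "?X q \<in> T q"
  proof (rule tangent_spaceI)
    fix f h assume f: "f \<in> C" and h: "h \<in> C"
    have "chart_derivative c q (\<lambda>q. f q + h q) b = chart_derivative c q f b + chart_derivative c q h b"
      if "q \<in> fst c" using val[OF has_derivative_add[OF D[OF f that] D[OF h that]]] by simp
    then show "?X q (\<lambda>q. f q + h q) = ?X q f + ?X q h"
      using f h smooth_add[OF f h] by (simp add: algebra_simps)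
    have "chart_derivative c q (\<lambda>q. f q * h q) b = f q * chart_derivative c q h b + h q * chart_derivative c q f b"
      if "q \<in> fst c" using val[OF has_derivative_mult[OF D[OF f that] D[OF h that]]] c that by simp
    then show "?X q (\<lambda>q. f q * h q) = f q * ?X q h + h q * ?X q f"
      using f h smooth_mult[OF f h] by (simp add: algebra_simps)
  next
    fix f a assume f: "f \<in> C"
    have "chart_derivative c q (\<lambda>q. a * f q) b = a * chart_derivative c q f b"
      if "q \<in> fst c" using val[OF has_derivative_mult_right[OF D[OF f that]], of a] by simp
    then show "?X q (\<lambda>q. a * f q) = a * ?X q f"
      using f smooth_mult[OF smooth_const f] by (simp add: algebra_simps)
  qed simp
next
  fix f assume f: "f \<in> C"
  from smooth_extend_by_zero[OF c chart_open[OF c] subset_refl smooth_on_frechet[OF smooth_functionsD[OF f c]] \<theta>]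
  have "(\<lambda>q. if q \<in> fst c then \<theta> q * chart_derivative c q f b else 0) \<in> C"
    unfolding chart_derivative_def .
  then show "(\<lambda>q. ?X q f) \<in> C" using f by simp
qed

text \<open>Global fields and functions that near \<open>p\<close> are the coordinate fields and the coordinate functions of a
  chart. Duality and the expansion of tangent vectors hold near \<open>p\<close>; at \<open>p\<close>
  itself the chart identifies the frame vectors with partial derivatives.\<close>

definition coordinate_frame :: "'m \<Rightarrow> ('e \<Rightarrow> 'm \<Rightarrow> 'm tangent) \<Rightarrow> ('e \<Rightarrow> 'm \<Rightarrow> real) \<Rightarrow> bool"
  where "coordinate_frame p W y \<longleftrightarrow>
    (\<forall>b\<in>B. W b \<in> VF \<and> y b \<in> C) \<and>
    (\<exists>c\<in>\<A>. p \<in> fst c \<and> (\<forall>b. \<forall>f\<in>C. W b p f = chart_derivative c p f b)) \<and>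
    eventually (\<lambda>q. (\<forall>b\<in>B. \<forall>b'\<in>B. W b q (y b') = (if b = b' then 1 else 0)) \<and>
      (\<forall>v\<in>T q. v = (\<Sum>b\<in>B. v (y b) *\<^sub>R W b q))) (nhds p)"

text \<open>The point is that the coordinate fields span the space of derivations. Near a point \<open>q\<close>, Hadamard's
  lemma writes \<open>f\<close> as \<open>f q\<close> plus the sum of \<open>(y b - y b q) * H b\<close>, and a derivation sees only the
  values of the factors \<open>H b\<close> at \<open>q\<close>, that is, the partial derivatives of \<open>f\<close>.\<close>

lemma coordinate_frame_exists: "\<exists>W y. coordinate_frame p W y"
proof -
  obtain c where c: "c \<in> \<A>" "p \<in> fst c" by (rule chart_exists)
  obtain \<theta> K where \<theta>: "\<theta> \<in> C" "eventually (\<lambda>q. \<theta> q = 1) (nhds p)" "closed K" "K \<subseteq> fst c"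
    "\<And>q. q \<notin> K \<Longrightarrow> \<theta> q = 0" using bump_exists[OF chart_open[OF c(1)] c(2)] by metis
  define W where "W b q f = (if f \<in> C \<and> q \<in> fst c then \<theta> q * chart_derivative c q f b else 0)" for b q f
  define y where "y b q = (if q \<in> fst c then \<theta> q * inner (snd c q) b else 0)" for b q
  have W: "W b \<in> VF" for b
    using chart_vector_field[OF c(1) \<theta>(1,3-5)] unfolding W_def .
  have y: "y b \<in> C" for b
    unfolding y_def
    by (rule smooth_extend_by_zero[OF c(1) chart_open[OF c(1)] subset_refl
          smooth_on_coordinate[OF chart_open_image[OF c(1)]] \<theta>(1,3-5)])
  obtain O1 where O1: "open O1" "p \<in> O1" "\<And>q. q \<in> O1 \<Longrightarrow> \<theta> q = 1"
    using \<theta>(2) unfolding eventually_nhds by blast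
  define O' where "O' = fst c \<inter> O1"
  have O': "open O'" "p \<in> O'" "\<And>q. q \<in> O' \<Longrightarrow> \<theta> q = 1" "O' \<subseteq> fst c"
    using O1 c chart_open[OF c(1)] by (auto simp: O'_def)
  have oO: "open (snd c ` O')"
    using chart_image_open[OF c(1) O'(1)] O'(4) by (simp add: Int_absorb1)
  have yO: "y b q = inner (snd c q) b" if "q \<in> O'" for q b
    using O'(3)[OF that] that O'(4) by (auto simp: y_def)
  have dual: "W b q (y b') = (if b = b' then 1 else 0)" if q: "q \<in> O'" and b: "b \<in> B" "b' \<in> B" for q b b'
  proof -
    have "frechet_derivative (\<lambda>x. y b' (chart_inv c x)) (at (snd c q)) =
      frechet_derivative (\<lambda>x. inner x b') (at (snd c q))"
      by (rule frechet_cong_open(2)[OF oO]) (use q yO c(1) O'(4) in \<open>auto simp: subset_iff\<close>)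
    also have "\<dots> = (\<lambda>v. inner v b')"
      by (intro has_derivative_imp_frechet has_derivative_inner_left has_derivative_ident)
    finally show ?thesis
      using q O'(3)[OF q] O'(4) y onb_inner[OF onb b] by (auto simp: W_def chart_derivative_def)
  qed
  have expand: "v = (\<Sum>b\<in>B. v (y b) *\<^sub>R W b q)" if q: "q \<in> O'" and v: "v \<in> T q" for q v
  proof
    fix f
    show "v f = (\<Sum>b\<in>B. v (y b) *\<^sub>R W b q) f"
    proof (cases "f \<in> C")
      case False
      then show ?thesis using tangent_nonsmooth[OF v] by (simp add: sum_fun_apply W_def)
    next
      case f: True
      define a where "a = snd c q"
      obtain r where r: "r > 0" "ball a r \<subseteq> snd c ` O'"
        using oO q open_contains_ball unfolding a_def by blast
      have "smooth_on (ball a r) (\<lambda>x. f (chart_inv c x))"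
        by (rule smooth_on_subset[OF smooth_functionsD[OF f c(1)]]) (use r O'(4) in blast)
      from hadamard[OF onb this r(1)] obtain h where
        h': "\<forall>b\<in>B. smooth_on (ball a r) (h b) \<and>
          h b a = frechet_derivative (\<lambda>x. f (chart_inv c x)) (at a) b" and
        hx': "\<forall>x\<in>ball a r. f (chart_inv c x) = f (chart_inv c a) + (\<Sum>b\<in>B. inner (x - a) b * h b x)"
        by blast
      have h: "smooth_on (ball a r) (h b)" "h b a = chart_derivative c q f b" if "b \<in> B" for b
        using h' that by (auto simp: a_def chart_derivative_def)
      have hx: "f (chart_inv c x) = f q + (\<Sum>b\<in>B. inner (x - a) b * h b x)" if "x \<in> ball a r" for x
        using hx' that q O'(4) c(1) by (auto simp: a_def)
      define N where "N = fst c \<inter> snd c -` ball a r"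
      have N: "open N" "q \<in> N" "N \<subseteq> fst c"
        using chart_preimage_open[OF c(1)] r q O'(4) by (auto simp: N_def a_def)
      have NO: "N \<subseteq> O'"
      proof
        fix x assume x: "x \<in> N"
        then obtain z where "z \<in> O'" "snd c x = snd c z" using r(2) by (auto simp: N_def)
        then show "x \<in> O'" using x c(1) O'(4) chart_inv_chart by (metis N(3) subsetD)
      qed
      have cN: "snd c ` N \<subseteq> ball a r" by (auto simp: N_def)
      obtain \<psi> L where \<psi>: "\<psi> \<in> C" "eventually (\<lambda>q. \<psi> q = 1) (nhds q)" "closed L" "L \<subseteq> N"
        "\<And>q. q \<notin> L \<Longrightarrow> \<psi> q = 0" using bump_exists[OF N(1,2)] by metis
      define H where "H b q = (if q \<in> N then \<psi> q * h b (snd c q) else 0)" for b q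
      have H: "H b \<in> C" if "b \<in> B" for b
        unfolding H_def
        by (rule smooth_extend_by_zero[OF c(1) N(1,3) smooth_on_subset[OF h(1)[OF that] cN] \<psi>(1,3-5)])
      define G where "G x = f q + (\<Sum>b\<in>B. (y b x - y b q) * H b x)" for x
      have "eventually (\<lambda>x. f x = G x) (nhds q)"
      proof -
        have "eventually (\<lambda>x. x \<in> N) (nhds q)" using N eventually_nhds by blast
        with \<psi>(2) show ?thesis
        proof eventually_elim
          case (elim x)
          then have "(y b x - y b q) * H b x = inner (snd c x - a) b * h b (snd c x)" for b
            using NO yO q by (auto simp: H_def a_def inner_diff_left)
          then show ?case using hx[of "snd c x"] elim c(1) by (simp add: G_def N_def)
        qed
      qed
      moreover have "G \<in> C" unfolding G_def using y H by (intro smooth_add smooth_sum smooth_mult smooth_diff smooth_const)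
      ultimately have "v f = v G" using tangent_local[OF v f] by blast
      also have "v G = v (\<lambda>x. f q) + v (\<lambda>x. \<Sum>b\<in>B. (y b x - y b q) * H b x)"
        unfolding G_def using y H by (intro tangent_add[OF v] smooth_sum smooth_mult smooth_diff smooth_const)
      also have "\<dots> = (\<Sum>b\<in>B. v (\<lambda>x. (y b x - y b q) * H b x))"
        using y H by (simp add: tangent_const[OF v] tangent_sum[OF v] smooth_mult smooth_diff)
      also have "\<dots> = (\<Sum>b\<in>B. v (y b) * W b q f)"
      proof (rule sum.cong)
        fix b assume b: "b \<in> B"
        have "v (\<lambda>x. (y b x - y b q) * H b x) = (y b q - y b q) * v (H b) + H b q * v (\<lambda>x. y b x - y b q)"
          using y H b by (intro tangent_mult[OF v] smooth_diff smooth_const)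
        also have "v (\<lambda>x. y b x - y b q) = v (y b)"
          using tangent_diff[OF v y smooth_const] tangent_const[OF v] by simp
        also have "H b q = W b q f"
          using h(2)[OF b] N(2) eventually_nhds_x_imp_x[OF \<psi>(2)] O'(3)[OF q] f N(3)
          by (auto simp: H_def W_def a_def)
        finally show "v (\<lambda>x. (y b x - y b q) * H b x) = v (y b) * W b q f" by simp
      qed simp
      finally show ?thesis by (simp add: sum_fun_apply)
    qed
  qed
  have "W b p f = chart_derivative c p f b" if "f \<in> C" for f b
    using that c(2) O'(2,3) by (simp add: W_def)
  moreover have "eventually (\<lambda>q. q \<in> O') (nhds p)" using O' eventually_nhds by blast
  then have "eventually (\<lambda>q. (\<forall>b\<in>B. \<forall>b'\<in>B. W b q (y b') = (if b = b' then 1 else 0)) \<and>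
      (\<forall>v\<in>T q. v = (\<Sum>b\<in>B. v (y b) *\<^sub>R W b q))) (nhds p)"
    by eventually_elim (use dual expand in blast)
  ultimately have "coordinate_frame p W y" unfolding coordinate_frame_def using c W y by blast
  then show ?thesis by blast
qed

lemma frame_fields: "coordinate_frame p W y \<Longrightarrow> b \<in> B \<Longrightarrow> W b \<in> VF"
  and frame_functions: "coordinate_frame p W y \<Longrightarrow> b \<in> B \<Longrightarrow> y b \<in> C"
  and frame_dual: "coordinate_frame p W y \<Longrightarrow> b \<in> B \<Longrightarrow> b' \<in> B \<Longrightarrow> W b p (y b') = (if b = b' then 1 else 0)"
  and frame_expand: "coordinate_frame p W y \<Longrightarrow> v \<in> T p \<Longrightarrow> (\<Sum>b\<in>B. v (y b) *\<^sub>R W b p) = v"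
  and frame_expand_near: "coordinate_frame p W y \<Longrightarrow>
    eventually (\<lambda>q. \<forall>v\<in>T q. v = (\<Sum>b\<in>B. v (y b) *\<^sub>R W b q)) (nhds p)"
  unfolding coordinate_frame_def
  by (auto dest!: eventually_nhds_x_imp_x simp: eventually_conj_iff)

lemma frame_ext:
  assumes fr: "coordinate_frame p W y" and "u \<in> T p" "v \<in> T p" "\<And>b. b \<in> B \<Longrightarrow> u (y b) = v (y b)"
  shows "u = v"
proof -
  have "u = (\<Sum>b\<in>B. u (y b) *\<^sub>R W b p)" using frame_expand[OF fr assms(2)] by (rule sym)
  also have "\<dots> = (\<Sum>b\<in>B. v (y b) *\<^sub>R W b p)" using assms(4) by (intro sum.cong refl) (simp only:)
  also have "\<dots> = v" by (rule frame_expand[OF fr assms(3)])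
  finally show ?thesis .
qed

text \<open>The combination of a frame at \<open>p\<close> whose constant coefficients are the coordinates of \<open>v\<close>.\<close>

lemma tangent_extend:
  assumes "v \<in> T p"
  obtains X where "X \<in> VF" "X p = v"
proof -
  obtain W y where fr: "coordinate_frame p W y" using coordinate_frame_exists by blast
  have "(\<lambda>q. \<Sum>b\<in>B. v (y b) *\<^sub>R W b q) \<in> VF" using frame_fields[OF fr] by (intro VF_sum VF_scale)
  moreover have "(\<Sum>b\<in>B. v (y b) *\<^sub>R W b p) = v" using frame_expand[OF fr assms] .
  ultimately show thesis by (rule that)
qed

text \<open>In a coordinate frame a tangent vector acts through partial derivatives, for which the chain rule
  is known.\<close>

lemma tangent_chain:
  assumes v: "v \<in> T p" and f: "f \<in> C" and \<phi>f: "(\<lambda>q. \<phi> (f q)) \<in> C"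
    and \<phi>: "(\<phi> has_real_derivative d) (at (f p))"
  shows "v (\<lambda>q. \<phi> (f q)) = d * v f"
proof -
  obtain W y where fr: "coordinate_frame p W y" using coordinate_frame_exists by blast
  then obtain c where c: "c \<in> \<A>" "p \<in> fst c"
    and Wf: "\<And>f b. f \<in> C \<Longrightarrow> W b p f = chart_derivative c p f b"
    unfolding coordinate_frame_def by blast
  have vv: "v h = (\<Sum>b\<in>B. v (y b) * chart_derivative c p h b)" if "h \<in> C" for h
  proof -
    have "v h = (\<Sum>b\<in>B. v (y b) *\<^sub>R W b p) h" by (simp add: frame_expand[OF fr v])
    then show ?thesis by (simp add: sum_fun_apply Wf[OF that])
  qed
  have "(\<phi> has_derivative (\<lambda>x. d * x)) (at (f (chart_inv c (snd c p))))"
    using \<phi> c by (simp add: has_field_derivative_def)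
  from has_derivative_compose[OF chart_derivative[OF f c] this]
  have "chart_derivative c p (\<lambda>q. \<phi> (f q)) = (\<lambda>x. d * chart_derivative c p f x)"
    unfolding chart_derivative_def[of c p "\<lambda>q. \<phi> (f q)"] by (rule has_derivative_imp_frechet)
  then show ?thesis by (simp add: vv[OF \<phi>f] vv[OF f] sum_distrib_left mult_ac)
qed

end

section \<open>Smooth linear algebra on a Riemannian manifold\<close>

locale riemannian = manifold \<A> B
  for \<A> :: "('m::{t2_space, second_countable_topology}, 'e::real_inner) chart set" and B +
  fixes g :: "'m metric"
  assumes metric: "riemannian_metric \<A> g"
begin

lemma g_sym: "u \<in> T p \<Longrightarrow> v \<in> T p \<Longrightarrow> g p u v = g p v u"
  and g_add_left: "u \<in> T p \<Longrightarrow> v \<in> T p \<Longrightarrow> w \<in> T p \<Longrightarrow> g p (u + v) w = g p u w + g p v w"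
  and g_scale_left: "u \<in> T p \<Longrightarrow> v \<in> T p \<Longrightarrow> g p (a *\<^sub>R u) v = a * g p u v"
  and g_pos: "u \<in> T p \<Longrightarrow> u \<noteq> 0 \<Longrightarrow> g p u u > 0"
  and g_smooth: "X \<in> VF \<Longrightarrow> Y \<in> VF \<Longrightarrow> (\<lambda>p. g p (X p) (Y p)) \<in> C"
  using metric unfolding riemannian_metric_def by blast+

lemma g_add_right: "u \<in> T p \<Longrightarrow> v \<in> T p \<Longrightarrow> w \<in> T p \<Longrightarrow> g p w (u + v) = g p w u + g p w v"
  using g_sym g_add_left T_add by metis

lemma g_scale_right: "u \<in> T p \<Longrightarrow> v \<in> T p \<Longrightarrow> g p u (a *\<^sub>R v) = a * g p u v"
  using g_sym g_scale_left T_scale by metis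

lemma g_minus_left: "u \<in> T p \<Longrightarrow> v \<in> T p \<Longrightarrow> g p (- u) v = - g p u v"
  using g_scale_left[of u p v "-1"] by simp

lemma g_minus_right: "u \<in> T p \<Longrightarrow> v \<in> T p \<Longrightarrow> g p u (- v) = - g p u v"
  using g_scale_right[of u p v "-1"] by simp

lemma g_diff_left: "u \<in> T p \<Longrightarrow> v \<in> T p \<Longrightarrow> w \<in> T p \<Longrightarrow> g p (u - v) w = g p u w - g p v w"
  using g_add_left[of u p "- v" w] g_minus_left T_minus by simp

lemma g_diff_right: "u \<in> T p \<Longrightarrow> v \<in> T p \<Longrightarrow> w \<in> T p \<Longrightarrow> g p w (u - v) = g p w u - g p w v"
  using g_add_right[of u p "- v" w] g_minus_right T_minus by simp

lemma g_zero_left [simp]: "u \<in> T p \<Longrightarrow> g p 0 u = 0"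
  using g_scale_left[of 0 p u 0] by simp

lemma g_zero_right [simp]: "u \<in> T p \<Longrightarrow> g p u 0 = 0"
  using g_scale_right[of u p 0 0] by simp

lemma g_self_zero: "u \<in> T p \<Longrightarrow> g p u u = 0 \<Longrightarrow> u = 0"
  using g_pos by fastforce

lemma g_sum_left:
  "(\<And>i. i \<in> I \<Longrightarrow> u i \<in> T p) \<Longrightarrow> v \<in> T p \<Longrightarrow> g p (\<Sum>i\<in>I. u i) v = (\<Sum>i\<in>I. g p (u i) v)"
proof (induction I rule: infinite_finite_induct)
  case (insert i I)
  have u: "u i \<in> T p" "(\<Sum>i\<in>I. u i) \<in> T p"
    using insert.prems(1) by (blast intro: T_sum)+
  have "g p (\<Sum>i\<in>insert i I. u i) v = g p (u i) v + g p (\<Sum>i\<in>I. u i) v"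
    by (simp only: sum.insert[OF insert.hyps] g_add_left[OF u insert.prems(2)])
  also have "g p (\<Sum>i\<in>I. u i) v = (\<Sum>i\<in>I. g p (u i) v)"
    using insert.prems by (intro insert.IH) blast+
  finally show ?case by (simp only: sum.insert[OF insert.hyps])
qed auto

lemma g_sum_scale_left:
  assumes "\<And>i. i \<in> I \<Longrightarrow> u i \<in> T p" "v \<in> T p"
  shows "g p (\<Sum>i\<in>I. c i *\<^sub>R u i) v = (\<Sum>i\<in>I. c i * g p (u i) v)"
proof -
  have "g p (\<Sum>i\<in>I. c i *\<^sub>R u i) v = (\<Sum>i\<in>I. g p (c i *\<^sub>R u i) v)"
    by (rule g_sum_left) (use assms in \<open>blast intro: T_scale\<close>)+
  also have "\<dots> = (\<Sum>i\<in>I. c i * g p (u i) v)"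
    by (intro sum.cong refl g_scale_left assms)
  finally show ?thesis .
qed

lemma g_sum_scale_right:
  assumes "\<And>i. i \<in> I \<Longrightarrow> u i \<in> T p" "v \<in> T p"
  shows "g p v (\<Sum>i\<in>I. c i *\<^sub>R u i) = (\<Sum>i\<in>I. c i * g p v (u i))"
proof -
  have "(\<Sum>i\<in>I. c i *\<^sub>R u i) \<in> T p" using assms(1) by (blast intro: T_sum T_scale)
  from g_sym[OF assms(2) this] have "g p v (\<Sum>i\<in>I. c i *\<^sub>R u i) = (\<Sum>i\<in>I. c i * g p (u i) v)"
    using g_sum_scale_left[OF assms] by (simp only:)
  also have "\<dots> = (\<Sum>i\<in>I. c i * g p v (u i))"
    using g_sym assms by (intro sum.cong refl) (simp only:)
  finally show ?thesis .
qed

text \<open>A smooth form of Gram-Schmidt and of the Riesz representation at once. In the induction step the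
  field \<open>e\<close> is \<open>E k\<close> minus its projection \<open>Q\<close> to the previous fields, which comes from the induction hypothesis itself; a multiple of \<open>e\<close> corrects the last inner
  product and leaves the others unchanged. Gradients and horizontal projections are instances.\<close>

lemma smooth_riesz:
  fixes E :: "'i \<Rightarrow> 'm \<Rightarrow> 'm tangent"
  assumes "finite I" and "\<And>i. i \<in> I \<Longrightarrow> E i \<in> VF" and "\<And>i. i \<in> I \<Longrightarrow> a i \<in> C"
    and "\<And>c i. (\<Sum>i\<in>I. c i *\<^sub>R E i p) = 0 \<Longrightarrow> i \<in> I \<Longrightarrow> c i = 0"
  shows "\<exists>G\<in>VF. eventually (\<lambda>q. (\<exists>c. G q = (\<Sum>i\<in>I. c i *\<^sub>R E i q)) \<and>
    (\<forall>i\<in>I. g q (G q) (E i q) = a i q)) (nhds p)"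
  using assms
proof (induction I arbitrary: a)
  case empty
  show ?case by (rule bexI[of _ "\<lambda>p. 0"]) auto
next
  case (insert k I)
  have EI: "\<And>i. i \<in> I \<Longrightarrow> E i \<in> VF" and Ek: "E k \<in> VF" and ak: "a k \<in> C"
    and aI: "\<And>i. i \<in> I \<Longrightarrow> a i \<in> C"
    using insert.prems by auto
  have indep: "c i = 0" if "(\<Sum>i\<in>I. c i *\<^sub>R E i p) = 0" "i \<in> I" for c i
  proof -
    have "(\<Sum>i\<in>I. (c(k := 0)) i *\<^sub>R E i p) = (\<Sum>i\<in>I. c i *\<^sub>R E i p)"
      using insert.hyps by (intro sum.cong) auto
    then have "(\<Sum>i\<in>insert k I. (c(k := 0)) i *\<^sub>R E i p) = 0" using that insert.hyps by simp
    then have "(c(k := 0)) i = 0" using insert.prems(3)[of "c(k := 0)" i] \<open>i \<in> I\<close> by blast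
    then show ?thesis using that insert.hyps by (auto split: if_splits)
  qed
  have IH: "\<exists>G\<in>VF. eventually (\<lambda>q. (\<exists>c. G q = (\<Sum>i\<in>I. c i *\<^sub>R E i q)) \<and>
    (\<forall>i\<in>I. g q (G q) (E i q) = a' i q)) (nhds p)" if "\<And>i. i \<in> I \<Longrightarrow> a' i \<in> C" for a'
    by (rule insert.IH[OF EI that]) (use indep in blast)+
  obtain G0 where G0: "G0 \<in> VF" "eventually (\<lambda>q. (\<exists>c. G0 q = (\<Sum>i\<in>I. c i *\<^sub>R E i q)) \<and>
    (\<forall>i\<in>I. g q (G0 q) (E i q) = a i q)) (nhds p)"
    using IH[of a] aI by blast
  obtain Q where Q: "Q \<in> VF" "eventually (\<lambda>q. (\<exists>c. Q q = (\<Sum>i\<in>I. c i *\<^sub>R E i q)) \<and>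
    (\<forall>i\<in>I. g q (Q q) (E i q) = g q (E k q) (E i q))) (nhds p)"
    using IH[of "\<lambda>i q. g q (E k q) (E i q)"] g_smooth[OF Ek EI] by blast
  define e where "e q = E k q - Q q" for q
  have e: "e \<in> VF" unfolding e_def using Ek Q(1) by (rule VF_diff)
  have "e p \<noteq> 0"
  proof
    assume "e p = 0"
    moreover obtain c where "Q p = (\<Sum>i\<in>I. c i *\<^sub>R E i p)"
      using eventually_nhds_x_imp_x[OF Q(2)] by blast
    moreover have "(\<Sum>i\<in>I. (c(k := -1)) i *\<^sub>R E i p) = (\<Sum>i\<in>I. c i *\<^sub>R E i p)"
      using insert.hyps by (intro sum.cong) auto
    ultimately have "(\<Sum>i\<in>insert k I. (c(k := -1)) i *\<^sub>R E i p) = 0"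
      using insert.hyps by (simp add: e_def)
    then have "(c(k := -1)) k = 0" using insert.prems(3)[of "c(k := -1)" k] by blast
    then show False by simp
  qed
  then have "g p (e p) (e p) \<noteq> 0" using g_self_zero VF_T[OF e] by blast
  then obtain \<kappa> where \<kappa>: "\<kappa> \<in> C" "eventually (\<lambda>q. \<kappa> q * g q (e q) (e q) = 1) (nhds p)"
    using local_inverse[OF g_smooth[OF e e]] by blast
  define s where "s q = \<kappa> q * (a k q - g q (G0 q) (E k q))" for q
  have s: "s \<in> C" unfolding s_def
    by (intro smooth_mult smooth_diff \<kappa>(1) ak g_smooth G0(1) Ek)
  define G where "G q = G0 q + s q *\<^sub>R e q" for q
  have "G \<in> VF" unfolding G_def using G0(1) s e by (intro VF_add VF_mult)
  moreover have "eventually (\<lambda>q. (\<exists>c. G q = (\<Sum>i\<in>insert k I. c i *\<^sub>R E i q)) \<and>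
    (\<forall>i\<in>insert k I. g q (G q) (E i q) = a i q)) (nhds p)"
    using G0(2) Q(2) \<kappa>(2)
  proof eventually_elim
    case (elim q)
    have Tq: "G0 q \<in> T q" "Q q \<in> T q" "e q \<in> T q" "E k q \<in> T q"
      using VF_T G0(1) Q(1) e Ek by blast+
    have TE: "E i q \<in> T q" if "i \<in> I" for i using VF_T EI that by blast
    obtain c0 c where c0: "G0 q = (\<Sum>i\<in>I. c0 i *\<^sub>R E i q)" and c: "Q q = (\<Sum>i\<in>I. c i *\<^sub>R E i q)"
      using elim by blast
    have eE: "g q (e q) (E i q) = 0" if "i \<in> I" for i
      unfolding e_def using elim Tq TE[OF that] that by (simp add: g_diff_left)
    then have eQ: "g q (e q) (Q q) = 0"
      unfolding c by (subst g_sum_scale_right) (use TE Tq in auto)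
    have eEk: "g q (e q) (E k q) = g q (e q) (e q)"
      using g_diff_right[OF Tq(4,2,3)] eQ by (simp add: e_def)
    have GE: "g q (G q) w = g q (G0 q) w + s q * g q (e q) w" if "w \<in> T q" for w
      unfolding G_def using Tq that by (simp add: g_add_left T_scale g_scale_left)
    have "g q (G q) (E k q) = g q (G0 q) (E k q) + (\<kappa> q * g q (e q) (e q)) * (a k q - g q (G0 q) (E k q))"
      using GE[OF Tq(4)] eEk by (simp add: s_def mult_ac)
    then have "g q (G q) (E k q) = a k q" using elim by simp
    moreover have "g q (G q) (E i q) = a i q" if "i \<in> I" for i
      using GE[OF TE[OF that]] eE[OF that] elim that by simp
    moreover have "\<exists>c. G q = (\<Sum>i\<in>insert k I. c i *\<^sub>R E i q)"
    proof (rule exI)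
      show "G q = (\<Sum>i\<in>insert k I. (if i = k then s q else c0 i - s q * c i) *\<^sub>R E i q)"
      proof -
        have "(\<Sum>i\<in>I. (if i = k then s q else c0 i - s q * c i) *\<^sub>R E i q) =
        (\<Sum>i\<in>I. c0 i *\<^sub>R E i q - s q *\<^sub>R (c i *\<^sub>R E i q))"
        using insert.hyps by (intro sum.cong) (auto simp: scaleR_diff_left)
      also have "\<dots> = G0 q - s q *\<^sub>R Q q"
        by (simp add: c0 c sum_subtractf scaleR_sum_right)
        finally show ?thesis using insert.hyps by (simp add: G_def e_def scaleR_diff_right)
      qed
    qed
    ultimately show ?case by blast
  qed
  ultimately show ?case by blast
qed

text \<open>The gradient is the field whose inner products with a coordinate frame are the derivatives of \<open>f\<close>
  along the frame.\<close>

lemma gradient_near: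
  assumes f: "f \<in> C"
  shows "\<exists>G\<in>VF. eventually (\<lambda>q. \<forall>v\<in>T q. g q (G q) v = v f) (nhds p)"
proof -
  obtain W y where fr: "coordinate_frame p W y" using coordinate_frame_exists by blast
  have indep: "c i = 0" if c: "(\<Sum>b\<in>B. c b *\<^sub>R W b p) = 0" and i: "i \<in> B" for c i
  proof -
    have "0 = (\<Sum>b\<in>B. c b *\<^sub>R W b p) (y i)" using c by simp
    also have "\<dots> = (\<Sum>b\<in>B. if b = i then c i else 0)"
      unfolding sum_fun_apply using frame_dual[OF fr _ i] by (intro sum.cong) auto
    finally show ?thesis using onb_finite[OF onb] i by simp
  qed
  have "\<exists>G\<in>VF. eventually (\<lambda>q. (\<exists>c. G q = (\<Sum>i\<in>B. c i *\<^sub>R W i q)) \<and>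
    (\<forall>i\<in>B. g q (G q) (W i q) = W i q f)) (nhds p)"
  proof (rule smooth_riesz[OF onb_finite[OF onb] frame_fields[OF fr]])
    show "(\<lambda>q. W i q f) \<in> C" if "i \<in> B" for i
      using VF_smooth[OF frame_fields[OF fr that] f] .
  qed (use indep in blast)+
  then obtain G where G: "G \<in> VF" "eventually (\<lambda>q. (\<exists>c. G q = (\<Sum>i\<in>B. c i *\<^sub>R W i q)) \<and>
    (\<forall>i\<in>B. g q (G q) (W i q) = W i q f)) (nhds p)"
    by blast
  have "eventually (\<lambda>q. \<forall>v\<in>T q. g q (G q) v = v f) (nhds p)"
    using G(2) frame_expand_near[OF fr]
  proof eventually_elim
    case (elim q)
    show ?case
    proof
      fix v assume v: "v \<in> T q"
      have WT: "W b q \<in> T q" if "b \<in> B" for b using VF_T frame_fields[OF fr that] by blast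
      have ve: "v = (\<Sum>b\<in>B. v (y b) *\<^sub>R W b q)" using elim v by blast
      have "g q (G q) (\<Sum>b\<in>B. v (y b) *\<^sub>R W b q) = (\<Sum>b\<in>B. v (y b) * g q (G q) (W b q))"
        by (rule g_sum_scale_right) (use WT VF_T[OF G(1)] in auto)
      also have "\<dots> = (\<Sum>b\<in>B. v (y b) *\<^sub>R W b q) f"
        unfolding sum_fun_apply using elim by (intro sum.cong) auto
      finally show "g q (G q) v = v f" by (simp only: ve[symmetric])
    qed
  qed
  then show ?thesis using G(1) by blast
qed

lemma gradient:
  assumes f: "f \<in> C"
  shows gradient_T: "gradient \<A> g f p \<in> T p"
    and gradient_g: "v \<in> T p \<Longrightarrow> g p (gradient \<A> g f p) v = v f"
proof -
  obtain G where G: "G \<in> VF" "eventually (\<lambda>q. \<forall>v\<in>T q. g q (G q) v = v f) (nhds p)"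
    using gradient_near[OF f] by blast
  have Gp: "G p \<in> T p \<and> (\<forall>v\<in>T p. g p (G p) v = v f)"
    using VF_T[OF G(1)] eventually_nhds_x_imp_x[OF G(2)] by blast
  have "gradient \<A> g f p \<in> T p \<and> (\<forall>v\<in>T p. g p (gradient \<A> g f p) v = v f)"
    unfolding gradient_def
  proof (rule theI[where P = "\<lambda>u. u \<in> T p \<and> (\<forall>v\<in>T p. g p u v = v f)", OF Gp])
    fix u assume u: "u \<in> T p \<and> (\<forall>v\<in>T p. g p u v = v f)"
    have "g p (u - G p) (u - G p) = 0" using u Gp by (simp add: g_diff_left T_diff)
    then show "u = G p" using g_self_zero[of "u - G p" p] u Gp T_diff by auto
  qed
  then show "gradient \<A> g f p \<in> T p" "v \<in> T p \<Longrightarrow> g p (gradient \<A> g f p) v = v f" by blast+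
qed

end

section \<open>The horizontal projection of a submersion\<close>

locale smooth_submersion =
  M: riemannian \<A> BM g + N: manifold \<B> BN
  for \<A> :: "('m::{t2_space, second_countable_topology}, 'e::real_inner) chart set" and BM g
    and \<B> :: "('n::{t2_space, second_countable_topology}, 'd::real_inner) chart set" and BN +
  fixes F :: "'m \<Rightarrow> 'n"
  assumes smooth_F: "smooth_map \<A> \<B> F"
    and surj_dF: "\<And>p. differential \<B> F ` tangent_space \<A> p = tangent_space \<B> (F p)"
begin

abbreviation "dF \<equiv> differential \<B> F"
abbreviation "V \<equiv> vertical \<A> \<B> F"
abbreviation "H \<equiv> horizontal \<A> g \<B> F"
abbreviation "hor \<equiv> hor_part \<A> g \<B> F"
abbreviation "vert \<equiv> vert_part \<A> g \<B> F"

lemma open_vimage_F: "open W \<Longrightarrow> open (F -` W)"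
  using smooth_F by (auto simp: smooth_map_def intro: open_vimage)

lemma eventually_F: "eventually P (nhds (F p)) \<Longrightarrow> eventually (\<lambda>q. P (F q)) (nhds p)"
proof -
  assume "eventually P (nhds (F p))"
  then obtain W where "open W" "F p \<in> W" "\<And>q. q \<in> W \<Longrightarrow> P q" unfolding eventually_nhds by blast
  then show ?thesis unfolding eventually_nhds
    using open_vimage_F by (intro exI[of _ "F -` W"]) auto
qed

text \<open>In charts \<open>f \<circ> F\<close> is the composition of \<open>f\<close> in a chart of the target with the chart expression of \<open>F\<close>.\<close>

lemma smooth_pullback:
  assumes f: "f \<in> N.C"
  shows "(\<lambda>p. f (F p)) \<in> M.C"
  unfolding smooth_functions_def
proof (intro CollectI ballI)
  fix c assume c: "c \<in> \<A>"
  show "smooth_on (snd c ` fst c) ((\<lambda>p. f (F p)) \<circ> chart_inv c)"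
  proof (rule smooth_on_local)
    fix x assume "x \<in> snd c ` fst c"
    then obtain q where q: "q \<in> fst c" "x = snd c q" by blast
    obtain d where d: "d \<in> \<B>" "F q \<in> fst d" by (rule N.chart_exists)
    define S where "S = snd c ` (fst c \<inter> F -` fst d)"
    have S: "open S" "x \<in> S"
      using M.chart_image_open[OF c open_vimage_F[OF N.chart_open[OF d(1)]]] q d by (auto simp: S_def)
    have "smooth_on S (snd d \<circ> F \<circ> chart_inv c)"
      using smooth_F c d by (simp add: smooth_map_def S_def)
    then have tr: "smooth_on S (\<lambda>x. snd d (F (chart_inv c x)))" by (simp add: o_def)
    have "smooth_on S (\<lambda>x. f (chart_inv d (snd d (F (chart_inv c x)))))"
      by (rule smooth_on_compose[OF N.onb S(1) N.chart_open_image[OF d(1)] _ N.smooth_functionsD[OF f d(1)] tr])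
        (use c in \<open>auto simp: S_def\<close>)
    then have "smooth_on S ((\<lambda>p. f (F p)) \<circ> chart_inv c)"
      by (rule smooth_on_transfer[OF _ S(1)]) (use c d in \<open>auto simp: S_def\<close>)
    then show "\<exists>S. open S \<and> x \<in> S \<and> smooth_on S ((\<lambda>p. f (F p)) \<circ> chart_inv c)" using S by blast
  qed
qed

lemma dF_apply: "f \<in> N.C \<Longrightarrow> dF v f = v (\<lambda>p. f (F p))"
  by (simp add: differential_def o_def)

lemma dF_T: "v \<in> M.T p \<Longrightarrow> dF v \<in> N.T (F p)"
  using surj_dF by blast

lemma dF_add: "dF (u + v) = dF u + dF v"
  by (auto simp: differential_def)

lemma dF_diff: "dF (u - v) = dF u - dF v"
  by (auto simp: differential_def)

lemma dF_zero: "dF 0 = 0"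
  by (auto simp: differential_def)

lemma V_iff: "v \<in> V p \<longleftrightarrow> v \<in> M.T p \<and> dF v = 0"
  by (simp add: vertical_def)

lemma H_iff: "v \<in> H p \<longleftrightarrow> v \<in> M.T p \<and> (\<forall>w\<in>V p. g p v w = 0)"
  by (simp add: horizontal_def orth_complement_def)

lemma V_T: "v \<in> V p \<Longrightarrow> v \<in> M.T p" and H_T: "v \<in> H p \<Longrightarrow> v \<in> M.T p"
  by (simp_all add: V_iff H_iff)

lemma H_perp_V: "u \<in> H p \<Longrightarrow> w \<in> V p \<Longrightarrow> g p u w = 0"
  by (simp add: H_iff)

lemma V_perp_H: "u \<in> H p \<Longrightarrow> w \<in> V p \<Longrightarrow> g p w u = 0"
  using H_perp_V M.g_sym H_T V_T by metis

lemma V_zero [simp]: "0 \<in> V p" by (simp add: V_iff dF_zero)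

lemma H_zero [simp]: "0 \<in> H p" by (simp add: H_iff V_T)

lemma V_add: "u \<in> V p \<Longrightarrow> v \<in> V p \<Longrightarrow> u + v \<in> V p"
  by (simp add: V_iff M.T_add dF_add)

lemma V_diff: "u \<in> V p \<Longrightarrow> v \<in> V p \<Longrightarrow> u - v \<in> V p"
  by (simp add: V_iff M.T_diff dF_diff)

lemma H_diff: "u \<in> H p \<Longrightarrow> v \<in> H p \<Longrightarrow> u - v \<in> H p"
  using V_T by (auto simp: H_iff M.T_diff M.g_diff_left)

lemma V_H_zero: "u \<in> V p \<Longrightarrow> u \<in> H p \<Longrightarrow> u = 0"
  using H_perp_V M.g_self_zero V_T by blast

text \<open>Near \<open>p\<close> the horizontal space is spanned by
  the gradients \<open>G b\<close> of the functions \<open>y b \<circ> F\<close>, where \<open>y b\<close> are coordinates near \<open>F p\<close>. They are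
  independent because \<open>dF\<close> is onto, and orthogonal to the vertical vectors because \<open>y b \<circ> F\<close> is
  constant along the fibres. The field \<open>Z\<close> in their span with the same inner products as \<open>X\<close>
  differs from \<open>X\<close> by a field that kills all \<open>y b \<circ> F\<close>, hence by a vertical one.\<close>

lemma hor_near:
  assumes X: "X \<in> M.VF"
  shows "\<exists>Z\<in>M.VF. eventually (\<lambda>q. Z q \<in> H q \<and> X q - Z q \<in> V q) (nhds p)"
proof -
  obtain W y where fr: "N.coordinate_frame (F p) W y" using N.coordinate_frame_exists by blast
  have yF: "(\<lambda>q. y b (F q)) \<in> M.C" if "b \<in> BN" for b
    using smooth_pullback[OF N.frame_functions[OF fr that]] .
  have "\<forall>b\<in>BN. \<exists>G. G \<in> M.VF \<and> eventually (\<lambda>q. \<forall>v\<in>M.T q. g q (G q) v = v (\<lambda>q. y b (F q))) (nhds p)"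
    unfolding Bex_def[symmetric] by (intro ballI M.gradient_near yF)
  from bchoice[OF this] obtain G where GG: "\<forall>b\<in>BN. G b \<in> M.VF \<and>
    eventually (\<lambda>q. \<forall>v\<in>M.T q. g q (G b q) v = v (\<lambda>q. y b (F q))) (nhds p)" ..
  have G: "G b \<in> M.VF"
    and Gg: "eventually (\<lambda>q. \<forall>v\<in>M.T q. g q (G b q) v = v (\<lambda>q. y b (F q))) (nhds p)"
    if "b \<in> BN" for b
    using bspec[OF GG that] by (rule conjunct1, rule conjunct2)
  have GT: "G b q \<in> M.T q" if "b \<in> BN" for b q using M.VF_T G that by blast
  have fin: "finite BN" using onb_finite[OF N.onb] .
  have indep: "c i = 0" if c: "(\<Sum>b\<in>BN. c b *\<^sub>R G b p) = 0" and i: "i \<in> BN" for c i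
  proof -
    obtain v where v: "v \<in> M.T p" "dF v = W i (F p)"
      using surj_dF N.VF_T[OF N.frame_fields[OF fr i]] by (metis imageE)
    have "0 = g p (\<Sum>b\<in>BN. c b *\<^sub>R G b p) v" using c v by simp
    also have "\<dots> = (\<Sum>b\<in>BN. c b * g p (G b p) v)" by (rule M.g_sum_scale_left) (use GT v in auto)
    also have "\<dots> = (\<Sum>b\<in>BN. if b = i then c i else 0)"
    proof (rule sum.cong)
      fix b assume b: "b \<in> BN"
      have "g p (G b p) v = dF v (y b)"
        using eventually_nhds_x_imp_x[OF Gg[OF b]] v(1) dF_apply[OF N.frame_functions[OF fr b]] by simp
      then show "c b * g p (G b p) v = (if b = i then c i else 0)"
        using v N.frame_dual[OF fr i b] by simp
    qed simp
    finally show ?thesis using fin i by simp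
  qed
  have "\<exists>Z\<in>M.VF. eventually (\<lambda>q. (\<exists>c. Z q = (\<Sum>i\<in>BN. c i *\<^sub>R G i q)) \<and>
    (\<forall>i\<in>BN. g q (Z q) (G i q) = X q (\<lambda>q. y i (F q)))) (nhds p)"
  proof (rule M.smooth_riesz[OF fin G])
    show "(\<lambda>q. X q (\<lambda>q. y i (F q))) \<in> M.C" if "i \<in> BN" for i
      using M.VF_smooth[OF X yF[OF that]] .
  qed (use indep in blast)+
  then obtain Z where Z: "Z \<in> M.VF" "eventually (\<lambda>q. (\<exists>c. Z q = (\<Sum>i\<in>BN. c i *\<^sub>R G i q)) \<and>
    (\<forall>i\<in>BN. g q (Z q) (G i q) = X q (\<lambda>q. y i (F q)))) (nhds p)"
    by blast
  have "eventually (\<lambda>q. \<forall>b\<in>BN. \<forall>v\<in>M.T q. g q (G b q) v = v (\<lambda>q. y b (F q))) (nhds p)"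
    using Gg fin by (simp add: eventually_ball_finite)
  then have "eventually (\<lambda>q. Z q \<in> H q \<and> X q - Z q \<in> V q) (nhds p)"
    using Z(2) eventually_F[OF N.frame_expand_near[OF fr]]
  proof eventually_elim
    case (elim q)
    have ZT: "Z q \<in> M.T q" and XT: "X q \<in> M.T q" using M.VF_T Z(1) X by blast+
    obtain c where c: "Z q = (\<Sum>i\<in>BN. c i *\<^sub>R G i q)" using elim by blast
    have "g q (Z q) w = 0" if w: "w \<in> V q" for w
    proof -
      have "g q (Z q) w = (\<Sum>b\<in>BN. c b * g q (G b q) w)"
        unfolding c by (rule M.g_sum_scale_left) (use GT V_T w in auto)
      also have "\<dots> = (\<Sum>b\<in>BN. 0)"
      proof (rule sum.cong)
        fix b assume b: "b \<in> BN"
        have "g q (G b q) w = dF w (y b)"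
          using elim b V_T[OF w] dF_apply[OF N.frame_functions[OF fr b]] by simp
        then show "c b * g q (G b q) w = 0" using w by (simp add: V_iff)
      qed simp
      finally show ?thesis by simp
    qed
    then have "Z q \<in> H q" using ZT by (simp add: H_iff)
    moreover have "dF (X q - Z q) = 0"
    proof -
      have "dF (X q - Z q) = (\<Sum>b\<in>BN. dF (X q - Z q) (y b) *\<^sub>R W b (F q))"
        using elim dF_T[OF M.T_diff[OF XT ZT]] by blast
      also have "\<dots> = (\<Sum>b\<in>BN. 0)"
      proof (rule sum.cong)
        fix b assume b: "b \<in> BN"
        have "dF (X q - Z q) (y b) = X q (\<lambda>q. y b (F q)) - Z q (\<lambda>q. y b (F q))"
          using dF_apply[OF N.frame_functions[OF fr b]] by simp
        also have "Z q (\<lambda>q. y b (F q)) = g q (Z q) (G b q)"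
          using elim b ZT M.g_sym[OF ZT GT[OF b]] by simp
        also have "\<dots> = X q (\<lambda>q. y b (F q))" using elim b by blast
        finally have z: "dF (X q - Z q) (y b) = X q (\<lambda>q. y b (F q)) - X q (\<lambda>q. y b (F q))" .
        show "dF (X q - Z q) (y b) *\<^sub>R W b (F q) = 0"
          by (simp only: z diff_self scale_zero_left)
      qed simp
      finally show ?thesis by simp
    qed
    ultimately show ?case using M.T_diff[OF XT ZT] by (simp add: V_iff)
  qed
  then show ?thesis using Z(1) by blast
qed

lemma hor_part_eqI:
  assumes "u \<in> H p" "X p - u \<in> V p"
  shows "hor X p = u" and "vert X p = X p - u"
proof -
  have uniq: "a = u" if "a \<in> H p" "b \<in> V p" "X p = a + b" for a b
  proof -
    have "a - u = (X p - u) - b" using that by simp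
    then have "a - u \<in> V p" using V_diff[OF assms(2) that(2)] by (simp only:)
    then show ?thesis using V_H_zero[OF _ H_diff[OF that(1) assms(1)]] by simp
  qed
  show "hor X p = u" unfolding hor_part_def component_def
  proof (rule the_equality)
    show "u \<in> H p \<and> (\<exists>b\<in>V p. X p = u + b)"
      using assms by (intro conjI bexI[of _ "X p - u"]) simp_all
  qed (use uniq in blast)
  show "vert X p = X p - u" unfolding vert_part_def component_def
  proof (rule the_equality)
    show "X p - u \<in> V p \<and> (\<exists>b\<in>H p. X p = X p - u + b)"
      using assms by (intro conjI bexI[of _ u]) simp_all
    fix a assume "a \<in> V p \<and> (\<exists>b\<in>H p. X p = a + b)"
    then obtain b where "a \<in> V p" "b \<in> H p" "X p = b + a" by (auto simp: add.commute)
    then show "a = X p - u" using uniq by fastforce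
  qed
qed

lemma hor_vert:
  assumes X: "X \<in> M.VF"
  shows hor_H: "hor X p \<in> H p" and vert_V: "vert X p \<in> V p"
    and hor_add_vert: "X p = hor X p + vert X p"
    and hor_VF: "hor X \<in> M.VF" and vert_VF: "vert X \<in> M.VF"
proof -
  have *: "hor X p \<in> H p \<and> vert X p \<in> V p \<and> X p = hor X p + vert X p" for p
  proof -
    obtain Z where "Z \<in> M.VF" and Z: "eventually (\<lambda>q. Z q \<in> H q \<and> X q - Z q \<in> V q) (nhds p)"
      using hor_near[OF X] by blast
    from eventually_nhds_x_imp_x[OF Z] show ?thesis
      using hor_part_eqI[of "Z p" p X] by simp
  qed
  then show "hor X p \<in> H p" "vert X p \<in> V p" "X p = hor X p + vert X p" by blast+
  show hVF: "hor X \<in> M.VF"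
  proof (rule M.VFI_local)
    fix p
    obtain Z where ZVF: "Z \<in> M.VF" and Z: "eventually (\<lambda>q. Z q \<in> H q \<and> X q - Z q \<in> V q) (nhds p)"
      using hor_near[OF X] by blast
    from Z have "eventually (\<lambda>q. hor X q = Z q) (nhds p)"
      by eventually_elim (simp add: hor_part_eqI(1))
    then show "\<exists>Z\<in>M.VF. eventually (\<lambda>q. hor X q = Z q) (nhds p)" using ZVF by blast
  qed
  have "vert X = (\<lambda>q. X q - hor X q)"
  proof
    fix q show "vert X q = X q - hor X q" using *[of q] by (metis add_diff_cancel_left')
  qed
  then show "vert X \<in> M.VF" using M.VF_diff[OF X hVF] by simp
qed

lemma hor_of_horizontal:
  assumes "\<And>q. X q \<in> H q" shows "hor X = X" "vert X = (\<lambda>q. 0)"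
proof -
  have *: "hor X q = X q" "vert X q = X q - X q" for q
    using hor_part_eqI[OF assms[of q], where X = X] by (simp_all only: diff_self V_zero)
  show "hor X = X" by (rule ext, rule *(1))
  show "vert X = (\<lambda>q. 0)" by (rule ext, rule *(2)[unfolded diff_self])
qed

lemma vert_of_vertical:
  assumes "\<And>q. X q \<in> V q" shows "vert X = X" "hor X = (\<lambda>q. 0)"
proof -
  have *: "hor X q = 0" "vert X q = X q - 0" for q
    using hor_part_eqI[OF H_zero, where X = X and p = q] assms[of q] by (simp_all only: diff_0_right)
  show "vert X = X" by (rule ext, rule *(2)[unfolded diff_0_right])
  show "hor X = (\<lambda>q. 0)" by (rule ext, rule *(1))
qed

lemma vert_inner:
  assumes X: "X \<in> M.VF" and w: "w \<in> V p"
  shows "g p (vert X p) w = g p (X p) w"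
proof -
  have "g p (X p) w = g p (hor X p) w + g p (vert X p) w"
    using M.g_add_left[OF H_T[OF hor_H[OF X]] V_T[OF vert_V[OF X]] V_T[OF w]]
    by (simp only: hor_add_vert[OF X, symmetric])
  then show ?thesis using H_perp_V[OF hor_H[OF X] w] by simp
qed

lemma hor_inner:
  assumes X: "X \<in> M.VF" and w: "w \<in> H p"
  shows "g p (hor X p) w = g p (X p) w"
proof -
  have "g p (X p) w = g p (hor X p) w + g p (vert X p) w"
    using M.g_add_left[OF H_T[OF hor_H[OF X]] V_T[OF vert_V[OF X]] H_T[OF w]]
    by (simp only: hor_add_vert[OF X, symmetric])
  then show ?thesis using V_perp_H[OF w vert_V[OF X]] by simp
qed

end

section \<open>Levi-Civita connections and the pullback connection\<close>

locale riemannian_connection = riemannian \<A> B g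
  for \<A> :: "('m::{t2_space, second_countable_topology}, 'e::real_inner) chart set" and B g +
  fixes nab :: "'m connection"
  assumes levi_civita: "levi_civita \<A> g nab"
begin

lemma nab_linear: "linear_connection \<A> VF nab"
  using levi_civita by (simp only: levi_civita_def)

lemma nab_VF: "X \<in> VF \<Longrightarrow> Y \<in> VF \<Longrightarrow> nab X Y \<in> VF"
  using nab_linear unfolding linear_connection_def by blast

lemma nab_add:
  assumes "X \<in> VF" "Y \<in> VF" "Z \<in> VF"
  shows "nab X (\<lambda>p. Y p + Z p) p = nab X Y p + nab X Z p"
proof -
  have "nab X (Y + Z) = nab X Y + nab X Z" using nab_linear assms unfolding linear_connection_def by blast
  then show ?thesis by (simp add: plus_fun_def)
qed

lemma nab_mult:
  assumes "X \<in> VF" "Y \<in> VF" "f \<in> C"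
  shows "nab X (\<lambda>p. f p *\<^sub>R Y p) p = X p f *\<^sub>R Y p + f p *\<^sub>R nab X Y p"
proof -
  have "nab X (\<lambda>p. f p *\<^sub>R Y p) = (\<lambda>p. X p f *\<^sub>R Y p + f p *\<^sub>R nab X Y p)"
    using nab_linear assms unfolding linear_connection_def by blast
  then show ?thesis by (rule fun_cong)
qed

lemma nab_torsion:
  assumes "X \<in> VF" "Y \<in> VF"
  shows "nab X Y p - nab Y X p = lie_bracket X Y p"
proof -
  have "nab X Y - nab Y X = lie_bracket X Y" using levi_civita assms unfolding levi_civita_def by blast
  then show ?thesis by (metis minus_apply)
qed

lemma nab_metric:
  assumes "X \<in> VF" "Y \<in> VF" "Z \<in> VF"
  shows "X p (\<lambda>q. g q (Y q) (Z q)) = g p (nab X Y p) (Z p) + g p (Y p) (nab X Z p)"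
  using levi_civita assms unfolding levi_civita_def by blast

lemma nab_T: "X \<in> VF \<Longrightarrow> Y \<in> VF \<Longrightarrow> nab X Y p \<in> T p"
  using VF_T nab_VF by blast

lemma nab_zero: "X \<in> VF \<Longrightarrow> nab X (\<lambda>p. 0) p = 0"
  using nab_mult[of X "\<lambda>p. 0" "\<lambda>p. 0" p] tangent_const[OF VF_T, of X p 0] by simp

lemma nab_const_sum:
  assumes "X \<in> VF" "\<And>i. i \<in> I \<Longrightarrow> Y i \<in> VF"
  shows "nab X (\<lambda>p. \<Sum>i\<in>I. c i *\<^sub>R Y i p) p = (\<Sum>i\<in>I. c i *\<^sub>R nab X (Y i) p)"
  using assms(2)
proof (induction I rule: infinite_finite_induct)
  case (insert i I)
  have "nab X (\<lambda>p. c i *\<^sub>R Y i p + (\<Sum>i\<in>I. c i *\<^sub>R Y i p)) p =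
    nab X (\<lambda>p. c i *\<^sub>R Y i p) p + nab X (\<lambda>p. \<Sum>i\<in>I. c i *\<^sub>R Y i p) p"
    using insert.prems by (intro nab_add assms(1) VF_scale VF_sum) auto
  also have "nab X (\<lambda>p. c i *\<^sub>R Y i p) p = X p (\<lambda>p. c i) *\<^sub>R Y i p + c i *\<^sub>R nab X (Y i) p"
    using insert.prems by (intro nab_mult assms(1) smooth_const) auto
  also have "X p (\<lambda>p. c i) = 0" using tangent_const VF_T assms(1) by blast
  also have "nab X (\<lambda>p. \<Sum>i\<in>I. c i *\<^sub>R Y i p) p = (\<Sum>i\<in>I. c i *\<^sub>R nab X (Y i) p)"
    using insert.prems by (intro insert.IH) blast
  finally show ?case by (simp only: sum.insert[OF insert.hyps] scale_zero_left add_0)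
qed (use nab_zero[OF assms(1)] in auto)

end

locale submersion_with_connections =
  smooth_submersion \<A> BM g \<B> BN F +
  M: riemannian_connection \<A> BM g nabM + N: riemannian_connection \<B> BN gN nabN
  for \<A> :: "('m::{t2_space, second_countable_topology}, 'e::real_inner) chart set" and BM g
    and \<B> :: "('n::{t2_space, second_countable_topology}, 'd::real_inner) chart set" and BN
    and F :: "'m \<Rightarrow> 'n" and nabM gN nabN +
  fixes nabF :: "('m \<Rightarrow> 'm tangent) \<Rightarrow> ('m \<Rightarrow> 'n tangent) \<Rightarrow> 'm \<Rightarrow> 'n tangent"
  assumes pullback_connection: "pullback_connection \<A> \<B> F nabN nabF"
begin

lemma oneill_A_horizontal:
  assumes X: "X \<in> M.VF" "\<And>q. X q \<in> H q" and Y: "\<And>q. Y q \<in> H q"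
  shows "oneill_A \<A> g nabM \<B> F X Y = vert (nabM X Y)"
proof -
  have "nabM X (\<lambda>q. 0) = (\<lambda>q. 0)" by (rule ext, rule M.nab_zero[OF X(1)])
  moreover have "hor (\<lambda>q. 0) = 0" unfolding zero_fun_def[where 'a = 'm] by (rule hor_of_horizontal) simp
  ultimately show ?thesis
    unfolding oneill_A_def hor_of_horizontal[OF X(2)] hor_of_horizontal[OF Y] by (simp only: add_0)
qed

lemma oneill_A_vertical:
  assumes X: "X \<in> M.VF" "\<And>q. X q \<in> H q" and Y: "\<And>q. Y q \<in> V q"
  shows "oneill_A \<A> g nabM \<B> F X Y = hor (nabM X Y)"
proof -
  have "nabM X (\<lambda>q. 0) = (\<lambda>q. 0)" by (rule ext, rule M.nab_zero[OF X(1)])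
  moreover have "vert (\<lambda>q. 0) = 0" unfolding zero_fun_def[where 'a = 'm] by (rule vert_of_vertical) simp
  ultimately show ?thesis
    unfolding oneill_A_def hor_of_horizontal[OF X(2)] vert_of_vertical[OF Y] by (simp only: add_0_right)
qed

abbreviation "PS \<equiv> pullback_sections \<A> \<B> F"

lemma PS_T: "S \<in> PS \<Longrightarrow> S p \<in> N.T (F p)"
  and PS_smooth: "S \<in> PS \<Longrightarrow> f \<in> N.C \<Longrightarrow> (\<lambda>p. S p f) \<in> M.C"
  by (auto simp: pullback_sections_def)

lemma PSI: "(\<And>p. S p \<in> N.T (F p)) \<Longrightarrow> (\<And>f. f \<in> N.C \<Longrightarrow> (\<lambda>p. S p f) \<in> M.C) \<Longrightarrow> S \<in> PS"
  by (auto simp: pullback_sections_def)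

lemma PS_zero: "(\<lambda>p. 0) \<in> PS"
  by (rule PSI) simp_all

lemma PS_add: "S \<in> PS \<Longrightarrow> S' \<in> PS \<Longrightarrow> (\<lambda>p. S p + S' p) \<in> PS"
  by (rule PSI) (simp_all add: N.T_add[OF PS_T PS_T] M.smooth_add[OF PS_smooth PS_smooth])

lemma PS_mult: "f \<in> M.C \<Longrightarrow> S \<in> PS \<Longrightarrow> (\<lambda>p. f p *\<^sub>R S p) \<in> PS"
  by (rule PSI) (simp_all add: N.T_scale[OF PS_T] M.smooth_mult[OF _ PS_smooth])

lemma PS_sum: "(\<And>i. i \<in> I \<Longrightarrow> S i \<in> PS) \<Longrightarrow> (\<lambda>p. \<Sum>i\<in>I. S i p) \<in> PS"
  by (induction I rule: infinite_finite_induct) (simp_all add: PS_zero PS_add)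

lemma PS_pullback: "W \<in> N.VF \<Longrightarrow> W \<circ> F \<in> PS"
  by (rule PSI) (simp_all add: N.VF_T smooth_pullback[OF N.VF_smooth])

lemma PS_dF: "X \<in> M.VF \<Longrightarrow> (\<lambda>p. dF (X p)) \<in> PS"
  by (rule PSI) (simp_all add: dF_T[OF M.VF_T] dF_apply M.VF_smooth[OF _ smooth_pullback])

lemma nabF_linear: "linear_connection \<A> PS nabF"
  using pullback_connection by (simp only: pullback_connection_def)

lemma nabF_PS: "X \<in> M.VF \<Longrightarrow> S \<in> PS \<Longrightarrow> nabF X S \<in> PS"
  using nabF_linear unfolding linear_connection_def by blast

lemma nabF_add:
  assumes "X \<in> M.VF" "S \<in> PS" "S' \<in> PS"
  shows "nabF X (\<lambda>p. S p + S' p) p = nabF X S p + nabF X S' p"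
proof -
  have "nabF X (S + S') = nabF X S + nabF X S'" using nabF_linear assms unfolding linear_connection_def by blast
  then show ?thesis by (simp add: plus_fun_def)
qed

lemma nabF_mult:
  assumes "X \<in> M.VF" "S \<in> PS" "f \<in> M.C"
  shows "nabF X (\<lambda>p. f p *\<^sub>R S p) p = X p f *\<^sub>R S p + f p *\<^sub>R nabF X S p"
proof -
  have "nabF X (\<lambda>p. f p *\<^sub>R S p) = (\<lambda>p. X p f *\<^sub>R S p + f p *\<^sub>R nabF X S p)"
    using nabF_linear assms unfolding linear_connection_def by blast
  then show ?thesis by (rule fun_cong)
qed

lemma nabF_T: "X \<in> M.VF \<Longrightarrow> S \<in> PS \<Longrightarrow> nabF X S p \<in> N.T (F p)"
  using PS_T nabF_PS by blast

lemma nabF_pullback: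
  assumes "X \<in> M.VF" "U \<in> N.VF" "W \<in> N.VF" "U (F p) = dF (X p)"
  shows "nabF X (W \<circ> F) p = nabN U W (F p)"
  using pullback_connection assms unfolding pullback_connection_def by blast

text \<open>The product rule for a cutoff at \<open>p\<close>, as for derivations. Sections may therefore be expanded in a
  local frame before they are differentiated.\<close>

lemma nabF_local:
  assumes X: "X \<in> M.VF" and S: "S \<in> PS" "S' \<in> PS" and eq: "eventually (\<lambda>q. S q = S' q) (nhds p)"
  shows "nabF X S p = nabF X S' p"
proof -
  obtain W where W: "open W" "p \<in> W" "\<And>q. q \<in> W \<Longrightarrow> S q = S' q"
    using eq unfolding eventually_nhds by blast
  obtain \<theta> K where \<theta>: "\<theta> \<in> M.C" "eventually (\<lambda>q. \<theta> q = 1) (nhds p)" "closed K" "K \<subseteq> W"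
    "\<And>q. q \<notin> K \<Longrightarrow> \<theta> q = 0" using M.bump_exists[OF W(1,2)] by metis
  have "(\<lambda>q. \<theta> q *\<^sub>R S q) = (\<lambda>q. \<theta> q *\<^sub>R S' q)"
  proof
    fix q show "\<theta> q *\<^sub>R S q = \<theta> q *\<^sub>R S' q"
      using \<theta>(4) \<theta>(5)[of q] W(3)[of q] by (cases "q \<in> K") auto
  qed
  then have "X p \<theta> *\<^sub>R S p + \<theta> p *\<^sub>R nabF X S p = X p \<theta> *\<^sub>R S' p + \<theta> p *\<^sub>R nabF X S' p"
    using nabF_mult[OF X S(1) \<theta>(1), of p] nabF_mult[OF X S(2) \<theta>(1), of p] by (simp only:)
  moreover have "\<theta> p = 1" using \<theta>(2) by (rule eventually_nhds_x_imp_x)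
  moreover have "S p = S' p" using eq by (rule eventually_nhds_x_imp_x)
  ultimately show ?thesis by (simp only: scale_one add_left_cancel)
qed

lemma nabF_zero: "X \<in> M.VF \<Longrightarrow> nabF X (\<lambda>p. 0) p = 0"
  using nabF_mult[OF _ PS_zero M.smooth_const, of X 0 p] M.tangent_const[OF M.VF_T, of X p 0] by simp

lemma nabF_sum:
  assumes X: "X \<in> M.VF" and "\<And>i. i \<in> I \<Longrightarrow> f i \<in> M.C" "\<And>i. i \<in> I \<Longrightarrow> S i \<in> PS"
  shows "nabF X (\<lambda>p. \<Sum>i\<in>I. f i p *\<^sub>R S i p) p =
    (\<Sum>i\<in>I. X p (f i) *\<^sub>R S i p + f i p *\<^sub>R nabF X (S i) p)"
  using assms(2,3)
proof (induction I rule: infinite_finite_induct)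
  case (insert i I)
  have "nabF X (\<lambda>p. f i p *\<^sub>R S i p + (\<Sum>i\<in>I. f i p *\<^sub>R S i p)) p =
    nabF X (\<lambda>p. f i p *\<^sub>R S i p) p + nabF X (\<lambda>p. \<Sum>i\<in>I. f i p *\<^sub>R S i p) p"
    using insert.prems by (intro nabF_add X PS_mult PS_sum) auto
  also have "nabF X (\<lambda>p. f i p *\<^sub>R S i p) p = X p (f i) *\<^sub>R S i p + f i p *\<^sub>R nabF X (S i) p"
    using insert.prems by (intro nabF_mult X) auto
  also have "nabF X (\<lambda>p. \<Sum>i\<in>I. f i p *\<^sub>R S i p) p =
    (\<Sum>i\<in>I. X p (f i) *\<^sub>R S i p + f i p *\<^sub>R nabF X (S i) p)"
    using insert.prems by (intro insert.IH) blast+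
  finally show ?case by (simp only: sum.insert[OF insert.hyps])
qed (use nabF_zero[OF X] in auto)

lemma PS_expand:
  assumes fr: "N.coordinate_frame (F p) W y" and S: "S \<in> PS"
  shows "eventually (\<lambda>q. S q = (\<Sum>b\<in>BN. S q (y b) *\<^sub>R W b (F q))) (nhds p)"
  using eventually_F[OF N.frame_expand_near[OF fr]]
  by eventually_elim (use PS_T[OF S] in blast)

text \<open>A section of the pullback bundle is near \<open>p\<close> a combination with smooth coefficients of pulled back
  frame fields, and on these the pullback connection is prescribed by the connection of the target.\<close>

lemma nabF_expand:
  assumes fr: "N.coordinate_frame (F p) W y" and X: "X \<in> M.VF" and S: "S \<in> PS"
    and U: "U \<in> N.VF" "U (F p) = dF (X p)"
  shows "nabF X S p =
    (\<Sum>b\<in>BN. X p (\<lambda>q. S q (y b)) *\<^sub>R W b (F p) + S p (y b) *\<^sub>R nabN U (W b) (F p))"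
proof -
  have S': "(\<lambda>q. S q (y b)) \<in> M.C" if "b \<in> BN" for b
    using PS_smooth[OF S N.frame_functions[OF fr that]] .
  have W: "W b \<circ> F \<in> PS" if "b \<in> BN" for b
    using PS_pullback[OF N.frame_fields[OF fr that]] .
  have "nabF X S p = nabF X (\<lambda>q. \<Sum>b\<in>BN. S q (y b) *\<^sub>R (W b \<circ> F) q) p"
  proof (rule nabF_local[OF X S])
    show "(\<lambda>q. \<Sum>b\<in>BN. S q (y b) *\<^sub>R (W b \<circ> F) q) \<in> PS"
      by (intro PS_sum PS_mult S' W)
    show "eventually (\<lambda>q. S q = (\<Sum>b\<in>BN. S q (y b) *\<^sub>R (W b \<circ> F) q)) (nhds p)"
      using PS_expand[OF fr S] by (simp only: o_apply)
  qed
  also have "\<dots> = (\<Sum>b\<in>BN. X p (\<lambda>q. S q (y b)) *\<^sub>R (W b \<circ> F) p + S p (y b) *\<^sub>R nabF X (W b \<circ> F) p)"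
    by (rule nabF_sum[OF X S' W])
  also have "\<dots> = (\<Sum>b\<in>BN. X p (\<lambda>q. S q (y b)) *\<^sub>R W b (F p) + S p (y b) *\<^sub>R nabN U (W b) (F p))"
    using nabF_pullback[OF X U(1) N.frame_fields[OF fr] U(2)] by (intro sum.cong refl) (simp only: o_apply)
  finally show ?thesis .
qed

text \<open>Inherited from the target connection, which is torsion-free. Both sides are compared on
  the coordinate functions \<open>y k\<close>. Besides the Lie bracket, the expansion in a frame leaves the terms
  \<open>nabN (cf X) (cf Y)\<close> and \<open>nabN (cf Y) (cf X)\<close>, where \<open>cf Z\<close> extends \<open>dF (Z p)\<close> with constant
  coefficients in the frame; their difference is the bracket of two such fields, which vanishes on
  the coordinates.\<close>

lemma nabF_torsion:
  assumes X: "X \<in> M.VF" and Y: "Y \<in> M.VF"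
  shows "nabF X (\<lambda>q. dF (Y q)) p - nabF Y (\<lambda>q. dF (X q)) p = dF (lie_bracket X Y p)"
proof -
  obtain W y where fr: "N.coordinate_frame (F p) W y" using N.coordinate_frame_exists by blast
  note WV = N.frame_fields[OF fr] and yC = N.frame_functions[OF fr]
  define cf where "cf Z = (\<lambda>q. \<Sum>b\<in>BN. dF (Z p) (y b) *\<^sub>R W b q)" for Z :: "'m \<Rightarrow> 'm tangent"
  have cfV: "cf Z \<in> N.VF" for Z unfolding cf_def using WV by (intro N.VF_sum N.VF_scale)
  have cfp: "cf Z (F p) = dF (Z p)" if "Z \<in> M.VF" for Z
    unfolding cf_def by (rule N.frame_expand[OF fr dF_T[OF M.VF_T[OF that]]])
  have comp: "nabF Z (\<lambda>q. dF (Z' q)) p (y k) =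
      Z p (\<lambda>q. Z' q (\<lambda>q. y k (F q))) + nabN (cf Z) (cf Z') (F p) (y k)"
    if Z: "Z \<in> M.VF" "Z' \<in> M.VF" and k: "k \<in> BN" for Z Z' k
  proof -
    have "nabF Z (\<lambda>q. dF (Z' q)) p (y k) =
      (\<Sum>b\<in>BN. Z p (\<lambda>q. dF (Z' q) (y b)) * W b (F p) (y k) +
        dF (Z' p) (y b) * nabN (cf Z) (W b) (F p) (y k))"
      unfolding nabF_expand[OF fr Z(1) PS_dF[OF Z(2)] cfV cfp[OF Z(1)]]
      by (simp add: sum_fun_apply)
    also have "\<dots> = (\<Sum>b\<in>BN. if b = k then Z p (\<lambda>q. dF (Z' q) (y k)) else 0) +
        (\<Sum>b\<in>BN. dF (Z' p) (y b) * nabN (cf Z) (W b) (F p) (y k))"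
      unfolding sum.distrib using N.frame_dual[OF fr _ k]
      by (intro arg_cong2[where f = "(+)"] sum.cong refl) auto
    also have "(\<Sum>b\<in>BN. if b = k then Z p (\<lambda>q. dF (Z' q) (y k)) else 0) = Z p (\<lambda>q. Z' q (\<lambda>q. y k (F q)))"
      using k onb_finite[OF N.onb] dF_apply[OF yC[OF k]] by simp
    also have "(\<Sum>b\<in>BN. dF (Z' p) (y b) * nabN (cf Z) (W b) (F p) (y k)) =
      nabN (cf Z) (cf Z') (F p) (y k)"
      using N.nab_const_sum[OF cfV WV, of BN "\<lambda>b. b" Z "\<lambda>b. dF (Z' p) (y b)" "F p"]
      unfolding cf_def[of Z'] by (simp add: sum_fun_apply)
    finally show ?thesis .
  qed
  have cf_sym: "nabN (cf X) (cf Y) (F p) (y k) = nabN (cf Y) (cf X) (F p) (y k)" if k: "k \<in> BN" for k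
  proof -
    have const: "cf Z (F p) (\<lambda>q. cf Z' q (y k)) = 0" for Z Z'
    proof -
      have "cf Z (F p) (\<lambda>q. cf Z' q (y k)) = cf Z (F p) (\<lambda>q. dF (Z' p) (y k))"
      proof (rule N.tangent_local[OF N.VF_T[OF cfV] N.VF_smooth[OF cfV yC[OF k]] N.smooth_const])
        have "eventually (\<lambda>q. \<forall>b\<in>BN. \<forall>b'\<in>BN. W b q (y b') = (if b = b' then 1 else 0)) (nhds (F p))"
          using fr unfolding N.coordinate_frame_def by (auto elim: eventually_mono)
        then show "eventually (\<lambda>q. cf Z' q (y k) = dF (Z' p) (y k)) (nhds (F p))"
        proof eventually_elim
          case (elim q)
          have "cf Z' q (y k) = (\<Sum>b\<in>BN. if b = k then dF (Z' p) (y k) else 0)"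
            unfolding cf_def sum_fun_apply using elim k by (intro sum.cong refl) auto
          then show ?case using k onb_finite[OF N.onb] by simp
        qed
      qed
      then show ?thesis using N.tangent_const[OF N.VF_T[OF cfV]] by simp
    qed
    have "nabN (cf X) (cf Y) (F p) (y k) - nabN (cf Y) (cf X) (F p) (y k) = lie_bracket (cf X) (cf Y) (F p) (y k)"
      using N.nab_torsion[OF cfV cfV, of X Y "F p"] by (metis minus_apply)
    also have "\<dots> = 0" unfolding lie_bracket_def by (simp only: const diff_self)
    finally show ?thesis by simp
  qed
  show ?thesis
  proof (rule N.frame_ext[OF fr])
    show "nabF X (\<lambda>q. dF (Y q)) p - nabF Y (\<lambda>q. dF (X q)) p \<in> N.T (F p)"
      by (intro N.T_diff nabF_T PS_dF X Y)
    have "lie_bracket X Y p = nabM X Y p - nabM Y X p" using M.nab_torsion[OF X Y] by (rule sym)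
    then show "dF (lie_bracket X Y p) \<in> N.T (F p)"
      using dF_T[OF M.T_diff[OF M.nab_T[OF X Y] M.nab_T[OF Y X]]] by (simp only:)
    fix k assume k: "k \<in> BN"
    show "(nabF X (\<lambda>q. dF (Y q)) p - nabF Y (\<lambda>q. dF (X q)) p) (y k) = dF (lie_bracket X Y p) (y k)"
      unfolding dF_apply[OF yC[OF k]] lie_bracket_def minus_apply comp[OF X Y k] comp[OF Y X k] cf_sym[OF k]
      by simp
  qed
qed

text \<open>In a frame \<open>W\<close> at \<open>F p\<close> both sections have
  smooth coefficients, and the claim reduces by the product rule to the metric compatibility of the
  target connection for the frame fields.\<close>

lemma nabF_metric:
  assumes X: "X \<in> M.VF" and S: "S \<in> PS" and S': "S' \<in> PS"
  shows "X p (\<lambda>q. gN (F q) (S q) (S' q)) = gN (F p) (nabF X S p) (S' p) + gN (F p) (S p) (nabF X S' p)"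
proof -
  have local: "\<exists>h\<in>M.C. eventually (\<lambda>q. gN (F q) (S q) (S' q) = h q) (nhds p) \<and>
    X p h = gN (F p) (nabF X S p) (S' p) + gN (F p) (S p) (nabF X S' p)" for p
  proof -
    obtain W y where fr: "N.coordinate_frame (F p) W y" using N.coordinate_frame_exists by blast
    note WV = N.frame_fields[OF fr] and yC = N.frame_functions[OF fr]
    have WT: "W b q \<in> N.T q" if "b \<in> BN" for b q using N.VF_T WV that by blast
    obtain U where U: "U \<in> N.VF" "U (F p) = dF (X p)"
      using N.tangent_extend[OF dF_T[OF M.VF_T[OF X]]] by blast
    have NT: "nabN U (W b) q \<in> N.T q" if "b \<in> BN" for b q using N.nab_T U(1) WV that by blast
    define w where "w b c q = gN (F q) (W b (F q)) (W c (F q))" for b c q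
    define s where "s b q = S q (y b)" for b q
    define s' where "s' b q = S' q (y b)" for b q
    have wC: "w b c \<in> M.C" if "b \<in> BN" "c \<in> BN" for b c
      unfolding w_def using smooth_pullback[OF N.g_smooth[OF WV WV]] that by blast
    have sC: "s b \<in> M.C" "s' b \<in> M.C" if "b \<in> BN" for b
      unfolding s_def s'_def using PS_smooth S S' yC that by blast+
    define h where "h q = (\<Sum>b\<in>BN. \<Sum>c\<in>BN. s b q * (s' c q * w b c q))" for q
    have hC: "h \<in> M.C" unfolding h_def by (intro M.smooth_sum M.smooth_mult wC sC)
    have bil: "gN (F q) (\<Sum>b\<in>BN. s b q *\<^sub>R W b (F q)) (\<Sum>b\<in>BN. s' b q *\<^sub>R W b (F q)) = h q" for q
    proof -
      have "(\<Sum>b\<in>BN. s' b q *\<^sub>R W b (F q)) \<in> N.T (F q)" using WT by (blast intro: N.T_sum N.T_scale)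
      then have "gN (F q) (\<Sum>b\<in>BN. s b q *\<^sub>R W b (F q)) (\<Sum>b\<in>BN. s' b q *\<^sub>R W b (F q)) =
        (\<Sum>b\<in>BN. s b q * gN (F q) (W b (F q)) (\<Sum>b\<in>BN. s' b q *\<^sub>R W b (F q)))"
        by (intro N.g_sum_scale_left WT)
      also have "\<dots> = h q"
        unfolding h_def w_def
        by (intro sum.cong refl) (simp only: N.g_sum_scale_right[OF WT WT] sum_distrib_left)
      finally show ?thesis .
    qed
    have "eventually (\<lambda>q. gN (F q) (S q) (S' q) = h q) (nhds p)"
      using PS_expand[OF fr S] PS_expand[OF fr S']
    proof eventually_elim
      case (elim q)
      show ?case using bil[of q] unfolding s_def s'_def by (simp only: elim[symmetric])
    qed
    moreover have "X p h = gN (F p) (nabF X S p) (S' p) + gN (F p) (S p) (nabF X S' p)"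
    proof -
      note XT = M.VF_T[OF X, of p]
      have Sp: "S p = (\<Sum>b\<in>BN. s b p *\<^sub>R W b (F p))" "S' p = (\<Sum>b\<in>BN. s' b p *\<^sub>R W b (F p))"
        unfolding s_def s'_def using N.frame_expand[OF fr PS_T] S S' by simp_all
      define n where "n b c = gN (F p) (nabN U (W b) (F p)) (W c (F p))" for b c
      have Xw: "X p (w b c) = n b c + n c b" if "b \<in> BN" "c \<in> BN" for b c
      proof -
        have "X p (w b c) = dF (X p) (\<lambda>q. gN q (W b q) (W c q))"
          unfolding w_def using dF_apply[OF N.g_smooth[OF WV WV]] that by simp
        also have "\<dots> = n b c + gN (F p) (W b (F p)) (nabN U (W c) (F p))"
          unfolding U(2)[symmetric] n_def using that by (intro N.nab_metric U(1) WV)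
        also have "gN (F p) (W b (F p)) (nabN U (W c) (F p)) = n c b"
          unfolding n_def using that by (intro N.g_sym WT NT)
        finally show ?thesis .
      qed
      have "X p h = (\<Sum>b\<in>BN. \<Sum>c\<in>BN. X p (\<lambda>q. s b q * (s' c q * w b c q)))"
        unfolding h_def
        by (subst M.tangent_sum[OF XT], (intro M.smooth_sum M.smooth_mult wC sC; assumption)[1],
            intro sum.cong refl M.tangent_sum[OF XT] M.smooth_mult wC sC)
      also have "\<dots> = (\<Sum>b\<in>BN. \<Sum>c\<in>BN.
          (X p (s b) * s' c p * w b c p + s b p * s' c p * n b c) +
          (s b p * X p (s' c) * w b c p + s b p * s' c p * n c b))"
      proof (intro sum.cong refl)
        fix b c assume b: "b \<in> BN" and c: "c \<in> BN"
        have "X p (\<lambda>q. s b q * (s' c q * w b c q)) =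
          s b p * (s' c p * X p (w b c) + w b c p * X p (s' c)) + s' c p * w b c p * X p (s b)"
          using M.tangent_mult[OF XT sC(1)[OF b] M.smooth_mult[OF sC(2)[OF c] wC[OF b c]]]
            M.tangent_mult[OF XT sC(2)[OF c] wC[OF b c]] by simp
        then show "X p (\<lambda>q. s b q * (s' c q * w b c q)) =
          (X p (s b) * s' c p * w b c p + s b p * s' c p * n b c) +
          (s b p * X p (s' c) * w b c p + s b p * s' c p * n c b)"
          unfolding Xw[OF b c] by (simp add: algebra_simps)
      qed
      also have "\<dots> = (\<Sum>b\<in>BN. \<Sum>c\<in>BN. X p (s b) * s' c p * w b c p + s b p * s' c p * n b c) +
        (\<Sum>b\<in>BN. \<Sum>c\<in>BN. s b p * X p (s' c) * w b c p + s b p * s' c p * n c b)"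
        by (simp only: sum.distrib)
      finally have Xh: "X p h = \<dots>" .
      have half: "gN (F p) (nabF X R p) (\<Sum>c\<in>BN. r' c *\<^sub>R W c (F p)) =
        (\<Sum>b\<in>BN. \<Sum>c\<in>BN. X p (\<lambda>q. R q (y b)) * r' c * w b c p + R p (y b) * r' c * n b c)"
        if R: "R \<in> PS" for R r'
      proof -
        have "gN (F p) (nabF X R p) (\<Sum>c\<in>BN. r' c *\<^sub>R W c (F p)) =
          (\<Sum>c\<in>BN. r' c * gN (F p) (nabF X R p) (W c (F p)))"
          by (intro N.g_sum_scale_right WT nabF_T X R)
        also have "\<dots> = (\<Sum>c\<in>BN. \<Sum>b\<in>BN. X p (\<lambda>q. R q (y b)) * r' c * w b c p + R p (y b) * r' c * n b c)"
        proof (intro sum.cong refl)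
          fix c assume c: "c \<in> BN"
          have "gN (F p) (nabF X R p) (W c (F p)) =
            (\<Sum>b\<in>BN. gN (F p) (X p (\<lambda>q. R q (y b)) *\<^sub>R W b (F p) + R p (y b) *\<^sub>R nabN U (W b) (F p)) (W c (F p)))"
            unfolding nabF_expand[OF fr X R U]
            by (intro N.g_sum_left N.T_add N.T_scale WT NT c)
          also have "\<dots> = (\<Sum>b\<in>BN. X p (\<lambda>q. R q (y b)) * w b c p + R p (y b) * n b c)"
          proof (intro sum.cong refl)
            fix b assume b: "b \<in> BN"
            show "gN (F p) (X p (\<lambda>q. R q (y b)) *\<^sub>R W b (F p) + R p (y b) *\<^sub>R nabN U (W b) (F p)) (W c (F p)) =
              X p (\<lambda>q. R q (y b)) * w b c p + R p (y b) * n b c"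
              unfolding w_def n_def
              by (simp only: N.g_add_left[OF N.T_scale[OF WT[OF b]] N.T_scale[OF NT[OF b]] WT[OF c]]
                  N.g_scale_left[OF WT[OF b] WT[OF c]] N.g_scale_left[OF NT[OF b] WT[OF c]])
          qed
          finally show "r' c * gN (F p) (nabF X R p) (W c (F p)) =
            (\<Sum>b\<in>BN. X p (\<lambda>q. R q (y b)) * r' c * w b c p + R p (y b) * r' c * n b c)"
            by (simp add: sum_distrib_left algebra_simps)
        qed
        also have "\<dots> = (\<Sum>b\<in>BN. \<Sum>c\<in>BN. X p (\<lambda>q. R q (y b)) * r' c * w b c p + R p (y b) * r' c * n b c)"
          by (rule sum.swap)
        finally show ?thesis .
      qed
      have 1: "gN (F p) (nabF X S p) (S' p) =
        (\<Sum>b\<in>BN. \<Sum>c\<in>BN. X p (s b) * s' c p * w b c p + s b p * s' c p * n b c)"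
        using half[OF S, of "\<lambda>c. s' c p"] Sp(2) unfolding s_def by simp
      have "gN (F p) (S p) (nabF X S' p) = gN (F p) (nabF X S' p) (S p)"
        by (intro N.g_sym PS_T nabF_T X S S')
      also have "\<dots> = (\<Sum>c\<in>BN. \<Sum>b\<in>BN. X p (s' c) * s b p * w c b p + s' c p * s b p * n c b)"
        using half[OF S', of "\<lambda>c. s c p"] Sp(1) unfolding s'_def by simp
      also have "\<dots> = (\<Sum>b\<in>BN. \<Sum>c\<in>BN. X p (s' c) * s b p * w c b p + s' c p * s b p * n c b)"
        by (rule sum.swap)
      also have "\<dots> = (\<Sum>b\<in>BN. \<Sum>c\<in>BN. s b p * X p (s' c) * w b c p + s b p * s' c p * n c b)"
      proof (intro sum.cong refl)
        fix b c assume "b \<in> BN" "c \<in> BN"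
        then have "w c b p = w b c p" unfolding w_def by (intro N.g_sym WT)
        then show "X p (s' c) * s b p * w c b p + s' c p * s b p * n c b =
          s b p * X p (s' c) * w b c p + s b p * s' c p * n c b" by simp
      qed
      finally show ?thesis using Xh 1 by simp
    qed
    ultimately show ?thesis using hC by blast
  qed
  have C: "(\<lambda>q. gN (F q) (S q) (S' q)) \<in> M.C"
    by (rule M.smooth_functionsI_local) (use local in blast)
  obtain h where h: "h \<in> M.C" "eventually (\<lambda>q. gN (F q) (S q) (S' q) = h q) (nhds p)"
    "X p h = gN (F p) (nabF X S p) (S' p) + gN (F p) (S p) (nabF X S' p)" using local by blast
  show ?thesis
    using M.tangent_local[OF M.VF_T[OF X] C h(1,2)] h(3) by simp
qed

end

section \<open>The second fundamental form of a horizontally conformal submersion\<close>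

locale conformal_submersion =
  submersion_with_connections \<A> BM g \<B> BN F nabM gN nabN nabF
  for \<A> :: "('m::{t2_space, second_countable_topology}, 'e::real_inner) chart set" and BM g
    and \<B> :: "('n::{t2_space, second_countable_topology}, 'd::real_inner) chart set" and BN
    and F :: "'m \<Rightarrow> 'n" and nabM gN nabN nabF +
  fixes lam :: "'m \<Rightarrow> real"
  assumes lam_smooth: "lam \<in> smooth_functions \<A>" and lam_pos: "\<And>p. lam p > 0"
    and conformal: "\<And>p u v. u \<in> horizontal \<A> g \<B> F p \<Longrightarrow> v \<in> horizontal \<A> g \<B> F p \<Longrightarrow>
      gN (F p) (differential \<B> F u) (differential \<B> F v) = (lam p)\<^sup>2 * g p u v"
begin

lemma ln_lam_smooth: "(\<lambda>p. ln (lam p)) \<in> M.C"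
  by (rule M.smooth_compose[OF lam_smooth smooth_on_ln]) (use lam_pos in auto)

lemma ln_lam_derivative: "v \<in> M.T p \<Longrightarrow> v lam = lam p * v (\<lambda>p. ln (lam p))"
  using M.tangent_chain[OF _ lam_smooth ln_lam_smooth DERIV_ln[OF lam_pos], of v p] lam_pos[of p]
  by (simp add: field_simps)

text \<open>The vertical part of \<open>u\<close> contributes to neither side, so this reduces to conformality on horizontal
  vectors. It will be applied to Lie brackets of horizontal fields.\<close>

lemma gN_dF_horizontal:
  assumes u: "u \<in> M.T p" and z: "z \<in> H p"
  shows "gN (F p) (dF u) (dF z) = (lam p)\<^sup>2 * g p u z"
proof -
  obtain X where X: "X \<in> M.VF" "X p = u" using M.tangent_extend[OF u] by blast
  note h = hor_H[OF X(1), of p] and v = vert_V[OF X(1), of p]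
  have u': "u = hor X p + vert X p" using hor_add_vert[OF X(1)] X(2) by metis
  have "dF u = dF (hor X p)"
    using v unfolding u' dF_add by (simp only: V_iff add_0_right)
  moreover have "g p u z = g p (hor X p) z"
    unfolding u' using M.g_add_left[OF H_T[OF h] V_T[OF v] H_T[OF z]] V_perp_H[OF z v] by simp
  ultimately show ?thesis using conformal[OF h z] by (simp only:)
qed

text \<open>The second fundamental form of a horizontally conformal submersion on horizontal fields. The
  expression \<open>E\<close> compares the pullback connection with the connection of \<open>M\<close>. Both are torsion-free,
  so \<open>E\<close> is symmetric in its first two arguments; both are metric, for \<open>gN\<close> and \<open>g\<close>, and these metrics
  differ by the factor \<open>lam\<^sup>2\<close> on horizontal vectors, so the symmetrisation of \<open>E\<close> in its last two
  arguments is the derivative of this factor. As in Koszul's formula the two symmetries determine \<open>E\<close>.\<close>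

lemma second_fundamental_form_horizontal:
  assumes X: "X \<in> sections \<A> H" and Y: "Y \<in> sections \<A> H" and Z: "Z \<in> sections \<A> H"
  shows "gN (F p) (nabF X (\<lambda>q. dF (Y q)) p) (dF (Z p)) = (lam p)\<^sup>2 *
    (g p (nabM X Y p) (Z p) + X p (\<lambda>p. ln (lam p)) * g p (Y p) (Z p)
      + Y p (\<lambda>p. ln (lam p)) * g p (X p) (Z p) - Z p (\<lambda>p. ln (lam p)) * g p (X p) (Y p))"
proof -
  define \<Gamma> where "\<Gamma> = sections \<A> H"
  have \<Gamma>: "A \<in> M.VF" "\<And>q. A q \<in> H q" "\<And>q. A q \<in> M.T q" if "A \<in> \<Gamma>" for A
    using that H_T by (auto simp: \<Gamma>_def sections_def)
  define l where "l A = 2 * (lam p)\<^sup>2 * A p (\<lambda>p. ln (lam p))" for A :: "'m \<Rightarrow> 'm tangent"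
  define E where "E A A' D = gN (F p) (nabF A (\<lambda>q. dF (A' q)) p) (dF (D p)) -
    (lam p)\<^sup>2 * g p (nabM A A' p) (D p)" for A A' D
  have met: "E A A' D + E A D A' = l A * g p (A' p) (D p)" if "A \<in> \<Gamma>" "A' \<in> \<Gamma>" "D \<in> \<Gamma>" for A A' D
  proof -
    note A = \<Gamma>[OF that(1)] and A' = \<Gamma>[OF that(2)] and D = \<Gamma>[OF that(3)]
    have C: "(\<lambda>q. g q (A' q) (D q)) \<in> M.C" by (rule M.g_smooth[OF A'(1) D(1)])
    have "A p (\<lambda>q. gN (F q) (dF (A' q)) (dF (D q))) = A p (\<lambda>q. (lam q * lam q) * g q (A' q) (D q))"
      using conformal[OF A'(2) D(2)] by (simp add: power2_eq_square)
    also have "\<dots> = (lam p * lam p) * A p (\<lambda>q. g q (A' q) (D q)) +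
        g p (A' p) (D p) * (lam p * A p lam + lam p * A p lam)"
      using M.tangent_mult[OF A(3) M.smooth_mult[OF lam_smooth lam_smooth] C]
        M.tangent_mult[OF A(3) lam_smooth lam_smooth] by simp
    finally have 1: "A p (\<lambda>q. gN (F q) (dF (A' q)) (dF (D q))) =
      (lam p)\<^sup>2 * (g p (nabM A A' p) (D p) + g p (A' p) (nabM A D p)) + l A * g p (A' p) (D p)"
      unfolding M.nab_metric[OF A(1) A'(1) D(1)] ln_lam_derivative[OF A(3)] l_def
      by (simp add: power2_eq_square algebra_simps)
    have "A p (\<lambda>q. gN (F q) (dF (A' q)) (dF (D q))) =
      gN (F p) (nabF A (\<lambda>q. dF (A' q)) p) (dF (D p)) + gN (F p) (dF (A' p)) (nabF A (\<lambda>q. dF (D q)) p)"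
      by (rule nabF_metric[OF A(1) PS_dF[OF A'(1)] PS_dF[OF D(1)]])
    moreover have "gN (F p) (dF (A' p)) (nabF A (\<lambda>q. dF (D q)) p) =
      gN (F p) (nabF A (\<lambda>q. dF (D q)) p) (dF (A' p))"
      by (intro N.g_sym dF_T nabF_T PS_dF A A' D)
    moreover have "g p (A' p) (nabM A D p) = g p (nabM A D p) (A' p)"
      by (intro M.g_sym M.nab_T A A' D)
    ultimately show ?thesis using 1 by (simp add: E_def algebra_simps)
  qed
  have tor: "E A A' D = E A' A D" if "A \<in> \<Gamma>" "A' \<in> \<Gamma>" "D \<in> \<Gamma>" for A A' D
  proof -
    note A = \<Gamma>[OF that(1)] and A' = \<Gamma>[OF that(2)] and D = \<Gamma>[OF that(3)]
    note T = nabF_T[OF A(1) PS_dF[OF A'(1)], of p] nabF_T[OF A'(1) PS_dF[OF A(1)], of p]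
      and T' = M.nab_T[OF A(1) A'(1), of p] M.nab_T[OF A'(1) A(1), of p]
    have "nabF A (\<lambda>q. dF (A' q)) p - nabF A' (\<lambda>q. dF (A q)) p = dF (nabM A A' p - nabM A' A p)"
      unfolding M.nab_torsion[OF A(1) A'(1)] by (rule nabF_torsion[OF A(1) A'(1)])
    then have "gN (F p) (nabF A (\<lambda>q. dF (A' q)) p - nabF A' (\<lambda>q. dF (A q)) p) (dF (D p)) =
      (lam p)\<^sup>2 * g p (nabM A A' p - nabM A' A p) (D p)"
      using gN_dF_horizontal[OF M.T_diff[OF T'] D(2)] by (simp only:)
    then show ?thesis
      unfolding N.g_diff_left[OF T dF_T[OF D(3)]] M.g_diff_left[OF T' D(3)]
      by (simp add: E_def algebra_simps)
  qed
  have XYZ: "X \<in> \<Gamma>" "Y \<in> \<Gamma>" "Z \<in> \<Gamma>" using X Y Z by (simp_all add: \<Gamma>_def)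
  have "2 * E X Y Z = l X * g p (Y p) (Z p) + l Y * g p (X p) (Z p) - l Z * g p (X p) (Y p)"
    using met[OF XYZ(1,2,3)] met[OF XYZ(2,1,3)] met[OF XYZ(3,1,2)]
      tor[OF XYZ(1,2,3)] tor[OF XYZ(1,3,2)] tor[OF XYZ(2,3,1)] by linarith
  then show ?thesis by (simp add: E_def l_def algebra_simps)
qed

end

section \<open>Semi-invariant distributions\<close>

locale semi_invariant_submersion =
  conformal_submersion \<A> BM g \<B> BN F nabM gN nabN nabF lam
  for \<A> :: "('m::{t2_space, second_countable_topology}, 'e::real_inner) chart set" and BM g
    and \<B> :: "('n::{t2_space, second_countable_topology}, 'd::real_inner) chart set" and BN
    and F :: "'m \<Rightarrow> 'n" and nabM gN nabN nabF lam +
  fixes R :: "'m endo" and D :: "'m \<Rightarrow> 'm tangent set"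
  assumes kaehler: "kaehler_structure \<A> g nabM R"
    and semi_invariant: "semi_invariant_distribution \<A> g \<B> F R D"
begin

abbreviation "\<D>\<^sub>2 \<equiv> D2 \<A> g \<B> F D"
abbreviation "\<mu> \<equiv> mu \<A> g \<B> F R D"

lemma R_properties:
  assumes u: "u \<in> M.T p"
  shows R_T: "R p u \<in> M.T p"
    and R_add: "v \<in> M.T p \<Longrightarrow> R p (u + v) = R p u + R p v"
    and R_R: "R p (R p u) = - u"
    and R_isometry: "v \<in> M.T p \<Longrightarrow> g p (R p u) (R p v) = g p u v"
  using kaehler u unfolding kaehler_structure_def endo_field_def by blast+

lemma R_VF: "X \<in> M.VF \<Longrightarrow> (\<lambda>p. R p (X p)) \<in> M.VF"
  and R_parallel: "X \<in> M.VF \<Longrightarrow> Y \<in> M.VF \<Longrightarrow> nabM X (\<lambda>p. R p (Y p)) = (\<lambda>p. R p (nabM X Y p))"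
  using kaehler unfolding kaehler_structure_def endo_field_def by blast+

lemma R_skew: "u \<in> M.T p \<Longrightarrow> v \<in> M.T p \<Longrightarrow> g p (R p u) v = - g p u (R p v)"
  using R_isometry[OF R_T, of u p v] R_R[of u p] M.g_minus_left[OF _ R_T, of u p v] by simp

lemma D_V: "u \<in> D p \<Longrightarrow> u \<in> V p"
  and R_D: "R p ` D p = D p"
  and R_D2: "u \<in> \<D>\<^sub>2 p \<Longrightarrow> R p u \<in> H p"
  and V_decompose: "u \<in> V p \<Longrightarrow> \<exists>a\<in>D p. \<exists>b\<in>\<D>\<^sub>2 p. u = a + b"
proof -
  have si: "D p \<subseteq> V p" "direct_sum (V p) (D p) (\<D>\<^sub>2 p)" "R p ` D p = D p" "R p ` \<D>\<^sub>2 p \<subseteq> H p"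
    using semi_invariant by (simp_all add: semi_invariant_distribution_def)
  show "u \<in> D p \<Longrightarrow> u \<in> V p" using si(1) by blast
  show "R p ` D p = D p" by (rule si(3))
  show "u \<in> \<D>\<^sub>2 p \<Longrightarrow> R p u \<in> H p" using si(4) by blast
  assume "u \<in> V p"
  then have "u \<in> {a + b |a b. a \<in> D p \<and> b \<in> \<D>\<^sub>2 p}" using si(2) unfolding direct_sum_def by (simp only:)
  then show "\<exists>a\<in>D p. \<exists>b\<in>\<D>\<^sub>2 p. u = a + b" by blast
qed

lemma D2_iff: "u \<in> \<D>\<^sub>2 p \<longleftrightarrow> u \<in> V p \<and> (\<forall>w\<in>D p. g p u w = 0)"
  by (simp add: D2_def orth_complement_def)

lemma mu_iff: "u \<in> \<mu> p \<longleftrightarrow> u \<in> H p \<and> (\<forall>w\<in>\<D>\<^sub>2 p. g p u (R p w) = 0)"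
  by (simp add: mu_def orth_complement_def)

lemma R_D_mem: "u \<in> D p \<Longrightarrow> R p u \<in> D p"
  using R_D by blast

lemma R_D_preimage: "u \<in> D p \<Longrightarrow> \<exists>v\<in>D p. u = R p v"
  using R_D[of p] by blast

lemma zero_section: "(\<lambda>p. 0) \<in> sections \<A> \<D>\<^sub>2"
proof -
  have "0 \<in> \<D>\<^sub>2 p" for p
    unfolding D2_iff using D_V V_T by simp
  then show ?thesis by (simp add: sections_def)
qed

lemma sections_D2:
  assumes "U \<in> sections \<A> \<D>\<^sub>2"
  shows "U \<in> M.VF" "U p \<in> \<D>\<^sub>2 p" "U p \<in> V p" "U p \<in> M.T p" "(\<lambda>q. R q (U q)) \<in> sections \<A> H"
  using assms R_VF R_D2 V_T by (auto simp: sections_def D2_iff)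

text \<open>The projection of a vertical vector to \<open>\<D>\<^sub>2\<close> is \<open>- R (hor (R v))\<close>: the \<open>D\<close>-part of \<open>v\<close> is mapped by \<open>R\<close> to a
  vertical and its \<open>\<D>\<^sub>2\<close>-part to a horizontal vector. This formula visibly preserves smoothness, so
  projecting the vertical part of any extension of \<open>b\<close> gives a section of \<open>\<D>\<^sub>2\<close>.\<close>

lemma D2_extend:
  assumes b: "b \<in> \<D>\<^sub>2 p"
  obtains U where "U \<in> sections \<A> \<D>\<^sub>2" "U p = b"
proof -
  have bV: "b \<in> V p" using b by (simp add: D2_iff)
  obtain W where W: "W \<in> M.VF" "W p = b" using M.tangent_extend[OF V_T[OF bV]] by blast
  define Q where "Q q = R q (vert W q)" for q
  have Q: "Q \<in> M.VF" unfolding Q_def by (rule R_VF[OF vert_VF[OF W(1)]])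
  define U where "U q = (-1) *\<^sub>R R q (hor Q q)" for q
  have proj: "U q = d" if "a \<in> D q" "d \<in> \<D>\<^sub>2 q" "vert W q = a + d" for q a d
  proof -
    have T: "a \<in> M.T q" "d \<in> M.T q" using that D_V V_T by (auto simp: D2_iff)
    have "Q q = R q a + R q d" unfolding Q_def that(3) by (rule R_add[OF T])
    then have "Q q - R q d = R q a" by (simp only: add_diff_cancel_right')
    then have "Q q - R q d \<in> V q" using D_V[OF R_D_mem[OF that(1)]] by (simp only:)
    then have "hor Q q = R q d" using hor_part_eqI(1)[OF R_D2[OF that(2)]] by blast
    then show ?thesis unfolding U_def by (simp add: R_R[OF T(2)])
  qed
  have "U \<in> M.VF" unfolding U_def by (intro M.VF_scale R_VF hor_VF Q)
  moreover have "U q \<in> \<D>\<^sub>2 q" for q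
    using V_decompose[OF vert_V[OF W(1)]] proj by metis
  moreover have "U p = b"
  proof (rule proj)
    obtain a d where a: "a \<in> D p" "d \<in> \<D>\<^sub>2 p" "b = a + d" using V_decompose[OF bV] by blast
    have "vert W p = b" using hor_part_eqI(2)[of 0 p W] bV W(2) by simp
    moreover have "a = 0"
    proof -
      have T: "a \<in> M.T p" "d \<in> M.T p" using a D_V V_T by (auto simp: D2_iff)
      have "g p b a = 0" "g p d a = 0" using b a by (auto simp: D2_iff)
      then have "g p a a = 0" using M.g_add_left[OF T T(1)] a(3) by simp
      then show ?thesis using M.g_self_zero T by blast
    qed
    ultimately show "(0::'m tangent) \<in> D p" "b \<in> \<D>\<^sub>2 p" "vert W p = 0 + b" using a b by simp_all
  qed
  ultimately show thesis using that[of U] by (simp add: sections_def)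
qed

text \<open>For horizontal \<open>Y\<close> the field \<open>R Y\<close> is orthogonal to \<open>D\<close> and to \<open>R \<D>\<^sub>2\<close>, since \<open>R\<close> maps \<open>D\<close> to \<open>D\<close> and
  \<open>R \<D>\<^sub>2\<close> to \<open>\<D>\<^sub>2\<close>, both of which are vertical. Hence the splitting of \<open>R Y\<close> into \<open>B Y + C Y\<close> is just
  its splitting into vertical and horizontal parts.\<close>

lemma B_part_C_part:
  assumes Y: "Y \<in> sections \<A> H"
  shows B_eq: "B_part \<A> g \<B> F R D Y = vert (\<lambda>q. R q (Y q))"
    and C_eq: "C_part \<A> g \<B> F R D Y = hor (\<lambda>q. R q (Y q))"
    and C_mu: "hor (\<lambda>q. R q (Y q)) p \<in> \<mu> p"
proof -
  define Z where "Z q = R q (Y q)" for q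
  have YV: "Y \<in> M.VF" and YH: "Y q \<in> H q" for q using Y by (auto simp: sections_def)
  have Z: "Z \<in> M.VF" unfolding Z_def by (rule R_VF[OF YV])
  note h = hor_H[OF Z] and v = vert_V[OF Z]
  have ZT: "Z q \<in> M.T q" for q using M.VF_T[OF Z] .
  have inner: "g q (Z q) w = g q (hor Z q) w + g q (vert Z q) w" if "w \<in> M.T q" for q w
    using M.g_add_left[OF H_T[OF h] V_T[OF v] that] hor_add_vert[OF Z, of q] by metis
  have D2v: "vert Z q \<in> \<D>\<^sub>2 q" for q
  proof -
    have "g q (vert Z q) w = 0" if w: "w \<in> D q" for w
    proof -
      have wT: "w \<in> M.T q" using V_T[OF D_V[OF w]] .
      have "g q (Z q) w = - g q (Y q) (R q w)"
        unfolding Z_def by (rule R_skew[OF H_T[OF YH] wT])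
      also have "\<dots> = 0" using H_perp_V[OF YH D_V[OF R_D_mem[OF w]]] by simp
      finally show ?thesis using inner[OF wT] H_perp_V[OF h D_V[OF w]] by simp
    qed
    then show ?thesis using v by (simp add: D2_iff)
  qed
  have muh: "hor Z q \<in> \<mu> q" for q
  proof -
    have "g q (hor Z q) (R q w) = 0" if w: "w \<in> \<D>\<^sub>2 q" for w
    proof -
      have wV: "w \<in> V q" using w by (simp add: D2_iff)
      have "g q (Z q) (R q w) = g q (Y q) w"
        unfolding Z_def by (rule R_isometry[OF H_T[OF YH] V_T[OF wV]])
      also have "\<dots> = 0" by (rule H_perp_V[OF YH wV])
      finally show ?thesis using inner[OF R_T[OF V_T[OF wV]]] V_perp_H[OF R_D2[OF w] v] by simp
    qed
    then show ?thesis using h by (simp add: mu_iff)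
  qed
  then show "hor (\<lambda>q. R q (Y q)) p \<in> \<mu> p" by (simp only: Z_def[abs_def])
  have uniq: "a = vert Z q" "b = hor Z q" if "a \<in> \<D>\<^sub>2 q" "b \<in> \<mu> q" "Z q = a + b" for a b q
  proof -
    have "Z q - b = a" using that(3) by (simp only: add_diff_cancel_right')
    then have "Z q - b \<in> V q" using that(1) by (simp only: D2_iff)
    then have "hor Z q = b" "vert Z q = Z q - b"
      using hor_part_eqI[of b q Z] that(2) by (simp_all only: mu_iff)
    then show "a = vert Z q" "b = hor Z q" using \<open>Z q - b = a\<close> by simp_all
  qed
  have sum: "Z q = vert Z q + hor Z q" for q using hor_add_vert[OF Z, of q] by (simp only: add.commute)
  have "B_part \<A> g \<B> F R D Y = vert Z"
  proof
    fix q
    show "B_part \<A> g \<B> F R D Y q = vert Z q"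
      unfolding B_part_def component_def Z_def[symmetric]
    proof (rule the_equality)
      show "vert Z q \<in> \<D>\<^sub>2 q \<and> (\<exists>b\<in>\<mu> q. Z q = vert Z q + b)" using D2v muh sum by blast
    qed (use uniq(1) in blast)
  qed
  then show "B_part \<A> g \<B> F R D Y = vert (\<lambda>q. R q (Y q))" by (simp only: Z_def[abs_def])
  have "C_part \<A> g \<B> F R D Y = hor Z"
  proof
    fix q
    show "C_part \<A> g \<B> F R D Y q = hor Z q"
      unfolding C_part_def component_def Z_def[symmetric]
    proof (rule the_equality)
      show "hor Z q \<in> \<mu> q \<and> (\<exists>b\<in>\<D>\<^sub>2 q. Z q = hor Z q + b)"
        using D2v muh hor_add_vert[OF Z] by blast
      fix a assume "a \<in> \<mu> q \<and> (\<exists>b\<in>\<D>\<^sub>2 q. Z q = a + b)"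
      then obtain b where "a \<in> \<mu> q" "b \<in> \<D>\<^sub>2 q" "Z q = b + a" by (auto simp only: add.commute)
      then show "a = hor Z q" using uniq(2) by blast
    qed
  qed
  then show "C_part \<A> g \<B> F R D Y = hor (\<lambda>q. R q (Y q))" by (simp only: Z_def[abs_def])
qed

context
  fixes X Y assumes X: "X \<in> sections \<A> H" and Y: "Y \<in> sections \<A> H"
begin

abbreviation "BY \<equiv> B_part \<A> g \<B> F R D Y"
abbreviation "CY \<equiv> C_part \<A> g \<B> F R D Y"
abbreviation "OA \<equiv> oneill_A \<A> g nabM \<B> F"

lemma horizontal_XY: "X \<in> M.VF" "X q \<in> H q" "Y \<in> M.VF" "Y q \<in> H q"
  using X Y by (simp_all add: sections_def)

lemma BY_CY: "BY \<in> M.VF" "CY \<in> M.VF" "BY q \<in> V q" "CY q \<in> H q" "CY q \<in> \<mu> q"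
  unfolding B_eq[OF Y] C_eq[OF Y]
  by (rule vert_VF[OF R_VF[OF horizontal_XY(3)]] hor_VF[OF R_VF[OF horizontal_XY(3)]] vert_V[OF R_VF[OF horizontal_XY(3)]]
      hor_H[OF R_VF[OF horizontal_XY(3)]] C_mu[OF Y])+

lemma nab_BY_CY: "nabM X BY p + nabM X CY p = R p (nabM X Y p)"
proof -
  have "(\<lambda>q. BY q + CY q) = (\<lambda>q. R q (Y q))"
    unfolding B_eq[OF Y] C_eq[OF Y]
    by (rule ext, rule trans[OF add.commute hor_add_vert[OF R_VF[OF horizontal_XY(3)], symmetric]])
  then have "nabM X (\<lambda>q. BY q + CY q) p = R p (nabM X Y p)"
    using R_parallel[OF horizontal_XY(1,3)] by (simp only:)
  then show ?thesis using M.nab_add[OF horizontal_XY(1) BY_CY(1,2)] by simp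
qed

lemma nab_tangent: "nabM X BY p \<in> M.T p" "nabM X CY p \<in> M.T p" "nabM X Y p \<in> M.T p"
  by (intro M.nab_T horizontal_XY BY_CY)+

lemma nab_BY_CY_inner:
  assumes w: "w \<in> M.T p"
  shows "g p (nabM X BY p) w + g p (nabM X CY p) w = g p (R p (nabM X Y p)) w"
  unfolding nab_BY_CY[symmetric] by (rule M.g_add_left[OF nab_tangent(1,2) w, symmetric])

text \<open>The field on the left is the vertical part of \<open>R (nabM X Y)\<close>. It lies in \<open>\<D>\<^sub>2\<close> iff it is orthogonal
  to \<open>D\<close>, and as \<open>R\<close> is skew and preserves \<open>D\<close> this means that \<open>nabM X Y\<close> is orthogonal to \<open>D\<close>.\<close>

lemma first_condition_iff:
  "OA X CY + vert (nabM X BY) \<in> sections \<A> \<D>\<^sub>2 \<longleftrightarrow> (\<forall>p. \<forall>w\<in>D p. g p (nabM X Y p) w = 0)"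
proof -
  let ?S = "OA X CY + vert (nabM X BY)"
  have nV: "nabM X BY \<in> M.VF" "nabM X CY \<in> M.VF" by (intro M.nab_VF horizontal_XY BY_CY)+
  have S: "?S = (\<lambda>q. vert (nabM X CY) q + vert (nabM X BY) q)"
    unfolding oneill_A_horizontal[OF horizontal_XY(1,2) BY_CY(4)] by (rule plus_fun_def)
  have SV: "?S \<in> M.VF" unfolding S by (intro M.VF_add vert_VF nV)
  have Sp: "?S p \<in> V p" for p unfolding S by (intro V_add vert_V nV)
  have Sw: "g p (?S p) w = g p (R p (nabM X Y p)) w" if w: "w \<in> D p" for p w
  proof -
    have "g p (?S p) w = g p (vert (nabM X CY) p) w + g p (vert (nabM X BY) p) w"
      unfolding S by (intro M.g_add_left V_T vert_V nV D_V w)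
    then show ?thesis
      unfolding vert_inner[OF nV(1) D_V[OF w]] vert_inner[OF nV(2) D_V[OF w]]
      using nab_BY_CY_inner[OF V_T[OF D_V[OF w]]] by simp
  qed
  have "?S \<in> sections \<A> \<D>\<^sub>2 \<longleftrightarrow> (\<forall>p. \<forall>w\<in>D p. g p (R p (nabM X Y p)) w = 0)"
    using SV Sp Sw unfolding sections_def D2_iff by auto
  also have "\<dots> \<longleftrightarrow> (\<forall>p. \<forall>w\<in>D p. g p (nabM X Y p) w = 0)"
  proof (intro iffI allI ballI)
    fix p w assume *: "\<forall>p. \<forall>w\<in>D p. g p (R p (nabM X Y p)) w = 0" and w: "w \<in> D p"
    obtain w' where w': "w' \<in> D p" "w = R p w'" using R_D_preimage[OF w] by blast
    then show "g p (nabM X Y p) w = 0"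
      using R_skew[OF nab_tangent(3) V_T[OF D_V[OF w'(1)]]] * by simp
  next
    fix p w assume *: "\<forall>p. \<forall>w\<in>D p. g p (nabM X Y p) w = 0" and w: "w \<in> D p"
    then show "g p (R p (nabM X Y p)) w = 0"
      using R_skew[OF nab_tangent(3) V_T[OF D_V[OF w]]] R_D_mem[OF w] by simp
  qed
  finally show ?thesis .
qed

text \<open>Since \<open>R\<close> is a parallel isometry, \<open>g (nabM X Y) U\<close> equals \<open>g (nabM X BY) (R U) + g (nabM X CY) (R U)\<close>.
  The first summand appears on the right hand side through the O'Neill tensor. The second one is
  \<open>- g CY (nabM X (R U))\<close> because \<open>CY\<close> and \<open>R U\<close> are orthogonal, and the second fundamental form of
  \<open>F\<close> expresses it by the pullback connection and the derivatives of \<open>ln lam\<close>. The terms with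
  \<open>ln lam\<close> cancel.\<close>

lemma second_condition_iff:
  assumes U: "U \<in> sections \<A> \<D>\<^sub>2"
  shows "gN (F p) (nabF X (\<lambda>q. dF (R q (U q))) p) (dF (CY p)) =
      (lam p)\<^sup>2 * g p (OA X BY p - CY p (\<lambda>p. ln (lam p)) *\<^sub>R X p +
        g p (X p) (CY p) *\<^sub>R gradient \<A> g (\<lambda>p. ln (lam p)) p) (R p (U p)) \<longleftrightarrow>
    g p (nabM X Y p) (U p) = 0"
proof -
  define \<phi> where "\<phi> = (\<lambda>p. ln (lam p))"
  define Q where "Q q = R q (U q)" for q
  note US = sections_D2[OF U]
  have Q: "Q \<in> sections \<A> H" unfolding Q_def by (rule US(5))
  have QV: "Q \<in> M.VF" and QH: "Q q \<in> H q" for q using Q by (auto simp: sections_def)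
  have CS: "CY \<in> sections \<A> H" using BY_CY by (simp add: sections_def)
  have CQ: "g q (CY q) (Q q) = 0" for q
    using BY_CY(5) US(2) unfolding mu_iff Q_def by blast
  have QC: "g q (Q q) (CY q) = 0" for q using CQ M.g_sym[OF H_T[OF QH] H_T[OF BY_CY(4)]] by simp
  have nV: "nabM X BY \<in> M.VF" by (intro M.nab_VF horizontal_XY BY_CY)
  have lhs: "gN (F p) (nabF X (\<lambda>q. dF (Q q)) p) (dF (CY p)) = (lam p)\<^sup>2 *
    (g p (nabM X Q p) (CY p) + Q p \<phi> * g p (X p) (CY p) - CY p \<phi> * g p (X p) (Q p))"
    using second_fundamental_form_horizontal[OF X Q CS] QC by (simp add: \<phi>_def)
  have grad: "gradient \<A> g \<phi> p \<in> M.T p" "g p (gradient \<A> g \<phi> p) (Q p) = Q p \<phi>"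
    using M.gradient_T[OF ln_lam_smooth] M.gradient_g[OF ln_lam_smooth M.VF_T[OF QV]]
    by (simp_all add: \<phi>_def)
  note T = H_T[OF hor_H[OF nV]] H_T[OF horizontal_XY(2)] H_T[OF QH]
  have rhs: "g p (OA X BY p - CY p \<phi> *\<^sub>R X p + g p (X p) (CY p) *\<^sub>R gradient \<A> g \<phi> p) (Q p) =
    g p (nabM X BY p) (Q p) - CY p \<phi> * g p (X p) (Q p) + g p (X p) (CY p) * Q p \<phi>"
    unfolding oneill_A_vertical[OF horizontal_XY(1,2) BY_CY(3)] hor_inner[OF nV QH, symmetric]
    by (simp only: M.g_add_left[OF M.T_diff[OF T(1) M.T_scale[OF T(2)]] M.T_scale[OF grad(1)] T(3)]
        M.g_diff_left[OF T(1) M.T_scale[OF T(2)] T(3)] M.g_scale_left[OF T(2) T(3)]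
        M.g_scale_left[OF grad(1) T(3)] grad(2))
  \<comment> \<open>Differentiating the orthogonality of \<open>Q\<close> and \<open>CY\<close> moves the derivative from one to the other.\<close>
  have "0 = X p (\<lambda>q. g q (Q q) (CY q))" using QC M.tangent_const[OF H_T[OF horizontal_XY(2)], of p 0] by simp
  also have "\<dots> = g p (nabM X Q p) (CY p) + g p (Q p) (nabM X CY p)"
    by (rule M.nab_metric[OF horizontal_XY(1) QV BY_CY(2)])
  also have "g p (Q p) (nabM X CY p) = g p (nabM X CY p) (Q p)"
    by (rule M.g_sym[OF T(3) nab_tangent(2)])
  finally have "g p (nabM X Q p) (CY p) = - g p (nabM X CY p) (Q p)" by simp
  moreover have "g p (nabM X BY p) (Q p) + g p (nabM X CY p) (Q p) = g p (nabM X Y p) (U p)"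
    unfolding nab_BY_CY_inner[OF T(3)] unfolding Q_def by (rule R_isometry[OF nab_tangent(3) US(4)])
  moreover have "(lam p)\<^sup>2 \<noteq> 0" using lam_pos[of p] by simp
  ultimately have "gN (F p) (nabF X (\<lambda>q. dF (Q q)) p) (dF (CY p)) =
      (lam p)\<^sup>2 * g p (OA X BY p - CY p \<phi> *\<^sub>R X p + g p (X p) (CY p) *\<^sub>R gradient \<A> g \<phi> p) (Q p) \<longleftrightarrow>
    g p (nabM X Y p) (U p) = 0"
    unfolding lhs rhs mult_left_cancel[OF \<open>(lam p)\<^sup>2 \<noteq> 0\<close>] by (intro iffI) (simp_all add: algebra_simps)
  then show ?thesis unfolding Q_def \<phi>_def .
qed

end

lemma condition_P_iff:
  "condition_P \<A> g nabM \<B> gN nabF F lam R D \<longleftrightarrow>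
    (\<forall>X\<in>sections \<A> H. \<forall>Y\<in>sections \<A> H. \<forall>U\<in>sections \<A> \<D>\<^sub>2.
      (\<forall>p. \<forall>w\<in>D p. g p (nabM X Y p) w = 0) \<and> (\<forall>p. g p (nabM X Y p) (U p) = 0))"
  unfolding condition_P_def Let_def
  by (intro ball_cong refl arg_cong2[where f = "(\<and>)"] first_condition_iff iff_allI second_condition_iff)

text \<open>The kernel of \<open>dF\<close> is the sum of \<open>D\<close> and \<open>\<D>\<^sub>2\<close>, so the two halves of the condition together say that
  \<open>nabM X Y\<close> is horizontal. For the \<open>\<D>\<^sub>2\<close>-half, which speaks of sections, every vector of \<open>\<D>\<^sub>2\<close> has to
  be extended to one.\<close>

theorem totally_geodesic_iff_condition_P:
  "totally_geodesic_foliation \<A> nabM H \<longleftrightarrow> condition_P \<A> g nabM \<B> gN nabF F lam R D"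
  unfolding condition_P_iff totally_geodesic_foliation_def
proof (intro iffI ballI)
  fix X Y U
  assume tg: "\<forall>X\<in>sections \<A> H. \<forall>Y\<in>sections \<A> H. nabM X Y \<in> sections \<A> H"
    and X: "X \<in> sections \<A> H" and Y: "Y \<in> sections \<A> H" and U: "U \<in> sections \<A> \<D>\<^sub>2"
  have "nabM X Y p \<in> H p" for p using tg X Y by (simp add: sections_def)
  then show "(\<forall>p. \<forall>w\<in>D p. g p (nabM X Y p) w = 0) \<and> (\<forall>p. g p (nabM X Y p) (U p) = 0)"
    using H_perp_V D_V sections_D2(3)[OF U] by blast
next
  fix X Y
  assume P: "\<forall>X\<in>sections \<A> H. \<forall>Y\<in>sections \<A> H. \<forall>U\<in>sections \<A> \<D>\<^sub>2.
      (\<forall>p. \<forall>w\<in>D p. g p (nabM X Y p) w = 0) \<and> (\<forall>p. g p (nabM X Y p) (U p) = 0)"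
    and X: "X \<in> sections \<A> H" and Y: "Y \<in> sections \<A> H"
  have VF: "nabM X Y \<in> M.VF" using X Y by (intro M.nab_VF) (auto simp: sections_def)
  have "nabM X Y p \<in> H p" for p
  proof -
    have "g p (nabM X Y p) w = 0" if w: "w \<in> V p" for w
    proof -
      obtain a b where ab: "a \<in> D p" "b \<in> \<D>\<^sub>2 p" "w = a + b" using V_decompose[OF w] by blast
      obtain U where U: "U \<in> sections \<A> \<D>\<^sub>2" "U p = b" using D2_extend[OF ab(2)] by blast
      have T: "a \<in> M.T p" "b \<in> M.T p" using ab D_V V_T by (auto simp: D2_iff)
      have "g p (nabM X Y p) a = 0" using P X Y zero_section ab(1) by blast
      moreover have "g p (nabM X Y p) b = 0" using P X Y U by blast
      ultimately show ?thesis unfolding ab(3) using M.g_add_right[OF T M.VF_T[OF VF]] by simp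
    qed
    then show ?thesis using M.VF_T[OF VF] by (simp add: H_iff)
  qed
  then show "nabM X Y \<in> sections \<A> H" using VF by (simp add: sections_def)
qed

end

section \<open>Hyperkaehler manifolds\<close>

theorem theorem3p12:
  fixes \<A> :: "('m::{t2_space, second_countable_topology}, 'e::real_inner) chart set"
    and \<B> :: "('n::{t2_space, second_countable_topology}, 'd::real_inner) chart set"
    and gM :: "'m metric" and gN :: "'n metric"
    and nabM :: "'m connection" and nabN :: "'n connection"
    and nabF :: "('m \<Rightarrow> 'm tangent) \<Rightarrow> ('m \<Rightarrow> 'n tangent) \<Rightarrow> 'm \<Rightarrow> 'n tangent"
    and I J K :: "'m endo"
    and F :: "'m \<Rightarrow> 'n" and lam :: "'m \<Rightarrow> real"
    and DI DJ DK :: "'m \<Rightarrow> 'm tangent set"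
  assumes "hyperkaehler \<A> gM nabM I J K"
    and "riemannian_manifold \<B> gN"
    and "levi_civita \<B> gN nabN"
    and "almost_h_conformal_semi_invariant_submersion \<A> gM \<B> gN F lam I J K DI DJ DK"
    and "pullback_connection \<A> \<B> F nabN nabF"
  shows "(totally_geodesic_foliation \<A> nabM (horizontal \<A> gM \<B> F) \<longleftrightarrow>
          condition_P \<A> gM nabM \<B> gN nabF F lam I DI) \<and>
         (condition_P \<A> gM nabM \<B> gN nabF F lam I DI \<longleftrightarrow>
          condition_P \<A> gM nabM \<B> gN nabF F lam J DJ) \<and>
         (condition_P \<A> gM nabM \<B> gN nabF F lam J DJ \<longleftrightarrow>
          condition_P \<A> gM nabM \<B> gN nabF F lam K DK)"
proof -
  have hk: "smooth_manifold \<A>" "riemannian_metric \<A> gM" "levi_civita \<A> gM nabM"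
    using assms(1) by (auto simp: hyperkaehler_def riemannian_manifold_def)
  have N: "smooth_manifold \<B>" "riemannian_metric \<B> gN"
    using assms(2) by (auto simp: riemannian_manifold_def)
  obtain BM :: "'e set" where BM: "onb BM" using hk(1) onb_exists unfolding smooth_manifold_def by blast
  obtain BN :: "'d set" where BN: "onb BN" using N(1) onb_exists unfolding smooth_manifold_def by blast
  have sub: "horizontally_conformal_submersion \<A> gM \<B> gN F lam"
    using assms(4) by (simp add: almost_h_conformal_semi_invariant_submersion_def)
  interpret conformal_submersion \<A> BM gM \<B> BN F nabM gN nabN nabF lam
    using hk N BM BN assms(3,5) sub
    by unfold_locales (auto simp: horizontally_conformal_submersion_def)
  have equiv: "totally_geodesic_foliation \<A> nabM (horizontal \<A> gM \<B> F) \<longleftrightarrow>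
      condition_P \<A> gM nabM \<B> gN nabF F lam R D"
    if "kaehler_structure \<A> gM nabM R" "semi_invariant_distribution \<A> gM \<B> F R D" for R D
  proof -
    interpret semi_invariant_submersion \<A> BM gM \<B> BN F nabM gN nabN nabF lam R D
      using that by unfold_locales
    show ?thesis by (rule totally_geodesic_iff_condition_P)
  qed
  have "kaehler_structure \<A> gM nabM I" "kaehler_structure \<A> gM nabM J" "kaehler_structure \<A> gM nabM K"
    using assms(1) by (simp_all add: hyperkaehler_def)
  then show ?thesis
    using assms(4) equiv unfolding almost_h_conformal_semi_invariant_submersion_def by metis
qed

end
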